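(* Consider the Lurye system $y_1=Gu_1$, $y_2=\phi u_2$, $u_1=r_1-y_2$, $u_2=y_1+r_2$, assumed well-posed, with $G:\mathcal{L}_{2e}\to\mathcal{L}_{2e}$ linear time-invariant, causal and stable, and $\phi:\mathcal{L}_{2e}\to\mathcal{L}_{2e}$ a (nonlinear) operator. Suppose that: (i) for $y=\phi u$, $y(t)=0$ whenever $u(t)=0$; the nonlinearity of $\phi$ is bounded below by $\underline{\alpha}$ and above by $\overline{\alpha}$, where $\underline{\alpha},\overline{\alpha}:\mathbb{R}\to\mathbb{R}$ are monotone and bounded, and $\underline\alpha(x)/x\ge 0$ for all $x\neq 0$; the nonlinearity is also bounded below by $\underline{\beta}$ and above by $\overline{\beta}$, where $\underline{\beta},\overline{\beta}:\mathbb{R}\to\mathbb{R}$ are monotone, bounded and odd, and $\underline\beta(x)/x\ge 0$ for all $x\neq 0$; (ii) there is a finite $A\ge 1$ such that $\overline{\alpha}$ is bounded above by $A\underline{\alpha}$, and there is a (possibly infinite) $B\ge A$ such that $\overline{\beta}$ is bounded above by $B\underline{\beta}$. Let $H_+$ and $H_-$ be (not necessarily causal) convolution operators whose impulse responses are respectively $h_+\in\mathbf{H_p}$ and $h_-\in\mathbf{H_p}$, satisfying $$A\|h_+\|_H+B\|h_-\|_H<1 .$$ Let $M=1-H_++H_-$. Then for any $u\in\mathcal{L}_2$, $$\int_{-\infty}^{\infty}(Mu)(t)\,(\phi u)(t)\,dt\ge 0 .$$ Furthermore the Lurye system is stable provided there exists $\varepsilon>0$ such that $$\mathrm{Re}\left[M(j\omega)G(j\omega)\right]\ge\varepsilon\quad\text{for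 all }\omega\in\mathbb{R}.$$
   Context: Signals are real-valued measurable functions of $t\in\mathbb{R}$. $\mathcal{L}_2$ is the space of square-integrable signals; $\mathcal{L}_{2e}$ is the extended space of signals all of whose truncations $x_T$ ($x_T(t)=x(t)$ for $t\le T$, $x_T(t)=0$ for $t>T$) lie in $\mathcal{L}_2$. Pointwise conditions on signals are understood for almost all $t$. The Lurye system is well-posed if for all $r_1,r_2\in\mathcal{L}_{2e}$ there are unique $u_1,u_2,y_1,y_2\in\mathcal{L}_{2e}$ satisfying its equations. It is stable if $r_1,r_2\in\mathcal{L}_2$ implies $u_1,u_2,y_1,y_2\in\mathcal{L}_2$. Stability of $G$ means that it maps $\mathcal{L}_2$ boundedly into $\mathcal{L}_2$; $G(j\omega)$ and $M(j\omega)$ denote frequency responses. A function $\alpha:\mathbb{R}\to\mathbb{R}$ is monotone if $\alpha(x_1)\ge\alpha(x_2)$ whenever $x_1\ge x_2$; bounded if there is $C\ge0$ with $|\alpha(x)|\le C|x|$ for all $x$; odd if $\alpha(-x)=-\alpha(x)$ for all $x$. The nonlinearity of $\phi$ (the possibly multivalued relation between $u(t)$ and $y(t)=(\phi u)(t)$) is bounded below by $\underline\alpha$ and above by $\overline\alpha$ if, for all $u\in\mathcal{L}_{2e}$ and $y=\phi u$, $\frac{\underline\alpha(u(t))}{u(t)}\le\frac{y(t)}{u(t)}\le\frac{\overline\alpha(u(t))}{u(t)}$ for all $t$ with $u(t)\ne0$. The operator $\phi$ need not be memoryless or time-invariant. A function $f:\mathbb{R}\to\mathbb{R}$ is bounded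 above by $g:\mathbb{R}\to\mathbb{R}$ if $f(x)/x\le g(x)/x$ for all $x\ne0$. When $B=\infty$ the condition that $\overline\beta$ is bounded above by $B\underline\beta$ is void, and $B\|h_-\|_H$ is read as $0$ if $h_-=0$ and $\infty$ otherwise. $\mathbf{H}$ is the set of generalized functions $h(t)=\sum_i h_i\delta(t-t_i)+h_a(t)$ with $t_i\neq0$, $h_a(0)=0$, $h_i\in\mathbb{R}$, $h_a(t)\in\mathbb{R}$, and $\|h\|_H=\sum_i|h_i|+\int_{-\infty}^{\infty}|h_a(t)|\,dt<\infty$. $\mathbf{H_p}\subset\mathbf{H}$ is the subset with $h_i\ge0$ for all $i$ and $h_a(t)\ge0$ for all $t$. $M=1-H_++H_-$ has impulse response $\delta(t)-h_+(t)+h_-(t)$. *)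

theory Defs
  imports "HOL-Analysis.Analysis"
begin

text \<open>
  Signals are Borel functions of type \<open>real \<Rightarrow> real\<close>. They are not quotiented: equality of signals
  is equality almost everywhere, and operators are required to respect it.
\<close>

definition sig_eq :: "(real \<Rightarrow> real) \<Rightarrow> (real \<Rightarrow> real) \<Rightarrow> bool" where
  "sig_eq x y \<longleftrightarrow> (AE t in lborel. x t = y t)"

definition L2 :: "(real \<Rightarrow> real) set" where
  "L2 = {x \<in> borel_measurable borel. integrable lborel (\<lambda>t. (x t)\<^sup>2)}"

definition L2_norm :: "(real \<Rightarrow> real) \<Rightarrow> real" where
  "L2_norm x = sqrt (LINT t|lborel. (x t)\<^sup>2)"

definition trunc :: "real \<Rightarrow> (real \<Rightarrow> real) \<Rightarrow> real \<Rightarrow> real" where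
  "trunc T x = (\<lambda>t. if t \<le> T then x t else 0)"

definition L2e :: "(real \<Rightarrow> real) set" where
  "L2e = {x \<in> borel_measurable borel. \<forall>T. trunc T x \<in> L2}"

type_synonym sig_op = "(real \<Rightarrow> real) \<Rightarrow> (real \<Rightarrow> real)"

definition L2e_operator :: "sig_op \<Rightarrow> bool" where
  "L2e_operator F \<longleftrightarrow>
     (\<forall>x\<in>L2e. F x \<in> L2e) \<and>
     (\<forall>x\<in>L2e. \<forall>y\<in>L2e. sig_eq x y \<longrightarrow> sig_eq (F x) (F y))"

definition linear_operator :: "sig_op \<Rightarrow> bool" where
  "linear_operator F \<longleftrightarrow>
     (\<forall>x\<in>L2e. \<forall>y\<in>L2e. \<forall>a b.
        sig_eq (F (\<lambda>t. a * x t + b * y t)) (\<lambda>t. a * F x t + b * F y t))"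

definition time_invariant :: "sig_op \<Rightarrow> bool" where
  "time_invariant F \<longleftrightarrow>
     (\<forall>x\<in>L2e. \<forall>\<tau>. sig_eq (F (\<lambda>t. x (t - \<tau>))) (\<lambda>t. F x (t - \<tau>)))"

definition causal :: "sig_op \<Rightarrow> bool" where
  "causal F \<longleftrightarrow> (\<forall>x\<in>L2e. \<forall>T. sig_eq (trunc T (F x)) (trunc T (F (trunc T x))))"

definition stable_operator :: "sig_op \<Rightarrow> bool" where
  "stable_operator F \<longleftrightarrow>
     (\<exists>K. \<forall>x\<in>L2. F x \<in> L2 \<and> L2_norm (F x) \<le> K * L2_norm x)"

definition lurye_eqs ::
  "sig_op \<Rightarrow> sig_op \<Rightarrow> (real \<Rightarrow> real) \<Rightarrow> (real \<Rightarrow> real) \<Rightarrow>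
   (real \<Rightarrow> real) \<Rightarrow> (real \<Rightarrow> real) \<Rightarrow> (real \<Rightarrow> real) \<Rightarrow> (real \<Rightarrow> real) \<Rightarrow> bool" where
  "lurye_eqs G \<phi> r1 r2 u1 u2 y1 y2 \<longleftrightarrow>
     sig_eq y1 (G u1) \<and> sig_eq y2 (\<phi> u2) \<and>
     sig_eq u1 (\<lambda>t. r1 t - y2 t) \<and> sig_eq u2 (\<lambda>t. y1 t + r2 t)"

definition well_posed :: "sig_op \<Rightarrow> sig_op \<Rightarrow> bool" where
  "well_posed G \<phi> \<longleftrightarrow>
     (\<forall>r1\<in>L2e. \<forall>r2\<in>L2e.
        (\<exists>u1\<in>L2e. \<exists>u2\<in>L2e. \<exists>y1\<in>L2e. \<exists>y2\<in>L2e. lurye_eqs G \<phi> r1 r2 u1 u2 y1 y2) \<and>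
        (\<forall>u1\<in>L2e. \<forall>u2\<in>L2e. \<forall>y1\<in>L2e. \<forall>y2\<in>L2e.
         \<forall>u1'\<in>L2e. \<forall>u2'\<in>L2e. \<forall>y1'\<in>L2e. \<forall>y2'\<in>L2e.
           lurye_eqs G \<phi> r1 r2 u1 u2 y1 y2 \<longrightarrow> lurye_eqs G \<phi> r1 r2 u1' u2' y1' y2' \<longrightarrow>
           sig_eq u1 u1' \<and> sig_eq u2 u2' \<and> sig_eq y1 y1' \<and> sig_eq y2 y2'))"

definition lurye_stable :: "sig_op \<Rightarrow> sig_op \<Rightarrow> bool" where
  "lurye_stable G \<phi> \<longleftrightarrow>
     (\<forall>r1\<in>L2. \<forall>r2\<in>L2. \<forall>u1\<in>L2e. \<forall>u2\<in>L2e. \<forall>y1\<in>L2e. \<forall>y2\<in>L2e.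
        lurye_eqs G \<phi> r1 r2 u1 u2 y1 y2 \<longrightarrow> u1 \<in> L2 \<and> u2 \<in> L2 \<and> y1 \<in> L2 \<and> y2 \<in> L2)"

definition bounded_fun :: "(real \<Rightarrow> real) \<Rightarrow> bool" where
  "bounded_fun \<alpha> \<longleftrightarrow> (\<exists>C\<ge>0. \<forall>x. \<bar>\<alpha> x\<bar> \<le> C * \<bar>x\<bar>)"

definition odd_fun :: "(real \<Rightarrow> real) \<Rightarrow> bool" where
  "odd_fun \<alpha> \<longleftrightarrow> (\<forall>x. \<alpha> (- x) = - \<alpha> x)"

definition fun_bounded_above :: "(real \<Rightarrow> real) \<Rightarrow> (real \<Rightarrow> real) \<Rightarrow> bool" where
  "fun_bounded_above f g \<longleftrightarrow> (\<forall>x. x \<noteq> 0 \<longrightarrow> f x / x \<le> g x / x)"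

definition zero_at_zero :: "sig_op \<Rightarrow> bool" where
  "zero_at_zero \<phi> \<longleftrightarrow> (\<forall>u\<in>L2e. AE t in lborel. u t = 0 \<longrightarrow> \<phi> u t = 0)"

definition nonlinearity_bounded_below :: "sig_op \<Rightarrow> (real \<Rightarrow> real) \<Rightarrow> bool" where
  "nonlinearity_bounded_below \<phi> \<alpha> \<longleftrightarrow>
     (\<forall>u\<in>L2e. AE t in lborel. u t \<noteq> 0 \<longrightarrow> \<alpha> (u t) / u t \<le> \<phi> u t / u t)"

definition nonlinearity_bounded_above :: "sig_op \<Rightarrow> (real \<Rightarrow> real) \<Rightarrow> bool" where
  "nonlinearity_bounded_above \<phi> \<alpha> \<longleftrightarrow>
     (\<forall>u\<in>L2e. AE t in lborel. u t \<noteq> 0 \<longrightarrow> \<phi> u t / u t \<le> \<alpha> (u t) / u t)"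

text \<open>
  The generalized function \<open>\<Sum>i. weight i * \<delta>(t - loc i) + dens t\<close>. Locations are distinct, so that
  \<open>H_norm\<close> is the total variation; finitely many atoms are padded with atoms of weight 0.
\<close>

record gen_fun =
  loc :: "nat \<Rightarrow> real"
  weight :: "nat \<Rightarrow> real"
  dens :: "real \<Rightarrow> real"

definition H_set :: "gen_fun set" where
  "H_set = {h. inj (loc h) \<and> (\<forall>i. loc h i \<noteq> 0) \<and> dens h 0 = 0 \<and>
               summable (\<lambda>i. \<bar>weight h i\<bar>) \<and> integrable lborel (dens h)}"

definition H_norm :: "gen_fun \<Rightarrow> real" where
  "H_norm h = (\<Sum>i. \<bar>weight h i\<bar>) + (LINT t|lborel. \<bar>dens h t\<bar>)"

definition Hp_set :: "gen_fun set" where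
  "Hp_set = {h \<in> H_set. (\<forall>i. 0 \<le> weight h i) \<and> (\<forall>t. 0 \<le> dens h t)}"

text \<open>For \<open>x \<in> L2\<close> the series and the integral converge absolutely for almost every \<open>t\<close>.\<close>

definition conv_op :: "gen_fun \<Rightarrow> sig_op" where
  "conv_op h x = (\<lambda>t. (\<Sum>i. weight h i * x (t - loc h i))
                      + (LINT \<tau>|lborel. dens h \<tau> * x (t - \<tau>)))"

definition gen_fourier :: "gen_fun \<Rightarrow> real \<Rightarrow> complex" where
  "gen_fourier h \<omega> = (\<Sum>i. complex_of_real (weight h i) * cis (- \<omega> * loc h i))
                      + (LINT t|lborel. complex_of_real (dens h t) * cis (- \<omega> * t))"

definition mult_op :: "gen_fun \<Rightarrow> gen_fun \<Rightarrow> sig_op" where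
  "mult_op hp hm x = (\<lambda>t. x t - conv_op hp x t + conv_op hm x t)"

definition mult_freq :: "gen_fun \<Rightarrow> gen_fun \<Rightarrow> real \<Rightarrow> complex" where
  "mult_freq hp hm \<omega> = 1 - gen_fourier hp \<omega> + gen_fourier hm \<omega>"

text \<open>
  \<open>X\<close> is the Fourier-Plancherel transform of \<open>x \<in> L2\<close>: the limit in the mean of the Fourier
  integrals over \<open>{-T..T}\<close>. It is determined up to null sets.
\<close>

definition has_fourier_transform :: "(real \<Rightarrow> real) \<Rightarrow> (real \<Rightarrow> complex) \<Rightarrow> bool" where
  "has_fourier_transform x X \<longleftrightarrow>
     X \<in> borel_measurable borel \<and>
     ((\<lambda>T. \<integral>\<^sup>+ \<omega>. ennreal ((cmod (X \<omega> -
          (LINT t:{-T..T}|lborel. complex_of_real (x t) * cis (- \<omega> * t))))\<^sup>2) \<partial>lborel)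
       \<longlongrightarrow> 0) at_top"

text \<open>
  \<open>Ghat \<omega>\<close> stands for \<open>G(j\<omega>)\<close>, the Fourier multiplier of \<open>G\<close> on \<open>L2\<close>; like the transform itself
  it is determined up to null sets.
\<close>

definition frequency_response :: "sig_op \<Rightarrow> (real \<Rightarrow> complex) \<Rightarrow> bool" where
  "frequency_response G Ghat \<longleftrightarrow>
     Ghat \<in> borel_measurable borel \<and>
     (\<forall>x\<in>L2. \<forall>X. has_fourier_transform x X \<longrightarrow>
        has_fourier_transform (G x) (\<lambda>\<omega>. Ghat \<omega> * X \<omega>))"

end

theory Submission imports Defs "HOL-Probability.Probability" begin

text \<open>
  Positivity. If \<open>y\<close> lies between \<open>f u\<close> and \<open>K f u\<close> with \<open>f\<close> monotone and \<open>F\<close> its integral, then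
  convexity gives \<open>v y \<le> K u y + K (F v - F u)\<close> pointwise. With \<open>v\<close> a shift of \<open>u\<close> the
  potential terms integrate to zero, so the cross correlation of \<open>u\<close> and \<open>y\<close> is at most
  \<open>K \<langle>u, y\<rangle>\<close>, and at least \<open>- K \<langle>u, y\<rangle>\<close> if \<open>f\<close> is odd; averaging over \<open>h\<^sub>+\<close> and \<open>h\<^sub>-\<close>
  yields \<open>\<langle>M u, y\<rangle> \<ge> 0\<close>. Only the pointwise relation between \<open>u\<close> and \<open>y\<close> enters.

  Stability. Parseval's identity turns the frequency condition into \<open>\<langle>M G q, q\<rangle> \<ge> \<epsilon> \<parallel>q\<parallel>\<^sup>2\<close>. As
  \<open>M\<close> is not causal, one would classically factorise it. Instead, since \<open>\<parallel>M - 1\<parallel> < 1\<close>, the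
  compressions of \<open>M\<close> and of its adjoint to signals on \<open>{T<..}\<close> are invertible, and the loop
  signals can be continued beyond \<open>T\<close> in such a way that the inequality \<open>\<langle>M u, y\<rangle> \<ge> 0\<close> only
  involves their values up to \<open>T\<close>. This bounds the truncations of \<open>y2\<close> uniformly in \<open>T\<close>.
\<close>

section \<open>Square-integrable signals\<close>

text \<open>The truncation argument needs continuations beyond \<open>T\<close> that do not fit
  together. The sector relation asks for \<open>y2\<close> to be continued by
  \<open>\<phi> u'\<close>, the loop equation for \<open>u2\<close> to be continued by
  \<open>G (r1 - y'') + r2\<close>, and the continuations obtained from the compressions satisfy
  neither. This is harmless: beyond \<open>T\<close> both \<open>M u'\<close> and the adjoint
  applied to \<open>y''\<close> are almost zero, so replacing the partner there costs only a small
  multiple of its norm. That smallness is chosen last, after all norms in play are bounded.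

  On the frequency side the response is given only through limits in the mean, and
  \<open>G q\<close> need not be integrable. Parseval's identity is therefore derived for integrable
  signals, with a Gaussian damping that is removed in the limit, and it reaches \<open>G q\<close>
  by clipping to bounded intervals. Coercivity is obtained for continuous \<open>q\<close> of
  compact support, whose transform is an honest integral, and extended by density.

  The factor 2 in the final bound stems from
  \<open>\<parallel>M\<parallel> \<le> 1 + H_norm hp + H_norm hm < 2\<close>.\<close>

lemma integrable_mult_of_squares:
  fixes f g :: "'a \<Rightarrow> real"
  assumes [measurable]: "f \<in> borel_measurable M" "g \<in> borel_measurable M"
    and "integrable M (\<lambda>x. (f x)\<^sup>2)" "integrable M (\<lambda>x. (g x)\<^sup>2)"
  shows "integrable M (\<lambda>x. f x * g x)"
proof (rule Bochner_Integration.integrable_bound)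
  show "integrable M (\<lambda>x. (f x)\<^sup>2 + (g x)\<^sup>2)" using assms by simp
  have "\<bar>a * b\<bar> \<le> a\<^sup>2 + b\<^sup>2" for a b :: real
  proof -
    have "2 * (\<bar>a\<bar> * \<bar>b\<bar>) \<le> a\<^sup>2 + b\<^sup>2" using sum_squares_bound[of "\<bar>a\<bar>" "\<bar>b\<bar>"] by simp
    moreover have "0 \<le> \<bar>a\<bar> * \<bar>b\<bar>" by simp
    ultimately show ?thesis unfolding abs_mult by linarith
  qed
  then show "AE x in M. norm (f x * g x) \<le> norm ((f x)\<^sup>2 + (g x)\<^sup>2)" by simp
qed simp

lemma integral_Cauchy_Schwarz:
  fixes f g :: "'a \<Rightarrow> real"
  assumes [measurable]: "f \<in> borel_measurable M" "g \<in> borel_measurable M"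
    and f: "integrable M (\<lambda>x. (f x)\<^sup>2)" and g: "integrable M (\<lambda>x. (g x)\<^sup>2)"
  shows "(LINT x|M. f x * g x)\<^sup>2 \<le> (LINT x|M. (f x)\<^sup>2) * (LINT x|M. (g x)\<^sup>2)"
proof -
  let ?F = "LINT x|M. (f x)\<^sup>2" and ?G = "LINT x|M. (g x)\<^sup>2" and ?I = "LINT x|M. f x * g x"
  have fg: "integrable M (\<lambda>x. f x * g x)" using integrable_mult_of_squares assms by blast
  have q: "0 \<le> a\<^sup>2 * ?F - 2 * a * b * ?I + b\<^sup>2 * ?G" for a b
  proof -
    have "0 \<le> (LINT x|M. (a * f x - b * g x)\<^sup>2)" by simp
    also have "(\<lambda>x. (a * f x - b * g x)\<^sup>2) = (\<lambda>x. a\<^sup>2 * (f x)\<^sup>2 - 2 * a * b * (f x * g x) + b\<^sup>2 * (g x)\<^sup>2)"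
      by (auto simp: power2_eq_square algebra_simps)
    also have "(LINT x|M. a\<^sup>2 * (f x)\<^sup>2 - 2 * a * b * (f x * g x) + b\<^sup>2 * (g x)\<^sup>2)
       = a\<^sup>2 * ?F - 2 * a * b * ?I + b\<^sup>2 * ?G"
      using f g fg by simp
    finally show ?thesis .
  qed
  have F: "0 \<le> ?F" and G: "0 \<le> ?G" by simp_all
  show ?thesis
  proof (cases "?G = 0")
    case True
    have "?I = 0"
    proof (rule ccontr)
      assume "?I \<noteq> 0"
      \<comment> \<open>This choice of \<open>b\<close> gives the quadratic form the value
        -1.\<close>
      then show False
        using q[of 1 "(?F + 1) / (2 * ?I)"] by (simp add: True)
    qed
    then show ?thesis by (simp add: True)
  next
    case False
    then have "0 < ?G" using G by linarith
    \<comment> \<open>The form at \<open>a = ?G\<close>, \<open>b = ?I\<close> is its minimum over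
      \<open>b\<close>, up to scaling; the common factor \<open>?G\<close> is then
      cancelled.\<close>
    have "?G * 0 \<le> ?G * (?G * ?F - ?I\<^sup>2)"
      using q[of "?G" "?I"] by (simp add: power2_eq_square algebra_simps)
    then have "0 \<le> ?G * ?F - ?I\<^sup>2"
      by (rule mult_left_le_imp_le) fact
    then show ?thesis by (simp add: mult.commute)
  qed
qed

section \<open>Inner product and norm of square-integrable signals\<close>

definition L2_inner :: "(real \<Rightarrow> real) \<Rightarrow> (real \<Rightarrow> real) \<Rightarrow> real" where
  "L2_inner x y = (LINT t|lborel. x t * y t)"

lemma L2_measurable [measurable_dest]: "x \<in> L2 \<Longrightarrow> x \<in> borel_measurable borel"
  by (simp add: L2_def)

lemma L2_integrable_mult: "x \<in> L2 \<Longrightarrow> y \<in> L2 \<Longrightarrow> integrable lborel (\<lambda>t. x t * y t)"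
  unfolding L2_def by (intro integrable_mult_of_squares) auto

lemma L2_lincomb:
  assumes "x \<in> L2" "y \<in> L2"
  shows "(\<lambda>t. a * x t + b * y t) \<in> L2"
proof -
  have "(\<lambda>t. (a * x t + b * y t)\<^sup>2) = (\<lambda>t. a\<^sup>2 * (x t)\<^sup>2 + b\<^sup>2 * (y t)\<^sup>2 + 2 * a * b * (x t * y t))"
    by (auto simp: power2_eq_square algebra_simps)
  moreover have "integrable lborel (\<lambda>t. a\<^sup>2 * (x t)\<^sup>2 + b\<^sup>2 * (y t)\<^sup>2 + 2 * a * b * (x t * y t))"
    using L2_integrable_mult[OF assms] assms by (auto simp: L2_def)
  ultimately show ?thesis using assms by (auto simp: L2_def)
qed

lemma L2_add: "x \<in> L2 \<Longrightarrow> y \<in> L2 \<Longrightarrow> (\<lambda>t. x t + y t) \<in> L2"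
  using L2_lincomb[of x y 1 1] by simp

lemma L2_diff: "x \<in> L2 \<Longrightarrow> y \<in> L2 \<Longrightarrow> (\<lambda>t. x t - y t) \<in> L2"
  using L2_lincomb[of x y 1 "-1"] by simp

lemma L2_zero: "(\<lambda>t. 0) \<in> L2"
  by (simp add: L2_def)

lemma L2_cmult: "x \<in> L2 \<Longrightarrow> (\<lambda>t. a * x t) \<in> L2"
  using L2_lincomb[of x x a 0] by simp

lemma L2_bound:
  assumes [measurable]: "x \<in> borel_measurable borel" and y: "y \<in> L2"
    and b: "AE t in lborel. \<bar>x t\<bar> \<le> \<bar>y t\<bar>"
  shows "x \<in> L2" "L2_norm x \<le> L2_norm y"
proof -
  have b2: "AE t in lborel. (x t)\<^sup>2 \<le> (y t)\<^sup>2"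
    using b by eventually_elim (simp add: abs_le_square_iff)
  have "integrable lborel (\<lambda>t. (x t)\<^sup>2)"
    by (rule Bochner_Integration.integrable_bound[of _ "\<lambda>t. (y t)\<^sup>2"])
      (use y b2 in \<open>auto simp: L2_def\<close>)
  then show x: "x \<in> L2" by (simp add: L2_def)
  show "L2_norm x \<le> L2_norm y"
    unfolding L2_norm_def real_sqrt_le_iff
    by (rule integral_mono_AE) (use x y b2 in \<open>auto simp: L2_def\<close>)
qed

lemma L2_cong_AE:
  assumes "x \<in> borel_measurable borel" "y \<in> L2" "AE t in lborel. x t = y t"
  shows "x \<in> L2" "L2_norm x = L2_norm y"
proof -
  show x: "x \<in> L2" by (rule L2_bound[of _ y]) (use assms in auto)
  show "L2_norm x = L2_norm y"
    by (intro order_antisym; rule L2_bound) (use assms x in auto)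
qed

lemma L2_norm_nonneg [simp]: "0 \<le> L2_norm x"
  by (simp add: L2_norm_def)

lemma L2_norm_square: "(L2_norm x)\<^sup>2 = L2_inner x x"
  by (simp add: L2_norm_def L2_inner_def power2_eq_square)

lemma L2_inner_commute: "L2_inner x y = L2_inner y x"
  by (simp add: L2_inner_def mult.commute)

lemma L2_inner_cong_AE:
  assumes "AE t in lborel. x t = x' t" "AE t in lborel. y t = y' t"
    and [measurable]: "x \<in> borel_measurable borel" "x' \<in> borel_measurable borel"
      "y \<in> borel_measurable borel" "y' \<in> borel_measurable borel"
  shows "L2_inner x y = L2_inner x' y'"
  unfolding L2_inner_def
proof (rule integral_cong_AE)
  show "AE t in lborel. x t * y t = x' t * y' t" using assms(1,2) by eventually_elim simp
qed measurable

lemma L2_inner_lincomb_left: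
  assumes "x \<in> L2" "y \<in> L2" "z \<in> L2"
  shows "L2_inner (\<lambda>t. a * x t + b * y t) z = a * L2_inner x z + b * L2_inner y z"
proof -
  have "L2_inner (\<lambda>t. a * x t + b * y t) z
     = (LINT t|lborel. a * (x t * z t) + b * (y t * z t))"
    unfolding L2_inner_def by (rule Bochner_Integration.integral_cong) (auto simp: algebra_simps)
  also have "\<dots> = a * L2_inner x z + b * L2_inner y z"
    using L2_integrable_mult assms by (simp add: L2_inner_def)
  finally show ?thesis .
qed

lemma L2_inner_add_left:
  "x \<in> L2 \<Longrightarrow> y \<in> L2 \<Longrightarrow> z \<in> L2 \<Longrightarrow>
    L2_inner (\<lambda>t. x t + y t) z = L2_inner x z + L2_inner y z"
  using L2_inner_lincomb_left[of x y z 1 1] by simp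

lemma L2_inner_diff_left:
  "x \<in> L2 \<Longrightarrow> y \<in> L2 \<Longrightarrow> z \<in> L2 \<Longrightarrow>
    L2_inner (\<lambda>t. x t - y t) z = L2_inner x z - L2_inner y z"
  using L2_inner_lincomb_left[of x y z 1 "-1"] by simp

lemma L2_inner_add_right:
  "x \<in> L2 \<Longrightarrow> y \<in> L2 \<Longrightarrow> z \<in> L2 \<Longrightarrow>
    L2_inner z (\<lambda>t. x t + y t) = L2_inner z x + L2_inner z y"
  using L2_inner_add_left L2_inner_commute by metis

lemma L2_inner_diff_right:
  "x \<in> L2 \<Longrightarrow> y \<in> L2 \<Longrightarrow> z \<in> L2 \<Longrightarrow>
    L2_inner z (\<lambda>t. x t - y t) = L2_inner z x - L2_inner z y"
  using L2_inner_diff_left L2_inner_commute by metis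

lemma L2_Cauchy_Schwarz:
  assumes "x \<in> L2" "y \<in> L2"
  shows "\<bar>L2_inner x y\<bar> \<le> L2_norm x * L2_norm y"
proof -
  have "(L2_inner x y)\<^sup>2 \<le> (LINT t|lborel. (x t)\<^sup>2) * (LINT t|lborel. (y t)\<^sup>2)"
    unfolding L2_inner_def by (rule integral_Cauchy_Schwarz) (use assms in \<open>auto simp: L2_def\<close>)
  from real_sqrt_le_mono[OF this] show ?thesis
    by (simp add: L2_norm_def real_sqrt_mult)
qed

lemma L2_norm_add:
  assumes "x \<in> L2" "y \<in> L2"
  shows "L2_norm (\<lambda>t. x t + y t) \<le> L2_norm x + L2_norm y"
proof -
  have "(L2_norm (\<lambda>t. x t + y t))\<^sup>2 = (L2_norm x)\<^sup>2 + 2 * L2_inner x y + (L2_norm y)\<^sup>2"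
    unfolding L2_norm_square using assms
    by (simp add: L2_inner_add_left L2_inner_add_right L2_add L2_inner_commute[of y x])
  also have "\<dots> \<le> (L2_norm x)\<^sup>2 + 2 * (L2_norm x * L2_norm y) + (L2_norm y)\<^sup>2"
    using L2_Cauchy_Schwarz[OF assms] by linarith
  also have "\<dots> = (L2_norm x + L2_norm y)\<^sup>2" by (simp add: power2_sum)
  finally show ?thesis by (rule power2_le_imp_le) simp
qed

lemma L2_norm_cmult: "L2_norm (\<lambda>t. a * x t) = \<bar>a\<bar> * L2_norm x"
  by (simp add: L2_norm_def power_mult_distrib real_sqrt_mult)

lemma L2_norm_diff:
  assumes "x \<in> L2" "y \<in> L2"
  shows "L2_norm (\<lambda>t. x t - y t) \<le> L2_norm x + L2_norm y"
  using L2_norm_add[OF assms(1) L2_cmult[OF assms(2), of "-1"]] L2_norm_cmult[of "-1" y] by simp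

lemma L2_trunc: "x \<in> L2 \<Longrightarrow> trunc T x \<in> L2"
  by (rule L2_bound[of _ x]) (auto simp: trunc_def L2_measurable)

lemma L2_subset_L2e: "x \<in> L2 \<Longrightarrow> x \<in> L2e"
  by (simp add: L2e_def L2_measurable L2_trunc)

lemma L2_indicator: "x \<in> L2 \<Longrightarrow> S \<in> sets borel \<Longrightarrow> (\<lambda>t. indicator S t * x t) \<in> L2"
  by (rule L2_bound[of _ x]) (auto simp: L2_measurable indicator_def)

section \<open>Convolution operators\<close>

lemma lborel_integral_shift:
  fixes f :: "real \<Rightarrow> 'a::{banach, second_countable_topology}"
  shows "(LINT t|lborel. f (t - s)) = (LINT t|lborel. f t)"
  using lborel_integral_real_affine[of 1 f "- s"] by simp

lemma lborel_integrable_shift: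
  fixes f :: "real \<Rightarrow> 'a::{banach, second_countable_topology}"
  shows "integrable lborel f \<Longrightarrow> integrable lborel (\<lambda>t. f (t - s))"
  using lborel_integrable_real_affine[of f 1 "- s"] by simp

lemma L2_shift:
  assumes "x \<in> L2"
  shows "(\<lambda>t. x (t - s)) \<in> L2" "L2_norm (\<lambda>t. x (t - s)) = L2_norm x"
  using assms lborel_integrable_shift[of "\<lambda>t. (x t)\<^sup>2" s] lborel_integral_shift[of "\<lambda>t. (x t)\<^sup>2" s]
  by (auto simp: L2_def L2_norm_def)

lemma L2_inner_shift_bound:
  "x \<in> L2 \<Longrightarrow> y \<in> L2 \<Longrightarrow> \<bar>L2_inner (\<lambda>t. x (t - s)) y\<bar> \<le> L2_norm x * L2_norm y"
  using L2_Cauchy_Schwarz[OF L2_shift(1), of x y s] L2_shift(2)[of x s] by simp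

lemma L2_inner_shift_measurable [measurable]:
  assumes [measurable]: "x \<in> borel_measurable borel" "y \<in> borel_measurable borel"
  shows "(\<lambda>s. L2_inner (\<lambda>t. x (t - s)) y) \<in> borel_measurable borel"
  unfolding L2_inner_def by measurable

text \<open>By Tonelli the shift can be integrated last. Each shift leaves the norm of
  \<open>x\<close> unchanged, so the double integral is the mass of \<open>N\<close> times that of
  the square.\<close>

lemma integrable_shifted_square:
  assumes "finite_measure N" and [measurable]: "l \<in> borel_measurable N" and x: "x \<in> L2"
  shows "integrable (lborel \<Otimes>\<^sub>M N) (\<lambda>(t, n). (x (t - l n))\<^sup>2)"
proof -
  interpret N: finite_measure N by fact
  interpret pair_sigma_finite lborel N ..
  note [measurable] = L2_measurable[OF x]
  have "(\<lambda>t. (x t)\<^sup>2) \<in> borel_measurable borel" by measurable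
  have "(\<integral>\<^sup>+ p. ennreal (norm (case p of (t, n) \<Rightarrow> (x (t - l n))\<^sup>2)) \<partial>(lborel \<Otimes>\<^sub>M N))
     = (\<integral>\<^sup>+ n. (\<integral>\<^sup>+ t. ennreal ((x (t - l n))\<^sup>2) \<partial>lborel) \<partial>N)"
    by (subst nn_integral_snd[symmetric]) auto
  also have "\<dots> = (\<integral>\<^sup>+ n. ennreal (LINT t|lborel. (x t)\<^sup>2) \<partial>N)"
  proof (rule nn_integral_cong)
    fix n
    have "(\<integral>\<^sup>+ t. ennreal ((x (t - l n))\<^sup>2) \<partial>lborel) = ennreal (LINT t|lborel. (x (t - l n))\<^sup>2)"
      by (rule nn_integral_eq_integral) (use L2_shift(1)[OF x, of "l n"] in \<open>auto simp: L2_def\<close>)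
    then show "(\<integral>\<^sup>+ t. ennreal ((x (t - l n))\<^sup>2) \<partial>lborel) = ennreal (LINT t|lborel. (x t)\<^sup>2)"
      using lborel_integral_shift[of "\<lambda>t. (x t)\<^sup>2"] by simp
  qed
  also have "\<dots> < \<infinity>"
    by (simp add: ennreal_mult_eq_top_iff less_top[symmetric])
  finally show ?thesis by (intro integrableI_bounded) (auto simp: case_prod_beta)
qed

text \<open>Convolution with the image of the finite positive measure \<open>N\<close> under
  \<open>l\<close>. One setting covers three cases: the atoms of an impulse response
  (\<open>l = loc h\<close>), its density (\<open>l\<close> the identity) and Gaussian smoothing
  (\<open>l z = \<sigma> * z\<close> under the normal law).\<close>

locale shift_average = finite_measure N for N :: "'n measure" +
  fixes l :: "'n \<Rightarrow> real"
  assumes l_measurable [measurable]: "l \<in> borel_measurable N"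
begin

definition avg :: "(real \<Rightarrow> real) \<Rightarrow> real \<Rightarrow> real" where
  "avg x t = (LINT n|N. x (t - l n))"

sublocale P: pair_sigma_finite lborel N ..

lemma integrable_shifted_mult:
  assumes x: "x \<in> L2" and y: "y \<in> L2"
  shows "integrable (lborel \<Otimes>\<^sub>M N) (\<lambda>(t, n). x (t - l n) * y t)"
proof -
  note [measurable] = L2_measurable[OF x] L2_measurable[OF y]
  have "integrable (lborel \<Otimes>\<^sub>M N) (\<lambda>p. x (fst p - l (snd p)) * y (fst p))"
  proof (rule integrable_mult_of_squares)
    show "integrable (lborel \<Otimes>\<^sub>M N) (\<lambda>p. (x (fst p - l (snd p)))\<^sup>2)"
      using integrable_shifted_square[OF finite_measure_axioms l_measurable x]
      by (simp add: case_prod_beta')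
    \<comment> \<open>A function of \<open>t\<close> alone is its own shift by zero.\<close>
    show "integrable (lborel \<Otimes>\<^sub>M N) (\<lambda>p. (y (fst p))\<^sup>2)"
      using integrable_shifted_square[OF finite_measure_axioms, of "\<lambda>_. 0" y] y
      by (simp add: case_prod_beta')
  qed measurable
  then show ?thesis by (simp add: case_prod_beta')
qed

lemma AE_integrable_shifts:
  assumes x: "x \<in> L2"
  shows "AE t in lborel. integrable N (\<lambda>n. (x (t - l n))\<^sup>2) \<and> integrable N (\<lambda>n. x (t - l n))"
proof -
  note [measurable] = L2_measurable[OF x]
  have "AE t in lborel. integrable N (\<lambda>n. (x (t - l n))\<^sup>2)"
    using integrable_shifted_square[OF finite_measure_axioms l_measurable x]
    by (rule P.AE_integrable_fst)
  then show ?thesis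
  proof eventually_elim
    case (elim t)
    then have "integrable N (\<lambda>n. x (t - l n) * 1)"
      by (intro integrable_mult_of_squares) auto
    with elim show ?case by simp
  qed
qed

lemma avg_measurable [measurable]:
  assumes [measurable]: "x \<in> borel_measurable borel"
  shows "avg x \<in> borel_measurable borel"
  unfolding avg_def by measurable

text \<open>Cauchy-Schwarz against the constant 1 bounds the squared average by the mass of
  \<open>N\<close> times the average of squares; integrating over \<open>t\<close> contributes the
  mass once more. This is Young's inequality for a measure and a square-integrable function.\<close>

lemma avg_L2:
  assumes x: "x \<in> L2"
  shows "avg x \<in> L2" "L2_norm (avg x) \<le> measure N (space N) * L2_norm x"
proof -
  note [measurable] = L2_measurable[OF x]
  let ?m = "measure N (space N)" and ?S = "\<lambda>t. LINT n|N. (x (t - l n))\<^sup>2"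
  have le: "AE t in lborel. (avg x t)\<^sup>2 \<le> ?m * ?S t"
    using AE_integrable_shifts[OF x]
  proof eventually_elim
    case (elim t)
    then have "(LINT n|N. x (t - l n) * 1)\<^sup>2 \<le> ?S t * (LINT n|N. 1\<^sup>2)"
      by (intro integral_Cauchy_Schwarz) auto
    then show ?case by (simp add: avg_def mult.commute)
  qed
  have S: "integrable lborel ?S"
    by (rule P.integrable_fst) (rule integrable_shifted_square[OF finite_measure_axioms l_measurable x])
  have avg: "integrable lborel (\<lambda>t. (avg x t)\<^sup>2)"
  proof (rule Bochner_Integration.integrable_bound)
    show "integrable lborel (\<lambda>t. ?m * ?S t)" using S by simp
    show "AE t in lborel. norm ((avg x t)\<^sup>2) \<le> norm (?m * ?S t)"
      using le by eventually_elim simp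
  qed measurable
  then show "avg x \<in> L2" by (simp add: L2_def)
  have "(LINT t|lborel. (avg x t)\<^sup>2) \<le> (LINT t|lborel. ?m * ?S t)"
    by (rule integral_mono_AE) (use avg S le in auto)
  also have "\<dots> = ?m * (LINT n|N. LINT t|lborel. (x (t - l n))\<^sup>2)"
    using P.Fubini_integral[OF integrable_shifted_square[OF finite_measure_axioms l_measurable x]]
    by simp
  also have "\<dots> = (?m * L2_norm x)\<^sup>2"
    using lborel_integral_shift[of "\<lambda>t. (x t)\<^sup>2"]
    by (simp add: L2_norm_def power2_eq_square)
  finally have "sqrt (LINT t|lborel. (avg x t)\<^sup>2) \<le> sqrt ((?m * L2_norm x)\<^sup>2)"
    by (rule real_sqrt_le_mono)
  then show "L2_norm (avg x) \<le> ?m * L2_norm x" by (simp add: L2_norm_def[of "avg x"])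
qed

text \<open>Fubini. Through it every estimate of the correlation with a single shift passes to the
  convolution.\<close>

lemma avg_inner:
  assumes x: "x \<in> L2" and y: "y \<in> L2"
  shows "L2_inner (avg x) y = (LINT n|N. L2_inner (\<lambda>t. x (t - l n)) y)"
  using P.Fubini_integral[OF integrable_shifted_mult[OF x y]]
  by (simp add: L2_inner_def avg_def)

lemma avg_lincomb:
  assumes x: "x \<in> L2" and y: "y \<in> L2"
  shows "AE t in lborel. avg (\<lambda>t. a * x t + b * y t) t = a * avg x t + b * avg y t"
  using AE_integrable_shifts[OF x] AE_integrable_shifts[OF y]
  by eventually_elim (simp add: avg_def)

end

section \<open>The measures carried by an impulse response\<close>

definition atoms_measure :: "gen_fun \<Rightarrow> nat measure" where
  "atoms_measure h = density (count_space UNIV) (\<lambda>i. ennreal (weight h i))"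

text \<open>Here, as for the atoms, \<open>ennreal\<close> cuts negative values to zero, so the two
  measures represent \<open>h\<close> faithfully only on \<open>Hp_set\<close>.\<close>

definition dens_measure :: "gen_fun \<Rightarrow> real measure" where
  "dens_measure h = density lborel (\<lambda>t. ennreal (dens h t))"

lemma sets_atoms_measure [simp, measurable_cong]: "sets (atoms_measure h) = sets (count_space UNIV)"
  by (simp add: atoms_measure_def)

lemma sets_dens_measure [simp, measurable_cong]: "sets (dens_measure h) = sets borel"
  by (simp add: dens_measure_def)

lemma Hp_setD:
  assumes "h \<in> Hp_set"
  shows "0 \<le> weight h i" "0 \<le> dens h t" "summable (weight h)" "integrable lborel (dens h)"
    "dens h \<in> borel_measurable borel"
  using assms by (auto simp: Hp_set_def H_set_def dest: borel_measurable_integrable)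

lemma atoms_measure_Hp:
  assumes h: "h \<in> Hp_set"
  shows "finite_measure (atoms_measure h)"
    and "measure (atoms_measure h) (space (atoms_measure h)) = (\<Sum>i. \<bar>weight h i\<bar>)"
proof -
  have e: "emeasure (atoms_measure h) (space (atoms_measure h)) = ennreal (\<Sum>i. weight h i)"
    using Hp_setD[OF h]
    by (simp add: atoms_measure_def emeasure_density nn_integral_count_space_nat suminf_ennreal2)
  then show "finite_measure (atoms_measure h)" by (intro finite_measureI) simp
  show "measure (atoms_measure h) (space (atoms_measure h)) = (\<Sum>i. \<bar>weight h i\<bar>)"
    using e Hp_setD[OF h] by (simp add: measure_def suminf_nonneg)
qed

lemma dens_measure_Hp:
  assumes h: "h \<in> Hp_set"
  shows "finite_measure (dens_measure h)"
    and "measure (dens_measure h) (space (dens_measure h)) = (LINT t|lborel. \<bar>dens h t\<bar>)"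
proof -
  note [measurable] = Hp_setD(5)[OF h]
  have e: "emeasure (dens_measure h) (space (dens_measure h)) = ennreal (LINT t|lborel. dens h t)"
    using Hp_setD[OF h]
    by (simp add: dens_measure_def emeasure_density nn_integral_eq_integral)
  then show "finite_measure (dens_measure h)" by (intro finite_measureI) simp
  show "measure (dens_measure h) (space (dens_measure h)) = (LINT t|lborel. \<bar>dens h t\<bar>)"
    using e Hp_setD[OF h] by (simp add: measure_def integral_nonneg_AE)
qed

lemma H_norm_Hp:
  assumes h: "h \<in> Hp_set"
  shows "H_norm h = measure (atoms_measure h) (space (atoms_measure h))
    + measure (dens_measure h) (space (dens_measure h))"
  using atoms_measure_Hp(2)[OF h] dens_measure_Hp(2)[OF h] by (simp add: H_norm_def)

lemma shift_average_atoms: "h \<in> Hp_set \<Longrightarrow> shift_average (atoms_measure h) (loc h)"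
  by (intro shift_average.intro atoms_measure_Hp shift_average_axioms.intro) measurable

lemma shift_average_dens: "h \<in> Hp_set \<Longrightarrow> shift_average (dens_measure h) (\<lambda>s. s)"
  by (intro shift_average.intro dens_measure_Hp shift_average_axioms.intro) measurable

lemma integral_atoms_measure:
  fixes f :: "nat \<Rightarrow> 'a::{banach, second_countable_topology}"
  assumes h: "h \<in> Hp_set" and f: "integrable (atoms_measure h) f"
  shows "(LINT i|atoms_measure h. f i) = (\<Sum>i. weight h i *\<^sub>R f i)"
proof -
  have "integrable (count_space UNIV) (\<lambda>i. weight h i *\<^sub>R f i)"
    using f Hp_setD[OF h] unfolding atoms_measure_def by (subst (asm) integrable_density) auto
  then show ?thesis
    using Hp_setD[OF h] unfolding atoms_measure_def
    by (subst integral_density) (auto simp: integral_count_space_nat)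
qed

lemma integral_dens_measure:
  fixes f :: "real \<Rightarrow> 'a::{banach, second_countable_topology}"
  assumes h: "h \<in> Hp_set" and "f \<in> borel_measurable borel"
  shows "(LINT s|dens_measure h. f s) = (LINT s|lborel. dens h s *\<^sub>R f s)"
  using Hp_setD[OF h] assms unfolding dens_measure_def by (subst integral_density) auto

section \<open>Convolution as a sum of two shift averages\<close>

lemma conv_op_measurable:
  assumes h: "h \<in> Hp_set" and [measurable]: "x \<in> borel_measurable borel"
  shows "conv_op h x \<in> borel_measurable borel"
proof -
  note [measurable] = Hp_setD(5)[OF h]
  show ?thesis unfolding conv_op_def by measurable
qed

text \<open>The exceptional null set comes from the atoms: the series in \<open>conv_op\<close> is
  an ordered sum, identified with an integral only where that integral converges absolutely. For the
  density both sides take the same default value when the integral diverges.\<close>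

lemma conv_op_AE:
  assumes h: "h \<in> Hp_set" and x: "x \<in> L2"
  shows "AE t in lborel. conv_op h x t =
    shift_average.avg (atoms_measure h) (loc h) x t + shift_average.avg (dens_measure h) (\<lambda>s. s) x t"
proof -
  note [measurable] = L2_measurable[OF x]
  interpret A: shift_average "atoms_measure h" "loc h" by (rule shift_average_atoms[OF h])
  interpret D: shift_average "dens_measure h" "\<lambda>s. s" by (rule shift_average_dens[OF h])
  from A.AE_integrable_shifts[OF x] show ?thesis
  proof eventually_elim
    case (elim t)
    then show ?case
      using integral_atoms_measure[OF h, of "\<lambda>i. x (t - loc h i)"]
        integral_dens_measure[OF h, of "\<lambda>s. x (t - s)"]
      by (simp add: A.avg_def D.avg_def conv_op_def)
  qed
qed

lemma conv_op_L2:
  assumes h: "h \<in> Hp_set" and x: "x \<in> L2"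
  shows "conv_op h x \<in> L2" "L2_norm (conv_op h x) \<le> H_norm h * L2_norm x"
proof -
  interpret A: shift_average "atoms_measure h" "loc h" by (rule shift_average_atoms[OF h])
  interpret D: shift_average "dens_measure h" "\<lambda>s. s" by (rule shift_average_dens[OF h])
  note c = L2_cong_AE[OF conv_op_measurable[OF h L2_measurable[OF x]]
      L2_add[OF A.avg_L2(1)[OF x] D.avg_L2(1)[OF x]] conv_op_AE[OF h x]]
  show "conv_op h x \<in> L2" by (rule c)
  show "L2_norm (conv_op h x) \<le> H_norm h * L2_norm x"
    unfolding c(2) H_norm_Hp[OF h] distrib_right
    by (rule order_trans[OF L2_norm_add[OF A.avg_L2(1)[OF x] D.avg_L2(1)[OF x]]])
      (intro add_mono A.avg_L2 D.avg_L2 x)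
qed

lemma conv_op_inner:
  assumes h: "h \<in> Hp_set" and x: "x \<in> L2" and y: "y \<in> L2"
  shows "L2_inner (conv_op h x) y =
    (LINT i|atoms_measure h. L2_inner (\<lambda>t. x (t - loc h i)) y)
    + (LINT s|dens_measure h. L2_inner (\<lambda>t. x (t - s)) y)"
proof -
  interpret A: shift_average "atoms_measure h" "loc h" by (rule shift_average_atoms[OF h])
  interpret D: shift_average "dens_measure h" "\<lambda>s. s" by (rule shift_average_dens[OF h])
  have "L2_inner (conv_op h x) y = L2_inner (\<lambda>t. A.avg x t + D.avg x t) y"
    using x y by (intro L2_inner_cong_AE conv_op_AE[OF h x] conv_op_measurable[OF h]
      borel_measurable_add A.avg_measurable D.avg_measurable L2_measurable AE_I2 refl)
  then show ?thesis
    by (simp add: L2_inner_add_left A.avg_L2 D.avg_L2 x y A.avg_inner D.avg_inner)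
qed

lemma conv_op_lincomb:
  assumes h: "h \<in> Hp_set" and x: "x \<in> L2" and y: "y \<in> L2"
  shows "AE t in lborel. conv_op h (\<lambda>t. a * x t + b * y t) t = a * conv_op h x t + b * conv_op h y t"
proof -
  interpret A: shift_average "atoms_measure h" "loc h" by (rule shift_average_atoms[OF h])
  interpret D: shift_average "dens_measure h" "\<lambda>s. s" by (rule shift_average_dens[OF h])
  show ?thesis
    using conv_op_AE[OF h x] conv_op_AE[OF h y] conv_op_AE[OF h L2_lincomb[OF x y, of a b]]
      A.avg_lincomb[OF x y, of a b] D.avg_lincomb[OF x y, of a b]
    by eventually_elim (simp add: algebra_simps)
qed

text \<open>The impulse response of the adjoint operator.\<close>

definition reflect :: "gen_fun \<Rightarrow> gen_fun" where
  "reflect h = \<lparr>loc = (\<lambda>i. - loc h i), weight = weight h, dens = (\<lambda>t. dens h (- t))\<rparr>"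

lemma lborel_integral_reflect:
  fixes f :: "real \<Rightarrow> 'a::{banach, second_countable_topology}"
  shows "(LINT t|lborel. f (- t)) = (LINT t|lborel. f t)"
  using lborel_integral_real_affine[of "-1" f 0] by simp

lemma lborel_integrable_reflect:
  fixes f :: "real \<Rightarrow> 'a::{banach, second_countable_topology}"
  shows "integrable lborel f \<Longrightarrow> integrable lborel (\<lambda>t. f (- t))"
  using lborel_integrable_real_affine[of f "-1" 0] by simp

lemma reflect_Hp: "h \<in> Hp_set \<Longrightarrow> reflect h \<in> Hp_set"
  using lborel_integrable_reflect[of "dens h"]
  by (auto simp: Hp_set_def H_set_def reflect_def inj_def)

lemma H_norm_reflect: "H_norm (reflect h) = H_norm h"
  using lborel_integral_reflect[of "\<lambda>t. \<bar>dens h t\<bar>"] by (simp add: H_norm_def reflect_def)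

lemma L2_inner_shift_swap: "L2_inner (\<lambda>t. x (t - s)) y = L2_inner (\<lambda>t. y (t + s)) x"
  using lborel_integral_shift[of "\<lambda>t. x t * y (t + s)" s] by (simp add: L2_inner_def mult.commute)

text \<open>Shifting one argument of the inner product by \<open>s\<close> amounts to shifting the
  other by \<open>-s\<close>; averaging over \<open>s\<close> turns this into reflection of the
  kernel.\<close>

lemma conv_op_adjoint:
  assumes h: "h \<in> Hp_set" and x: "x \<in> L2" and y: "y \<in> L2"
  shows "L2_inner (conv_op h x) y = L2_inner x (conv_op (reflect h) y)"
proof -
  note [measurable] = L2_measurable[OF x] L2_measurable[OF y]
  have m [measurable]: "(\<lambda>s. L2_inner (\<lambda>t. y (t - s)) x) \<in> borel_measurable borel"
    "(\<lambda>s. L2_inner (\<lambda>t. x (t - s)) y) \<in> borel_measurable borel" by measurable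
  \<comment> \<open>Atoms are indexed by numbers, so reflection changes their locations and leaves
    the measure on indices alone.\<close>
  have a: "atoms_measure (reflect h) = atoms_measure h" by (simp add: atoms_measure_def reflect_def)
  have "(LINT s|dens_measure (reflect h). L2_inner (\<lambda>t. y (t - s)) x)
    = (LINT s|lborel. dens h (- s) * L2_inner (\<lambda>t. y (t - s)) x)"
    using integral_dens_measure[OF reflect_Hp[OF h] m(1)] by (simp add: reflect_def)
  also have "\<dots> = (LINT s|lborel. dens h s * L2_inner (\<lambda>t. y (t + s)) x)"
    using lborel_integral_reflect[of "\<lambda>s. dens h s * L2_inner (\<lambda>t. y (t + s)) x"] by simp
  also have "\<dots> = (LINT s|dens_measure h. L2_inner (\<lambda>t. x (t - s)) y)"
    using integral_dens_measure[OF h m(2)] by (simp add: L2_inner_shift_swap)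
  finally have d: "(LINT s|dens_measure (reflect h). L2_inner (\<lambda>t. y (t - s)) x)
    = (LINT s|dens_measure h. L2_inner (\<lambda>t. x (t - s)) y)" .
  show ?thesis
    unfolding L2_inner_commute[of x] conv_op_inner[OF h x y] conv_op_inner[OF reflect_Hp[OF h] y x] a d
    by (simp add: reflect_def L2_inner_shift_swap[of x])
qed

section \<open>Positivity of the multiplier\<close>

text \<open>The primitive of \<open>f\<close> that vanishes at 0. For every \<open>x\<close> one of
  the two intervals is empty or a point, so the difference is the signed integral from 0 to
  \<open>x\<close>.\<close>

definition potential :: "(real \<Rightarrow> real) \<Rightarrow> real \<Rightarrow> real" where
  "potential f x = integral {0..x} f - integral {x..0} f"

lemma mono_integrable_on:
  fixes f :: "real \<Rightarrow> real"
  shows "mono f \<Longrightarrow> f integrable_on {a..b}"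
  by (rule integrable_on_mono_on) (simp add: monotone_on_def)

lemma potential_diff:
  assumes f: "mono f" and "u \<le> v"
  shows "potential f v - potential f u = integral {u..v} f"
proof -
  have c: "integral {a..b} f + integral {b..c} f = integral {a..c} f" if "a \<le> b" "b \<le> c" for a b c
    using that by (intro Henstock_Kurzweil_Integration.integral_combine mono_integrable_on f)
  have z: "integral {a..b} f = 0" if "b \<le> a" for a b
    using that by (cases "a = b") auto
  consider "0 \<le> u" | "u \<le> 0" "0 \<le> v" | "v \<le> 0" by linarith
  then show ?thesis
  proof cases
    case 1
    then show ?thesis using c[of 0 u v] z[of 0 u] z[of 0 v] \<open>u \<le> v\<close> by (simp add: potential_def)
  next
    case 2
    then show ?thesis using c[of u 0 v] z[of u 0] z[of 0 v] by (simp add: potential_def)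
  next
    case 3
    then show ?thesis using c[of u v 0] z[of u 0] z[of v 0] \<open>u \<le> v\<close> by (simp add: potential_def)
  qed
qed

text \<open>Replacing a monotone \<open>f\<close> by its value at the endpoint \<open>u\<close> errs
  in the same direction whether the interval runs to the right or to the left of \<open>u\<close>.
  This is convexity of the potential in a form that tolerates jumps of \<open>f\<close>.\<close>

lemma potential_subgradient:
  assumes f: "mono f"
  shows "f u * (v - u) \<le> potential f v - potential f u"
proof (cases "u \<le> v")
  case True
  have "integral {u..v} (\<lambda>_. f u) \<le> integral {u..v} f"
    by (rule integral_le) (use mono_integrable_on[OF f] monoD[OF f] in auto)
  then show ?thesis using True by (simp add: potential_diff[OF f] mult.commute)
next
  case False
  have "integral {v..u} f \<le> integral {v..u} (\<lambda>_. f u)"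
    by (rule integral_le) (use mono_integrable_on[OF f] monoD[OF f] in auto)
  then show ?thesis using False potential_diff[OF f, of v u] by (simp add: algebra_simps)
qed

lemma potential_zero [simp]: "potential f 0 = 0"
  by (simp add: potential_def)

lemma potential_bounds:
  assumes f: "mono f" "f 0 = 0"
  shows "0 \<le> potential f u" "potential f u \<le> f u * u"
  using potential_subgradient[OF f(1), of 0 u] potential_subgradient[OF f(1), of u 0] f(2) by auto

lemma potential_even:
  assumes "odd_fun f"
  shows "potential f (- x) = potential f x"
proof -
  have "integral {- b..- a} f = - integral {a..b} f" for a b
    using Henstock_Kurzweil_Integration.integral_reflect_real[of b a "\<lambda>x. f (- x)"] assms
    by (simp add: odd_fun_def)
  from this[of x 0] this[of 0 x] show ?thesis by (simp add: potential_def)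
qed

text \<open>The subgradients are supporting lines, so the potential is convex, hence
  continuous.\<close>

lemma potential_measurable:
  assumes f: "mono f"
  shows "potential f \<in> borel_measurable borel"
proof -
  have "convex_on UNIV (potential f)"
  proof (intro convex_onI)
    fix t x y :: real assume t: "0 < t" "t < 1"
    define z where "z = (1 - t) * x + t * y"
    have "(1 - t) * (f z * (x - z)) \<le> (1 - t) * (potential f x - potential f z)"
      "t * (f z * (y - z)) \<le> t * (potential f y - potential f z)"
      using t by (auto intro!: mult_left_mono potential_subgradient f)
    moreover have "(1 - t) * (f z * (x - z)) + t * (f z * (y - z)) = f z * ((1 - t) * x + t * y - z)"
      by (simp add: algebra_simps)
    ultimately have "0 \<le> (1 - t) * (potential f x - potential f z) + t * (potential f y - potential f z)"
      by (simp add: z_def)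
    then show "potential f ((1 - t) *\<^sub>R x + t *\<^sub>R y) \<le> (1 - t) * potential f x + t * potential f y"
      by (simp add: z_def algebra_simps)
  qed simp
  then have "continuous_on UNIV (potential f)"
    by (intro convex_on_continuous) auto
  then show ?thesis by (rule borel_measurable_continuous_onI)
qed

text \<open>The pointwise trace of the operator bounds, with one lower function and a factor in
  place of two functions. At \<open>u = 0\<close> the quotients carry no information, hence the
  separate clause.\<close>

definition in_sector :: "(real \<Rightarrow> real) \<Rightarrow> real \<Rightarrow> real \<Rightarrow> real \<Rightarrow> bool" where
  "in_sector f K u y \<longleftrightarrow> (u = 0 \<longrightarrow> y = 0) \<and> (u \<noteq> 0 \<longrightarrow> f u / u \<le> y / u \<and> y / u \<le> K * f u / u)"

text \<open>\<open>y\<close> has the sign of \<open>u\<close>. If \<open>v * y\<close> is not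
  positive, the right side is nonnegative in any case, because \<open>u * y\<close> dominates
  \<open>f u * u\<close> and so the potential at \<open>u\<close>, while the potential at
  \<open>v\<close> is nonnegative. Otherwise \<open>v\<close> has that sign too, the upper sector
  bound gives \<open>v * y \<le> K * (v * f u)\<close>, and the subgradient inequality at
  \<open>u\<close> finishes.\<close>

lemma in_sector_mult_le:
  assumes f: "mono f" "f 0 = 0" and K: "1 \<le> K" and s: "in_sector f K u y"
  shows "v * y \<le> K * (u * y) + K * (potential f v - potential f u)"
proof -
  note pv = potential_bounds[OF f, of v] and pu = potential_bounds[OF f, of u]
  have 0: "f u * u \<le> u * y \<and> (v * y \<le> 0 \<or> v * y \<le> K * (v * f u))"
  proof -
    consider "u = 0" | "0 < u" | "u < 0" by linarith
    then show ?thesis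
    proof cases
      case 1
      then show ?thesis using s by (simp add: in_sector_def)
    next
      case 2
      then have "0 \<le> f u" using monoD[OF f(1), of 0 u] f(2) by simp
      moreover have b: "f u \<le> y" "y \<le> K * f u"
        using s 2 by (auto simp: in_sector_def divide_le_cancel)
      ultimately have "0 \<le> y" by linarith
      have "v * y \<le> 0 \<or> v * y \<le> v * (K * f u)"
      proof (cases "0 \<le> v")
        case True
        then show ?thesis using b by (auto intro: mult_left_mono)
      next
        case False
        then show ?thesis using \<open>0 \<le> y\<close> by (auto simp: mult_nonpos_nonneg)
      qed
      then show ?thesis using 2 b by (auto simp: mult.commute mult.left_commute intro: mult_left_mono)
    next
      case 3
      then have "f u \<le> 0" using monoD[OF f(1), of u 0] f(2) by simp
      moreover have b: "y \<le> f u" "K * f u \<le> y"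
        using s 3 by (auto simp: in_sector_def divide_le_cancel)
      ultimately have "y \<le> 0" by linarith
      have "v * y \<le> 0 \<or> v * y \<le> v * (K * f u)"
      proof (cases "0 \<le> v")
        case True
        then show ?thesis using \<open>y \<le> 0\<close> by (auto simp: mult_nonneg_nonpos)
      next
        case False
        then show ?thesis using b by (auto intro: mult_left_mono_neg)
      qed
      then show ?thesis using 3 b by (auto simp: mult.commute mult.left_commute intro: mult_left_mono_neg)
    qed
  qed
  then consider "v * y \<le> 0" | "v * y \<le> K * (v * f u)" by blast
  then show ?thesis
  proof cases
    case 1
    have "0 \<le> u * y + (potential f v - potential f u)" using 0 pv pu by linarith
    then have "0 \<le> K * (u * y + (potential f v - potential f u))" using K by simp
    then show ?thesis using 1 by (simp add: algebra_simps)
  next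
    case 2
    have "v * f u \<le> u * y + (potential f v - potential f u)"
      using 0 potential_subgradient[OF f(1), of u v] by (simp add: algebra_simps)
    then have "K * (v * f u) \<le> K * (u * y + (potential f v - potential f u))"
      using K by (intro mult_left_mono) auto
    then show ?thesis using 2 by (simp add: algebra_simps)
  qed
qed

lemma bounded_fun_zero: "bounded_fun f \<Longrightarrow> f 0 = 0"
  unfolding bounded_fun_def by (metis abs_le_zero_iff abs_zero mult_zero_right)

lemma integrable_potential:
  assumes f: "mono f" "bounded_fun f" and u: "u \<in> L2"
  shows "integrable lborel (\<lambda>t. potential f (u t))"
proof -
  note [measurable] = L2_measurable[OF u] potential_measurable[OF f(1)]
  obtain C where C: "0 \<le> C" "\<And>x. \<bar>f x\<bar> \<le> C * \<bar>x\<bar>" using f(2) by (auto simp: bounded_fun_def)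
  show ?thesis
  proof (rule Bochner_Integration.integrable_bound)
    show "integrable lborel (\<lambda>t. C * (u t)\<^sup>2)" using u by (simp add: L2_def)
    have "\<bar>potential f x\<bar> \<le> \<bar>C * x\<^sup>2\<bar>" for x
    proof -
      have "\<bar>potential f x\<bar> \<le> \<bar>f x\<bar> * \<bar>x\<bar>"
        using potential_bounds[OF f(1) bounded_fun_zero[OF f(2)], of x]
        by (simp add: abs_mult[symmetric])
      also have "\<dots> \<le> C * \<bar>x\<bar> * \<bar>x\<bar>" using C by (intro mult_right_mono) auto
      finally show ?thesis using C by (simp add: power2_eq_square abs_mult)
    qed
    then show "AE t in lborel. norm (potential f (u t)) \<le> norm (C * (u t)\<^sup>2)" by simp
  qed measurable
qed

text \<open>
  Integrating \<open>v y \<le> K u y + K (F v - F u)\<close>, with \<open>F\<close> a potential of the sector function and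
  \<open>v\<close> a shift of \<open>u\<close>, the potential terms cancel because the integral is translation invariant.
\<close>

lemma in_sector_shift_le:
  assumes f: "mono f" "bounded_fun f" and K: "1 \<le> K" and u: "u \<in> L2" and y: "y \<in> L2"
    and s: "AE t in lborel. in_sector f K (u t) (y t)"
  shows "L2_inner (\<lambda>t. u (t - s)) y \<le> K * L2_inner u y"
    and "odd_fun f \<Longrightarrow> - (K * L2_inner u y) \<le> L2_inner (\<lambda>t. u (t - s)) y"
proof -
  note f0 = bounded_fun_zero[OF f(2)]
  let ?F = "\<lambda>t. K * (u t * y t) + K * (potential f (u (t - s)) - potential f (u t))"
  have p: "integrable lborel (\<lambda>t. potential f (u (t - s)))" "integrable lborel (\<lambda>t. potential f (u t))"
    by (intro integrable_potential f u L2_shift)+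
  have F: "integrable lborel ?F"
    using p L2_integrable_mult[OF u y] by simp
  have eq: "(LINT t|lborel. ?F t) = K * L2_inner u y"
    using p L2_integrable_mult[OF u y] lborel_integral_shift[of "\<lambda>t. potential f (u t)" s]
    by (simp add: L2_inner_def)
  have v: "integrable lborel (\<lambda>t. u (t - s) * y t)" by (intro L2_integrable_mult L2_shift u y)
  have "(LINT t|lborel. u (t - s) * y t) \<le> (LINT t|lborel. ?F t)"
  proof (rule integral_mono_AE[OF v F])
    show "AE t in lborel. u (t - s) * y t \<le> ?F t"
      using s by eventually_elim (rule in_sector_mult_le[OF f(1) f0 K])
  qed
  then show "L2_inner (\<lambda>t. u (t - s)) y \<le> K * L2_inner u y"
    unfolding eq by (simp add: L2_inner_def)
  assume "odd_fun f"
  have "(LINT t|lborel. - (u (t - s) * y t)) \<le> (LINT t|lborel. ?F t)"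
  proof (rule integral_mono_AE[OF _ F])
    show "integrable lborel (\<lambda>t. - (u (t - s) * y t))" using v by simp
    show "AE t in lborel. - (u (t - s) * y t) \<le> ?F t"
      using s
    proof eventually_elim
      case (elim t)
      \<comment> \<open>The comparison value is now the negated shift. Oddness of \<open>f\<close>
        makes the potential even, so the potential terms are those of the shift itself and still
        integrate to zero.\<close>
      show ?case
        using in_sector_mult_le[OF f(1) f0 K elim, of "- u (t - s)"] potential_even[OF \<open>odd_fun f\<close>]
        by simp
    qed
  qed
  then show "- (K * L2_inner u y) \<le> L2_inner (\<lambda>t. u (t - s)) y"
    unfolding eq by (simp add: L2_inner_def)
qed

section \<open>From single shifts to the multiplier\<close>

lemma integral_le_measure:
  fixes f :: "'a \<Rightarrow> real"
  assumes "finite_measure M" and [measurable]: "f \<in> borel_measurable M"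
    and b: "\<And>x. \<bar>f x\<bar> \<le> b" and c: "\<And>x. f x \<le> c"
  shows "(LINT x|M. f x) \<le> c * measure M (space M)"
proof -
  interpret finite_measure M by fact
  have "integrable M f" using b by (intro integrable_const_bound[of _ b]) auto
  then have "(LINT x|M. f x) \<le> (LINT x|M. c)" using c by (intro integral_mono) auto
  then show ?thesis by (simp add: mult.commute)
qed

lemma conv_op_inner_le:
  assumes h: "h \<in> Hp_set" and x: "x \<in> L2" and y: "y \<in> L2"
    and c: "\<And>s. L2_inner (\<lambda>t. x (t - s)) y \<le> c"
  shows "L2_inner (conv_op h x) y \<le> c * H_norm h"
proof -
  note [measurable] = L2_measurable[OF x] L2_measurable[OF y]
  have m: "(\<lambda>s. L2_inner (\<lambda>t. x (t - s)) y) \<in> borel_measurable borel" by measurable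
  have "(\<lambda>i. L2_inner (\<lambda>t. x (t - loc h i)) y) \<in> borel_measurable (atoms_measure h)"
    "(\<lambda>s. L2_inner (\<lambda>t. x (t - s)) y) \<in> borel_measurable (dens_measure h)"
    using m by (auto cong: measurable_cong_sets)
  then show ?thesis
    unfolding conv_op_inner[OF h x y] H_norm_Hp[OF h] distrib_left
    by (intro add_mono integral_le_measure[where b = "L2_norm x * L2_norm y"]
        atoms_measure_Hp dens_measure_Hp h L2_inner_shift_bound x y c)
qed

lemma mult_op_inner:
  assumes "hp \<in> Hp_set" "hm \<in> Hp_set" and "x \<in> L2" and "y \<in> L2"
  shows "L2_inner (mult_op hp hm x) y
    = L2_inner x y - L2_inner (conv_op hp x) y + L2_inner (conv_op hm x) y"
  unfolding mult_op_def using assms by (simp add: L2_inner_add_left L2_inner_diff_left L2_diff conv_op_L2)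

text \<open>\<open>hp\<close> enters \<open>M\<close> with a minus sign and asks for an upper bound
  on correlations; \<open>hm\<close> enters with a plus sign and asks for a lower one, which is
  where oddness is used. The disjunction accommodates an infinite \<open>B\<close>: then
  \<open>hm\<close> has norm zero, and its term vanishes by Cauchy-Schwarz instead of by a sector
  bound.\<close>

lemma mult_op_nonneg:
  assumes h: "hp \<in> Hp_set" "hm \<in> Hp_set" and u: "u \<in> L2" and y: "y \<in> L2"
    and a: "mono f" "bounded_fun f" "1 \<le> A" "AE t in lborel. in_sector f A (u t) (y t)"
    and b: "mono g" "bounded_fun g" "odd_fun g" "1 \<le> B"
      "H_norm hm = 0 \<or> (AE t in lborel. in_sector g B (u t) (y t))"
    and le: "A * H_norm hp + B * H_norm hm \<le> 1"
  shows "0 \<le> L2_inner (mult_op hp hm u) y"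
proof -
  let ?I = "L2_inner u y"
  have I: "0 \<le> ?I"
    unfolding L2_inner_def
  proof (rule integral_nonneg_AE)
    show "AE t in lborel. 0 \<le> u t * y t"
      using a(4)
    proof eventually_elim
      case (elim t)
      \<comment> \<open>The comparison value \<open>v = 0\<close> bounds
        \<open>A * (u t * y t)\<close> below by \<open>A\<close> times the potential at
        \<open>u t\<close>.\<close>
      have "0 \<le> A * (u t * y t) + A * (potential f 0 - potential f (u t))"
        using in_sector_mult_le[OF a(1) bounded_fun_zero[OF a(2)] a(3) elim, of 0] by simp
      moreover have "0 \<le> A * potential f (u t)"
        using potential_bounds(1)[OF a(1) bounded_fun_zero[OF a(2)]] a(3) by simp
      ultimately have "0 \<le> A * (u t * y t)" by (simp add: algebra_simps)
      then show ?case using a(3) by (simp add: zero_le_mult_iff)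
    qed
  qed
  have p: "L2_inner (conv_op hp u) y \<le> A * ?I * H_norm hp"
    by (intro conv_op_inner_le h u y in_sector_shift_le(1)[OF a(1,2,3) u y a(4)])
  have m: "- L2_inner (conv_op hm u) y \<le> B * ?I * H_norm hm"
  proof (cases "H_norm hm = 0")
    case True
    have "\<bar>L2_inner (conv_op hm u) y\<bar> \<le> L2_norm (conv_op hm u) * L2_norm y"
      by (intro L2_Cauchy_Schwarz conv_op_L2 h u y)
    also have "\<dots> \<le> (H_norm hm * L2_norm u) * L2_norm y"
      by (intro mult_right_mono conv_op_L2 h u) simp
    finally show ?thesis using True by simp
  next
    case False
    then have s: "AE t in lborel. in_sector g B (u t) (y t)" using b(5) by blast
    have neg: "L2_inner x (\<lambda>t. - 1 * y t) = - L2_inner x y" for x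
      by (simp add: L2_inner_def)
    have "L2_inner (\<lambda>t. u (t - s)) (\<lambda>t. - 1 * y t) \<le> B * ?I" for s
      using in_sector_shift_le(2)[OF b(1,2,4) u y s b(3), of s] unfolding neg by linarith
    then have "L2_inner (conv_op hm u) (\<lambda>t. - 1 * y t) \<le> B * ?I * H_norm hm"
      by (intro conv_op_inner_le h u L2_cmult y)
    then show ?thesis unfolding neg .
  qed
  have "0 \<le> (1 - (A * H_norm hp + B * H_norm hm)) * ?I" using le I by simp
  then have "0 \<le> ?I - A * ?I * H_norm hp - B * ?I * H_norm hm" by (simp add: algebra_simps)
  then show ?thesis unfolding mult_op_inner[OF h u y] using p m by linarith
qed

section \<open>Truncated loop signals\<close>

definition dev_op :: "gen_fun \<Rightarrow> gen_fun \<Rightarrow> sig_op" where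
  "dev_op hp hm x = (\<lambda>t. conv_op hp x t - conv_op hm x t)"

lemma mult_op_dev_op: "mult_op hp hm x = (\<lambda>t. x t - dev_op hp hm x t)"
  by (auto simp: mult_op_def dev_op_def)

lemma dev_op_L2:
  assumes "hp \<in> Hp_set" "hm \<in> Hp_set" "x \<in> L2"
  shows "dev_op hp hm x \<in> L2" "L2_norm (dev_op hp hm x) \<le> (H_norm hp + H_norm hm) * L2_norm x"
proof -
  show "dev_op hp hm x \<in> L2" unfolding dev_op_def by (intro L2_diff conv_op_L2 assms)
  have "L2_norm (dev_op hp hm x) \<le> L2_norm (conv_op hp x) + L2_norm (conv_op hm x)"
    unfolding dev_op_def by (intro L2_norm_diff conv_op_L2 assms)
  also have "\<dots> \<le> H_norm hp * L2_norm x + H_norm hm * L2_norm x"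
    by (intro add_mono conv_op_L2 assms)
  finally show "L2_norm (dev_op hp hm x) \<le> (H_norm hp + H_norm hm) * L2_norm x"
    by (simp add: distrib_right)
qed

lemma mult_op_L2:
  assumes "hp \<in> Hp_set" "hm \<in> Hp_set" "x \<in> L2"
  shows "mult_op hp hm x \<in> L2" "L2_norm (mult_op hp hm x) \<le> (1 + H_norm hp + H_norm hm) * L2_norm x"
proof -
  show "mult_op hp hm x \<in> L2" unfolding mult_op_dev_op by (intro L2_diff dev_op_L2 assms)
  have "L2_norm (mult_op hp hm x) \<le> L2_norm x + L2_norm (dev_op hp hm x)"
    unfolding mult_op_dev_op by (intro L2_norm_diff dev_op_L2 assms)
  then show "L2_norm (mult_op hp hm x) \<le> (1 + H_norm hp + H_norm hm) * L2_norm x"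
    using dev_op_L2(2)[OF assms] by (simp add: distrib_right)
qed

lemma mult_op_adjoint:
  assumes h: "hp \<in> Hp_set" "hm \<in> Hp_set" and x: "x \<in> L2" and y: "y \<in> L2"
  shows "L2_inner (mult_op hp hm x) y = L2_inner x (mult_op (reflect hp) (reflect hm) y)"
  unfolding mult_op_inner[OF h x y] L2_inner_commute[of x "mult_op _ _ _"]
    mult_op_inner[OF reflect_Hp[OF h(1)] reflect_Hp[OF h(2)] y x]
  using conv_op_adjoint[OF h(1) x y] conv_op_adjoint[OF h(2) x y] by (simp add: L2_inner_commute)

lemma dev_op_diff:
  assumes "hp \<in> Hp_set" "hm \<in> Hp_set" "x \<in> L2" "y \<in> L2"
  shows "AE t in lborel. dev_op hp hm (\<lambda>t. x t - y t) t = dev_op hp hm x t - dev_op hp hm y t"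
  using conv_op_lincomb[OF assms(1,3,4), of 1 "-1"] conv_op_lincomb[OF assms(2,3,4), of 1 "-1"]
  by eventually_elim (simp add: dev_op_def)

section \<open>Continuation beyond a truncation time\<close>

definition tail :: "real \<Rightarrow> (real \<Rightarrow> real) \<Rightarrow> real \<Rightarrow> real" where
  "tail T x = (\<lambda>t. if t \<le> T then 0 else x t)"

lemma tail_measurable: "x \<in> borel_measurable borel \<Longrightarrow> tail T x \<in> borel_measurable borel"
  by (simp add: tail_def)

lemma L2_tail:
  assumes "x \<in> L2"
  shows "tail T x \<in> L2" "L2_norm (tail T x) \<le> L2_norm x"
  by (rule L2_bound[OF tail_measurable[OF L2_measurable[OF assms]] assms], simp add: tail_def)+

lemma L2_norm_trunc: "x \<in> L2 \<Longrightarrow> L2_norm (trunc T x) \<le> L2_norm x"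
  by (rule L2_bound(2)) (auto simp: trunc_def L2_measurable)

lemma L2_inner_tail: "L2_inner x (tail T y) = L2_inner (tail T x) (tail T y)"
  unfolding L2_inner_def by (rule Bochner_Integration.integral_cong) (auto simp: tail_def)

text \<open>
  On signals supported beyond \<open>T\<close> the map \<open>e \<mapsto> tail T (dev_op hp hm (a + e))\<close> is a contraction.
  An approximate fixed point is all that is needed, which avoids the completeness of \<open>L2\<close>.
\<close>

lemma mult_op_tail_approx:
  assumes h: "hp \<in> Hp_set" "hm \<in> Hp_set" and \<rho>: "H_norm hp + H_norm hm < 1"
    and a: "a \<in> L2" "tail T a = (\<lambda>t. 0)" and \<delta>: "0 < \<delta>"
  obtains e where "e \<in> L2" "tail T e = e"
    "L2_norm e \<le> L2_norm a / (1 - (H_norm hp + H_norm hm))"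
    "L2_norm (tail T (mult_op hp hm (\<lambda>t. a t + e t))) \<le> \<delta>"
proof -
  define \<rho> where "\<rho> = H_norm hp + H_norm hm"
  have r: "0 \<le> \<rho>" "\<rho> < 1" using \<rho> H_norm_Hp[OF h(1)] H_norm_Hp[OF h(2)] by (auto simp: \<rho>_def)
  define F where "F e = tail T (dev_op hp hm (\<lambda>t. a t + e t))" for e
  define E where "E n = (F ^^ n) (\<lambda>t. 0)" for n
  have E_Suc: "E (Suc n) = F (E n)" for n by (simp add: E_def)
  have E_Suc': "E (Suc n) t = (if t \<le> T then 0 else dev_op hp hm (\<lambda>t. a t + E n t) t)" for n t
    by (simp add: E_Suc F_def tail_def)
  have EL2: "E n \<in> L2" for n
    by (induction n) (simp add: E_def L2_zero, simp add: E_Suc F_def L2_tail dev_op_L2 h L2_add a)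
  have tE: "tail T (E n) = E n" for n
    by (cases n) (simp add: E_def tail_def, simp add: E_Suc F_def tail_def fun_eq_iff)
  \<comment> \<open>The solution \<open>k\<close> of \<open>k = \<rho> * (L2_norm a + k)\<close>,
    hence a bound that the iteration preserves.\<close>
  let ?K = "\<rho> * L2_norm a / (1 - \<rho>)"
  have bE: "L2_norm (E n) \<le> ?K" for n
  proof (induction n)
    case 0
    then show ?case using r by (simp add: E_def L2_norm_def)
  next
    case (Suc n)
    have "L2_norm (E (Suc n)) \<le> L2_norm (dev_op hp hm (\<lambda>t. a t + E n t))"
      unfolding E_Suc F_def by (intro L2_tail dev_op_L2 h L2_add a EL2)
    also have "\<dots> \<le> \<rho> * L2_norm (\<lambda>t. a t + E n t)"
      unfolding \<rho>_def by (intro dev_op_L2 h L2_add a EL2)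
    also have "\<dots> \<le> \<rho> * (L2_norm a + ?K)"
      using L2_norm_add[OF a(1) EL2[of n]] Suc r by (intro mult_left_mono) auto
    also have "\<dots> = ?K" using r by (simp add: field_simps)
    finally show ?case .
  qed
  have dE: "L2_norm (\<lambda>t. E (Suc n) t - E n t) \<le> \<rho> ^ n * ?K" for n
  proof (induction n)
    case 0
    have "(\<lambda>t. E (Suc 0) t - E 0 t) = E (Suc 0)" by (simp add: E_def)
    then show ?case using bE[of "Suc 0"] by simp
  next
    case (Suc n)
    let ?d = "\<lambda>t. E (Suc n) t - E n t"
    have dL2: "?d \<in> L2" by (intro L2_diff EL2)
    have lin: "AE t in lborel. dev_op hp hm ?d t
        = dev_op hp hm (\<lambda>t. a t + E (Suc n) t) t - dev_op hp hm (\<lambda>t. a t + E n t) t"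
      using dev_op_diff[OF h L2_add[OF a(1) EL2[of "Suc n"]] L2_add[OF a(1) EL2[of n]]] by simp
    have "L2_norm (\<lambda>t. E (Suc (Suc n)) t - E (Suc n) t) \<le> L2_norm (dev_op hp hm ?d)"
    proof (rule L2_bound(2))
      show "(\<lambda>t. E (Suc (Suc n)) t - E (Suc n) t) \<in> borel_measurable borel"
        by (intro L2_measurable L2_diff EL2)
      show "dev_op hp hm ?d \<in> L2" by (intro dev_op_L2 h dL2)
      show "AE t in lborel. \<bar>E (Suc (Suc n)) t - E (Suc n) t\<bar> \<le> \<bar>dev_op hp hm ?d t\<bar>"
        using lin by eventually_elim (simp add: E_Suc')
    qed
    also have "\<dots> \<le> \<rho> * L2_norm ?d" unfolding \<rho>_def by (intro dev_op_L2 h dL2)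
    also have "\<dots> \<le> \<rho> * (\<rho> ^ n * ?K)" using Suc r by (intro mult_left_mono) auto
    finally show ?case by (simp add: mult.assoc)
  qed
  have "(\<lambda>n. \<rho> ^ n * ?K) \<longlonglongrightarrow> 0 * ?K"
    using r by (intro tendsto_mult LIMSEQ_power_zero tendsto_const) auto
  then have "\<forall>\<^sub>F n in sequentially. \<rho> ^ n * ?K < \<delta>"
    using \<delta> by (intro order_tendstoD) auto
  then obtain n where n: "\<rho> ^ n * ?K < \<delta>" by (auto simp: eventually_sequentially)
  \<comment> \<open>Since \<open>a\<close> vanishes beyond \<open>T\<close>, what \<open>M\<close>
    leaves there is the negative of the next increment of the iteration, and the increments decay
    geometrically.\<close>
  have "tail T (mult_op hp hm (\<lambda>t. a t + E n t)) = (\<lambda>t. - 1 * (E (Suc n) t - E n t))"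
  proof
    fix t
    show "tail T (mult_op hp hm (\<lambda>t. a t + E n t)) t = - 1 * (E (Suc n) t - E n t)"
      using fun_cong[OF tE[of n], of t] fun_cong[OF a(2), of t]
      by (auto simp: mult_op_dev_op E_Suc F_def tail_def split: if_splits)
  qed
  then have "L2_norm (tail T (mult_op hp hm (\<lambda>t. a t + E n t))) = L2_norm (\<lambda>t. E (Suc n) t - E n t)"
    by (simp only: L2_norm_cmult abs_minus_cancel abs_one mult_1)
  also have "\<dots> \<le> \<delta>" using dE[of n] n by linarith
  finally have "L2_norm (tail T (mult_op hp hm (\<lambda>t. a t + E n t))) \<le> \<delta>" .
  moreover have "L2_norm (E n) \<le> L2_norm a / (1 - (H_norm hp + H_norm hm))"
  proof -
    have "\<rho> * L2_norm a \<le> L2_norm a" using r by (simp add: mult_left_le_one_le)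
    then have "?K \<le> L2_norm a / (1 - \<rho>)" using r by (intro divide_right_mono) auto
    then show ?thesis using bE[of n] by (simp add: \<rho>_def)
  qed
  ultimately show thesis using EL2 tE by (intro that[of "E n"])
qed

text \<open>
  Neither \<open>\<phi>\<close> nor the multiplier is causal, so the passivity of \<open>(u2, y2)\<close> does not survive
  truncation. Instead \<open>u2\<close> is continued beyond \<open>T\<close> so that \<open>M u'\<close> is almost supported on \<open>{..T}\<close>,
  and \<open>y2\<close> so that the same holds for the adjoint of \<open>M\<close>. Then \<open>\<langle>M u', y''\<rangle>\<close> involves only the
  values of \<open>u2\<close> and \<open>y2\<close> up to \<open>T\<close>, where by causality \<open>u' = G (r1 - y'') + r2\<close>.
\<close>

lemma lurye_trunc_bound:
  assumes h: "hp \<in> Hp_set" "hm \<in> Hp_set" and \<rho>: "H_norm hp + H_norm hm < 1"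
    and G: "L2e_operator G" "linear_operator G" "causal G" "stable_operator G"
    and \<phi>: "L2e_operator \<phi>" "\<And>u. u \<in> L2e \<Longrightarrow> AE t in lborel. S (u t) (\<phi> u t)"
    and C: "0 \<le> C" "\<And>a b. S a b \<Longrightarrow> \<bar>b\<bar> \<le> C * \<bar>a\<bar>"
    and pos: "\<And>u y. u \<in> L2 \<Longrightarrow> y \<in> L2 \<Longrightarrow> AE t in lborel. S (u t) (y t) \<Longrightarrow>
      0 \<le> L2_inner (mult_op hp hm u) y"
    and coercive: "0 < \<epsilon>" "\<And>q. q \<in> L2 \<Longrightarrow> \<epsilon> * (L2_norm q)\<^sup>2 \<le> L2_inner (mult_op hp hm (G q)) q"
    and r: "r1 \<in> L2" "r2 \<in> L2"
    and L2e: "u1 \<in> L2e" "u2 \<in> L2e" "y1 \<in> L2e" "y2 \<in> L2e"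
    and eqs: "lurye_eqs G \<phi> r1 r2 u1 u2 y1 y2"
  shows "\<epsilon> * L2_norm (trunc T y2) \<le> 2 * L2_norm (\<lambda>t. G r1 t + r2 t)"
proof (rule ccontr)
  define r where "r = (\<lambda>t. G r1 t + r2 t)"
  define a where "a = trunc T u2"
  define b where "b = trunc T y2"
  assume "\<not> \<epsilon> * L2_norm (trunc T y2) \<le> 2 * L2_norm (\<lambda>t. G r1 t + r2 t)"
  then have gt: "2 * L2_norm r < \<epsilon> * L2_norm b" by (simp add: r_def b_def)
  obtain K where GL2: "\<And>x. x \<in> L2 \<Longrightarrow> G x \<in> L2"
    and K: "\<And>x. x \<in> L2 \<Longrightarrow> L2_norm (G x) \<le> K * L2_norm x"
    using G(4) unfolding stable_operator_def by blast
  have rL2: "r \<in> L2" unfolding r_def by (intro L2_add GL2 r)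
  have ab: "a \<in> L2" "b \<in> L2" using L2e by (auto simp: a_def b_def L2e_def)
  have tab: "tail T a = (\<lambda>t. 0)" "tail T b = (\<lambda>t. 0)" by (auto simp: a_def b_def tail_def trunc_def)
  have ae: "AE t in lborel. y1 t = G u1 t" "AE t in lborel. y2 t = \<phi> u2 t"
    "AE t in lborel. u1 t = r1 t - y2 t" "AE t in lborel. u2 t = y1 t + r2 t"
    using eqs by (auto simp: lurye_eqs_def sig_eq_def)
  define \<rho> where "\<rho> = H_norm hp + H_norm hm"
  have \<rho>1: "\<rho> < 1" "0 \<le> \<rho>" using \<rho> H_norm_Hp[OF h(1)] H_norm_Hp[OF h(2)] by (auto simp: \<rho>_def)
  \<comment> \<open>Bounds for \<open>u'\<close>, for the continuation \<open>\<eta>\<close> and for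
    the loop mismatch \<open>d\<close>. They may depend on \<open>T\<close> but not on \<delta>, so
    \<delta> can be fixed before the continuations are constructed. \<open>D\<close> adds up the
    three errors: from \<open>f\<close>, from \<open>\<eta>\<close> and from
    \<open>d\<close>.\<close>
  define K1 where "K1 = L2_norm a + L2_norm a / (1 - \<rho>)"
  define K2 where "K2 = L2_norm b / (1 - \<rho>)"
  define K3 where "K3 = K1 + L2_norm r + \<bar>K\<bar> * (L2_norm b + K2)"
  define D where "D = C * K1 + K2 + K3"
  have Kpos: "0 \<le> K1" "0 \<le> K2" "0 \<le> K3" using \<rho>1 by (auto simp: K1_def K2_def K3_def)
  then have "0 \<le> D" using C(1) by (simp add: D_def)
  \<comment> \<open>The value at \<open>x = L2_norm b\<close> of
    \<open>x * (\<epsilon> * x - 2 * L2_norm r)\<close>, positive under the assumption to be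
    refuted. The errors must stay below it.\<close>
  define c where "c = L2_norm b * (\<epsilon> * L2_norm b - 2 * L2_norm r)"
  have "L2_norm b > 0"
    using gt L2_norm_nonneg[of b] L2_norm_nonneg[of r] coercive(1)
    by (metis less_le_not_le linorder_le_cases mult_2 add_nonneg_nonneg mult_zero_right order_antisym_conv order_less_le_trans)
  then have "0 < c" using gt by (simp add: c_def)
  \<comment> \<open>The summand 1 keeps the denominator positive when \<open>D\<close> is
    zero.\<close>
  define \<delta> where "\<delta> = c / (2 * (D + 1))"
  have "0 < \<delta>" using \<open>0 < c\<close> \<open>0 \<le> D\<close> by (simp add: \<delta>_def)
  have \<delta>D: "\<delta> * D < c"
  proof -
    have "\<delta> * D \<le> \<delta> * (D + 1)" using \<open>0 < \<delta>\<close> by simp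
    also have "\<dots> = c / 2" using \<open>0 \<le> D\<close> by (simp add: \<delta>_def field_simps)
    finally show ?thesis using \<open>0 < c\<close> by linarith
  qed
  note h' = reflect_Hp[OF h(1)] reflect_Hp[OF h(2)]
  obtain e where e: "e \<in> L2" "tail T e = e" "L2_norm e \<le> L2_norm a / (1 - \<rho>)"
    "L2_norm (tail T (mult_op hp hm (\<lambda>t. a t + e t))) \<le> \<delta>"
    using mult_op_tail_approx[OF h \<rho> ab(1) tab(1) \<open>0 < \<delta>\<close>] unfolding \<rho>_def by blast
  have \<rho>': "H_norm (reflect hp) + H_norm (reflect hm) < 1" using \<rho> by (simp add: H_norm_reflect)
  obtain \<eta> where \<eta>: "\<eta> \<in> L2" "tail T \<eta> = \<eta>" "L2_norm \<eta> \<le> K2"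
    "L2_norm (tail T (mult_op (reflect hp) (reflect hm) (\<lambda>t. b t + \<eta> t))) \<le> \<delta>"
    using mult_op_tail_approx[OF h' \<rho>' ab(2) tab(2) \<open>0 < \<delta>\<close>] unfolding \<rho>_def K2_def
    by (auto simp: H_norm_reflect)
  define u' where "u' = (\<lambda>t. a t + e t)"
  define y'' where "y'' = (\<lambda>t. b t + \<eta> t)"
  define z where "z = mult_op (reflect hp) (reflect hm) y''"
  define w where "w = mult_op hp hm u'"
  have L2s: "u' \<in> L2" "y'' \<in> L2" "z \<in> L2" "w \<in> L2"
    unfolding u'_def y''_def z_def w_def by (intro L2_add mult_op_L2 ab e \<eta> h h')+
  have nu': "L2_norm u' \<le> K1"
    using L2_norm_add[OF ab(1) e(1)] e(3) by (simp add: u'_def K1_def)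
  have ny'': "L2_norm y'' \<le> L2_norm b + K2"
    using L2_norm_add[OF ab(2) \<eta>(1)] \<eta>(3) by (simp add: y''_def)
  have e0: "e t = 0" "\<eta> t = 0" if "t \<le> T" for t
    using fun_cong[OF e(2), of t] fun_cong[OF \<eta>(2), of t] that by (auto simp: tail_def)
  have u'T: "u' t = u2 t" and y''T: "y'' t = y2 t" if "t \<le> T" for t
    using that e0[of t] by (auto simp: u'_def y''_def a_def b_def trunc_def)

  \<comment> \<open>The output is spliced from two inputs: up to \<open>T\<close> it is
    \<open>y2\<close>, produced by \<open>u2\<close>, beyond \<open>T\<close> it is produced by
    \<open>u'\<close>. As \<open>S\<close> relates values at the same time, \<open>b + f\<close> is
    an admissible partner of \<open>u'\<close>, whatever memory or anticipation
    \<open>\<phi>\<close> has.\<close>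
  define f where "f = tail T (\<phi> u')"
  have "\<phi> u' \<in> L2e" using \<phi>(1) L2_subset_L2e[OF L2s(1)] by (auto simp: L2e_operator_def)
  then have fm: "f \<in> borel_measurable borel" unfolding f_def by (intro tail_measurable) (simp add: L2e_def)
  have S': "AE t in lborel. S (u' t) (\<phi> u' t)" by (intro \<phi>(2) L2_subset_L2e L2s)
  have fb: "AE t in lborel. \<bar>f t\<bar> \<le> \<bar>C * u' t\<bar>"
    using S'
  proof eventually_elim
    case (elim t)
    then show ?case using C(2)[OF elim] C(1) by (auto simp: f_def tail_def abs_mult)
  qed
  have fL2: "f \<in> L2" "L2_norm f \<le> C * K1"
  proof -
    show "f \<in> L2" by (rule L2_bound[OF fm L2_cmult[OF L2s(1)] fb])
    have "L2_norm f \<le> C * L2_norm u'"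
      using L2_bound(2)[OF fm L2_cmult[OF L2s(1)] fb] C(1) by (simp add: L2_norm_cmult)
    also have "\<dots> \<le> C * K1" using C(1) nu' by (rule mult_left_mono[rotated])
    finally show "L2_norm f \<le> C * K1" .
  qed
  have pair: "AE t in lborel. S (u' t) (b t + f t)"
    using S' \<phi>(2)[OF L2e(2)] ae(2)
  proof eventually_elim
    case (elim t)
    then show ?case using u'T[of t] by (cases "t \<le> T") (auto simp: b_def f_def trunc_def tail_def)
  qed
  have "0 \<le> L2_inner w (\<lambda>t. b t + f t)"
    unfolding w_def by (intro pos L2s L2_add ab fL2 pair)
  also have "\<dots> = L2_inner w b + L2_inner w f"
    by (intro L2_inner_add_right L2s ab fL2)
  finally have 1: "0 \<le> L2_inner w b + L2_inner w f" .
  \<comment> \<open>The price of altering a partner beyond \<open>T\<close>. It is applied to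
    \<open>f\<close> and \<open>\<eta>\<close> against \<open>w\<close>, and to \<open>d\<close>
    against \<open>z\<close>.\<close>
  have tail_bound: "\<bar>L2_inner x (tail T y)\<bar> \<le> \<delta> * B"
    if "x \<in> L2" "tail T y \<in> L2" "L2_norm (tail T x) \<le> \<delta>" "L2_norm (tail T y) \<le> B" for x y B
  proof -
    have "\<bar>L2_inner x (tail T y)\<bar> \<le> L2_norm (tail T x) * L2_norm (tail T y)"
      unfolding L2_inner_tail[of x] by (intro L2_Cauchy_Schwarz L2_tail that)
    also have "\<dots> \<le> \<delta> * B" using that \<open>0 < \<delta>\<close> by (intro mult_mono) auto
    finally show ?thesis .
  qed
  have tw: "L2_norm (tail T w) \<le> \<delta>" using e(4) by (simp add: w_def u'_def)
  have tz: "L2_norm (tail T z) \<le> \<delta>" using \<eta>(4) by (simp add: z_def y''_def)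
  have 2: "\<bar>L2_inner w f\<bar> \<le> \<delta> * (C * K1)"
    unfolding f_def by (rule tail_bound) (use fL2 tw L2s in \<open>simp_all add: f_def\<close>)
  have 3: "\<bar>L2_inner w \<eta>\<bar> \<le> \<delta> * K2"
    using tail_bound[of w \<eta> K2] L2s tw \<eta> by simp
  have 4: "L2_inner w y'' = L2_inner w b + L2_inner w \<eta>"
    unfolding y''_def by (intro L2_inner_add_right L2s ab \<eta>)
  have 5: "L2_inner w y'' = L2_inner u' z"
    unfolding w_def z_def by (intro mult_op_adjoint h L2s)

  \<comment> \<open>The response of the linear part to the continued feedback \<open>y''\<close>.
    Causality of \<open>G\<close> makes it agree with \<open>u2\<close> up to \<open>T\<close>,
    because \<open>y''\<close> and \<open>y2\<close> agree there.\<close>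
  define v where "v = (\<lambda>t. r t - G y'' t)"
  have vL2: "v \<in> L2" unfolding v_def by (intro L2_diff rL2 GL2 L2s)
  have agree: "AE t in lborel. t \<le> T \<longrightarrow> u2 t = v t"
  proof -
    let ?q = "\<lambda>t. r1 t - y'' t"
    have q: "?q \<in> L2" by (intro L2_diff r L2s)
    have "AE t in lborel. trunc T u1 t = trunc T ?q t"
      using ae(3)
    proof eventually_elim
      case (elim t)
      then show ?case using y''T[of t] by (auto simp: trunc_def)
    qed
    moreover have "trunc T u1 \<in> L2" using L2e(1) by (simp add: L2e_def)
    then have "trunc T u1 \<in> L2e" by (rule L2_subset_L2e)
    moreover have "trunc T ?q \<in> L2e" by (intro L2_subset_L2e L2_trunc q)
    ultimately have "AE t in lborel. G (trunc T u1) t = G (trunc T ?q) t"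
      using G(1) by (auto simp: L2e_operator_def sig_eq_def)
    moreover have "AE t in lborel. trunc T (G u1) t = trunc T (G (trunc T u1)) t"
      using G(3) L2e(1) by (auto simp: causal_def sig_eq_def)
    moreover have "AE t in lborel. trunc T (G ?q) t = trunc T (G (trunc T ?q)) t"
      using G(3) L2_subset_L2e[OF q] by (auto simp: causal_def sig_eq_def)
    moreover have "AE t in lborel. G (\<lambda>t. 1 * r1 t + (- 1) * y'' t) t = 1 * G r1 t + (- 1) * G y'' t"
      using G(2) L2_subset_L2e[OF r(1)] L2_subset_L2e[OF L2s(2)]
      unfolding linear_operator_def sig_eq_def by blast
    ultimately show ?thesis
      using ae(1,4)
      by eventually_elim (auto simp: trunc_def v_def r_def)
  qed
  \<comment> \<open>Beyond \<open>T\<close> the continuation \<open>u'\<close> need not satisfy the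
    loop equation. The defect lives where \<open>z\<close> is almost zero.\<close>
  define d where "d = tail T (\<lambda>t. u' t - v t)"
  have dL2: "d \<in> L2" unfolding d_def by (intro L2_tail L2_diff L2s vL2)
  have nG: "L2_norm (G y'') \<le> \<bar>K\<bar> * (L2_norm b + K2)"
    using K[OF L2s(2)] by (rule order_trans) (intro mult_mono ny'', auto)
  have "L2_norm d \<le> L2_norm u' + L2_norm v"
    unfolding d_def by (rule order_trans[OF L2_tail(2) L2_norm_diff]) (intro L2_diff L2s vL2)+
  then have nd: "L2_norm d \<le> K3"
    using L2_norm_diff[OF rL2 GL2[OF L2s(2)]] nu' nG unfolding K3_def v_def by linarith
  have "AE t in lborel. u' t = v t + d t"
    using agree
  proof eventually_elim
    case (elim t)
    then show ?case using u'T[of t] by (auto simp: d_def tail_def)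
  qed
  then have "L2_inner u' z = L2_inner (\<lambda>t. v t + d t) z"
    by (rule L2_inner_cong_AE) (intro L2_measurable L2s L2_add vL2 dL2 AE_I2 refl)+
  also have "\<dots> = L2_inner v z + L2_inner d z" by (intro L2_inner_add_left vL2 dL2 L2s)
  also have "L2_inner v z = L2_inner r z - L2_inner (G y'') z"
    unfolding v_def by (intro L2_inner_diff_left rL2 GL2 L2s)
  finally have 6: "L2_inner u' z = L2_inner r z - L2_inner (G y'') z + L2_inner d z" .
  have 7: "L2_inner d z \<le> \<delta> * K3"
    using tail_bound[of z "\<lambda>t. u' t - v t" K3] L2s tz dL2 nd
    by (simp add: d_def[symmetric] L2_inner_commute[of z])
  have 8: "\<epsilon> * (L2_norm y'')\<^sup>2 \<le> L2_inner (G y'') z"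
    using coercive(2)[OF L2s(2)] mult_op_adjoint[OF h GL2[OF L2s(2)] L2s(2)] by (simp add: z_def)
  have 9: "L2_inner r z \<le> 2 * L2_norm r * L2_norm y''"
  proof -
    have "L2_inner r z = L2_inner (mult_op hp hm r) y''"
      using mult_op_adjoint[OF h rL2 L2s(2)] by (simp add: z_def)
    also have "\<dots> \<le> L2_norm (mult_op hp hm r) * L2_norm y''"
      using L2_Cauchy_Schwarz[OF mult_op_L2(1)[OF h rL2] L2s(2)] by linarith
    also have "\<dots> \<le> (2 * L2_norm r) * L2_norm y''"
    proof (rule mult_right_mono)
      \<comment> \<open>The source of the factor 2: the norm of \<open>M\<close> is at most
        \<open>1 + \<rho>\<close>.\<close>
      have "(1 + H_norm hp + H_norm hm) * L2_norm r \<le> 2 * L2_norm r"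
        using \<rho> by (intro mult_right_mono) auto
      then show "L2_norm (mult_op hp hm r) \<le> 2 * L2_norm r"
        using mult_op_L2(2)[OF h rL2] by linarith
    qed simp
    finally show ?thesis .
  qed
  have "\<epsilon> * (L2_norm y'')\<^sup>2 - 2 * L2_norm r * L2_norm y'' \<le> \<delta> * (C * K1) + \<delta> * K2 + \<delta> * K3"
    using 1 2 3 4 5 6 7 8 9 by linarith
  then have "L2_norm y'' * (\<epsilon> * L2_norm y'' - 2 * L2_norm r) \<le> \<delta> * D"
    by (simp add: D_def power2_eq_square algebra_simps)
  \<comment> \<open>Truncation does not increase the norm, and
    \<open>x * (\<epsilon> * x - 2 * L2_norm r)\<close> increases in \<open>x\<close> once its
    second factor is nonnegative.\<close>
  moreover have "c \<le> L2_norm y'' * (\<epsilon> * L2_norm y'' - 2 * L2_norm r)"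
  proof -
    have "b = trunc T y''" using y''T by (auto simp: b_def trunc_def)
    then have "L2_norm b \<le> L2_norm y''" using L2_norm_trunc[OF L2s(2), of T] by simp
    then show ?thesis unfolding c_def using gt coercive(1) by (intro mult_mono diff_mono) auto
  qed
  ultimately show False using \<delta>D by linarith
qed

text \<open>Monotone convergence along integer truncation times, which is why a bound uniform in
  \<open>T\<close> is wanted.\<close>

lemma L2_of_trunc_bounded:
  assumes y: "y \<in> L2e" and B: "\<And>T. L2_norm (trunc T y) \<le> B"
  shows "y \<in> L2"
proof -
  have [measurable]: "y \<in> borel_measurable borel" using y by (simp add: L2e_def)
  have tr: "(\<lambda>t. (trunc T y t)\<^sup>2) \<in> borel_measurable borel" for T unfolding trunc_def by measurable
  have "0 \<le> B" using B[of 0] L2_norm_nonneg order_trans by blast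
  have "(\<integral>\<^sup>+ t. ennreal ((y t)\<^sup>2) \<partial>lborel)
      = (\<integral>\<^sup>+ t. (SUP n. ennreal ((trunc (real n) y t)\<^sup>2)) \<partial>lborel)"
  proof (rule nn_integral_cong)
    fix t :: real
    obtain n :: nat where n: "t \<le> real n" using real_arch_simple by blast
    show "ennreal ((y t)\<^sup>2) = (SUP n. ennreal ((trunc (real n) y t)\<^sup>2))"
    proof (rule antisym)
      show "ennreal ((y t)\<^sup>2) \<le> (SUP n. ennreal ((trunc (real n) y t)\<^sup>2))"
        by (rule SUP_upper2[of n]) (use n in \<open>auto simp: trunc_def\<close>)
      show "(SUP n. ennreal ((trunc (real n) y t)\<^sup>2)) \<le> ennreal ((y t)\<^sup>2)"
        by (rule SUP_least) (auto simp: trunc_def)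
    qed
  qed
  also have "\<dots> = (SUP n. \<integral>\<^sup>+ t. ennreal ((trunc (real n) y t)\<^sup>2) \<partial>lborel)"
    by (rule nn_integral_monotone_convergence_SUP)
      (use tr in \<open>auto simp: incseq_def le_fun_def trunc_def\<close>)
  also have "\<dots> \<le> ennreal (B\<^sup>2)"
  proof (rule SUP_least)
    fix n :: nat
    have t: "trunc (real n) y \<in> L2" using y by (simp add: L2e_def)
    have "(\<integral>\<^sup>+ t. ennreal ((trunc (real n) y t)\<^sup>2) \<partial>lborel) = ennreal ((L2_norm (trunc (real n) y))\<^sup>2)"
      using t by (simp add: L2_norm_def L2_def nn_integral_eq_integral)
    also have "\<dots> \<le> ennreal (B\<^sup>2)" using B by (intro ennreal_leI power_mono) auto
    finally show "(\<integral>\<^sup>+ t. ennreal ((trunc (real n) y t)\<^sup>2) \<partial>lborel) \<le> ennreal (B\<^sup>2)" .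
  qed
  finally have "(\<integral>\<^sup>+ t. ennreal ((y t)\<^sup>2) \<partial>lborel) < \<infinity>"
    by (rule order_le_less_trans) simp
  then have "integrable lborel (\<lambda>t. (y t)\<^sup>2)" by (intro integrableI_bounded) auto
  then show ?thesis by (simp add: L2_def)
qed

text \<open>Once \<open>y2\<close> is controlled, one turn around the loop gives the rest:
  \<open>u1 = r1 - y2\<close>, then \<open>y1 = G u1\<close> by stability of \<open>G\<close>, then
  \<open>u2 = y1 + r2\<close>.\<close>

lemma lurye_stableI:
  assumes G: "stable_operator G"
    and y2: "\<And>r1 r2 u1 u2 y1 y2. r1 \<in> L2 \<Longrightarrow> r2 \<in> L2 \<Longrightarrow> u1 \<in> L2e \<Longrightarrow> u2 \<in> L2e \<Longrightarrow> y1 \<in> L2e \<Longrightarrow>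
      y2 \<in> L2e \<Longrightarrow> lurye_eqs G \<phi> r1 r2 u1 u2 y1 y2 \<Longrightarrow> y2 \<in> L2"
  shows "lurye_stable G \<phi>"
  unfolding lurye_stable_def
proof (intro ballI impI)
  fix r1 r2 u1 u2 y1 y2
  assume r: "r1 \<in> L2" "r2 \<in> L2" and L2e: "u1 \<in> L2e" "u2 \<in> L2e" "y1 \<in> L2e" "y2 \<in> L2e"
    and eqs: "lurye_eqs G \<phi> r1 r2 u1 u2 y1 y2"
  have m: "u1 \<in> borel_measurable borel" "u2 \<in> borel_measurable borel" "y1 \<in> borel_measurable borel"
    using L2e by (auto simp: L2e_def)
  have ae: "AE t in lborel. y1 t = G u1 t"
    "AE t in lborel. u1 t = r1 t - y2 t" "AE t in lborel. u2 t = y1 t + r2 t"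
    using eqs by (auto simp: lurye_eqs_def sig_eq_def)
  have 1: "y2 \<in> L2" by (rule y2[OF r L2e eqs])
  have 2: "u1 \<in> L2" by (rule L2_cong_AE[OF m(1) L2_diff[OF r(1) 1] ae(2)])
  then have "G u1 \<in> L2" using G by (auto simp: stable_operator_def)
  then have 3: "y1 \<in> L2" by (rule L2_cong_AE[OF m(3) _ ae(1)])
  have "u2 \<in> L2" by (rule L2_cong_AE[OF m(2) L2_add[OF 3 r(2)] ae(3)])
  with 1 2 3 show "u1 \<in> L2 \<and> u2 \<in> L2 \<and> y1 \<in> L2 \<and> y2 \<in> L2" by blast
qed

section \<open>Parseval's identity\<close>

lemma borel_measurable_cis [measurable]: "cis \<in> borel_measurable borel"
  by (intro borel_measurable_continuous_onI continuous_intros)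

text \<open>The normalisation matches \<open>has_fourier_transform\<close>, so Parseval's identity
  carries the factor \<open>2 * pi\<close>.\<close>

definition fourier :: "(real \<Rightarrow> real) \<Rightarrow> real \<Rightarrow> complex" where
  "fourier g \<omega> = (LINT t|lborel. complex_of_real (g t) * cis (- \<omega> * t))"

lemma fourier_measurable [measurable]:
  assumes [measurable]: "g \<in> borel_measurable borel"
  shows "fourier g \<in> borel_measurable borel"
  unfolding fourier_def by measurable

lemma cnj_fourier: "cnj (fourier g \<omega>) = (LINT t|lborel. complex_of_real (g t) * cis (\<omega> * t))"
  unfolding fourier_def by (simp add: cis_cnj flip: Bochner_Integration.integral_cnj)

lemma fourier_shift: "fourier (\<lambda>t. g (t - s)) \<omega> = cis (- \<omega> * s) * fourier g \<omega>"
proof -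
  have "fourier (\<lambda>t. g (t - s)) \<omega>
      = (LINT t|lborel. (\<lambda>r. cis (- \<omega> * s) * (complex_of_real (g r) * cis (- \<omega> * r))) (t - s))"
    unfolding fourier_def
    by (rule Bochner_Integration.integral_cong) (auto simp: cis_mult algebra_simps)
  also have "\<dots> = (LINT r|lborel. cis (- \<omega> * s) * (complex_of_real (g r) * cis (- \<omega> * r)))"
    by (rule lborel_integral_shift)
  also have "\<dots> = cis (- \<omega> * s) * fourier g \<omega>"
    unfolding fourier_def by (rule integral_mult_right_zero)
  finally show ?thesis .
qed

section \<open>Parseval's identity with Gaussian damping\<close>

lemma integrable_tensor:
  fixes g q :: "real \<Rightarrow> real"
  assumes g: "integrable lborel g" and q: "integrable lborel q"
  shows "integrable (lborel \<Otimes>\<^sub>M lborel) (\<lambda>p. g (fst p) * q (snd p))"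
proof (rule lborel_pair.Fubini_integrable)
  note [measurable] = borel_measurable_integrable[OF g] borel_measurable_integrable[OF q]
  show "(\<lambda>p. g (fst p) * q (snd p)) \<in> borel_measurable (lborel \<Otimes>\<^sub>M lborel)" by measurable
  show "integrable lborel (\<lambda>x. LINT y|lborel. norm (g (fst (x, y)) * q (snd (x, y))))"
    using g by (simp add: abs_mult)
  show "AE x in lborel. integrable lborel (\<lambda>y. g (fst (x, y)) * q (snd (x, y)))"
    using q by simp
qed

lemma integrable_mult_cis:
  fixes f a :: "'a \<Rightarrow> real"
  assumes f: "integrable M f" and [measurable]: "a \<in> borel_measurable M"
  shows "integrable M (\<lambda>x. complex_of_real (f x) * cis (a x))"
proof (rule Bochner_Integration.integrable_bound[OF f])
  note [measurable] = borel_measurable_integrable[OF f]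
  show "(\<lambda>x. complex_of_real (f x) * cis (a x)) \<in> borel_measurable M" by measurable
qed (simp add: norm_mult)

lemma fourier_mult_cnj:
  assumes g: "integrable lborel g" and q: "integrable lborel q"
  shows "fourier g \<omega> * cnj (fourier q \<omega>)
    = (LINT p|(lborel \<Otimes>\<^sub>M lborel). complex_of_real (g (fst p) * q (snd p)) * cis (- \<omega> * (fst p - snd p)))"
proof -
  have "(LINT p|(lborel \<Otimes>\<^sub>M lborel). complex_of_real (g (fst p) * q (snd p)) * cis (- \<omega> * (fst p - snd p)))
      = (LINT s|lborel. LINT t|lborel. complex_of_real (g s * q t) * cis (- \<omega> * (s - t)))"
    by (subst lborel_pair.integral_fst'[symmetric])
      (auto intro!: integrable_mult_cis integrable_tensor g q simp del: of_real_mult)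
  also have "\<dots> = (LINT s|lborel. (complex_of_real (g s) * cis (- \<omega> * s)) * cnj (fourier q \<omega>))"
  proof (rule Bochner_Integration.integral_cong[OF refl])
    fix s
    have "(LINT t|lborel. complex_of_real (g s * q t) * cis (- \<omega> * (s - t)))
      = (LINT t|lborel. (complex_of_real (g s) * cis (- \<omega> * s)) * (complex_of_real (q t) * cis (\<omega> * t)))"
      by (rule Bochner_Integration.integral_cong) (auto simp: cis_mult algebra_simps)
    also have "\<dots> = (complex_of_real (g s) * cis (- \<omega> * s)) * cnj (fourier q \<omega>)"
      unfolding cnj_fourier by (rule integral_mult_right_zero)
    finally show "(LINT t|lborel. complex_of_real (g s * q t) * cis (- \<omega> * (s - t)))
      = (complex_of_real (g s) * cis (- \<omega> * s)) * cnj (fourier q \<omega>)" .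
  qed
  also have "\<dots> = fourier g \<omega> * cnj (fourier q \<omega>)"
    unfolding fourier_def[of g] by (rule integral_mult_left_zero)
  finally show ?thesis by simp
qed

text \<open>With the frequency drawn from a normal law the triple integral converges absolutely and
  Fubini applies. The frequency integral is then the characteristic function of the standard normal
  law, again a Gaussian.\<close>

lemma fourier_mult_cnj_normal:
  assumes g: "integrable lborel g" and q: "integrable lborel q"
  shows "(LINT z|std_normal_distribution. fourier g (z / \<sigma>) * cnj (fourier q (z / \<sigma>)))
    = complex_of_real (LINT p|(lborel \<Otimes>\<^sub>M lborel).
        g (fst p) * q (snd p) * exp (- ((fst p - snd p) / \<sigma>)\<^sup>2 / 2))"
proof -
  let ?L = "lborel \<Otimes>\<^sub>M lborel :: (real \<times> real) measure" and ?N = std_normal_distribution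
  let ?f = "\<lambda>p z. complex_of_real (g (fst p) * q (snd p)) * cis (- (z / \<sigma>) * (fst p - snd p))"
  note [measurable] = borel_measurable_integrable[OF g] borel_measurable_integrable[OF q]
  interpret N: prob_space ?N by (rule prob_space_normal_density) simp
  interpret P: pair_sigma_finite ?L ?N
    by (intro pair_sigma_finite.intro N.sigma_finite_measure_axioms) (simp add: lborel_prod lborel.sigma_finite_measure_axioms)
  have int: "integrable (?L \<Otimes>\<^sub>M ?N) (case_prod ?f)"
  proof (rule P.Fubini_integrable)
    show "case_prod ?f \<in> borel_measurable (?L \<Otimes>\<^sub>M ?N)" by measurable
    have "(\<lambda>p. LINT z|?N. norm (case (p, z) of (p, z) \<Rightarrow> ?f p z)) = (\<lambda>p. \<bar>g (fst p) * q (snd p)\<bar>)"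
      using N.prob_space by (simp add: norm_mult abs_mult)
    then show "integrable ?L (\<lambda>p. LINT z|?N. norm (case (p, z) of (p, z) \<Rightarrow> ?f p z))"
      using integrable_tensor[OF g q] by simp
    show "AE p in ?L. integrable ?N (\<lambda>z. case (p, z) of (p, z) \<Rightarrow> ?f p z)"
    proof (rule AE_I2)
      fix p :: "real \<times> real"
      show "integrable ?N (\<lambda>z. case (p, z) of (p, z) \<Rightarrow> ?f p z)"
        by (rule N.integrable_const_bound[where B = "\<bar>g (fst p) * q (snd p)\<bar>"])
          (auto simp: norm_mult abs_mult)
    qed
  qed
  have "(LINT z|?N. fourier g (z / \<sigma>) * cnj (fourier q (z / \<sigma>))) = (LINT z|?N. LINT p|?L. ?f p z)"
    by (simp only: fourier_mult_cnj[OF g q])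
  also have "\<dots> = (LINT p|?L. LINT z|?N. ?f p z)"
    by (rule P.Fubini_integral[OF int])
  also have "\<dots> = (LINT p|?L. complex_of_real (g (fst p) * q (snd p) * exp (- ((fst p - snd p) / \<sigma>)\<^sup>2 / 2)))"
  proof (rule Bochner_Integration.integral_cong[OF refl])
    fix p :: "real \<times> real"
    have "(LINT z|?N. cis (- (z / \<sigma>) * (fst p - snd p))) = char ?N (- (fst p - snd p) / \<sigma>)"
    proof -
      have "- (z / \<sigma>) * (fst p - snd p) = - (fst p - snd p) / \<sigma> * z" for z
        by (simp add: divide_inverse algebra_simps)
      then show ?thesis by (simp only: char_def cis_conv_exp)
    qed
    also have "\<dots> = complex_of_real (exp (- ((fst p - snd p) / \<sigma>)\<^sup>2 / 2))"
      unfolding char_std_normal_distribution by (simp add: power_divide power2_commute)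
    finally show "(LINT z|?N. ?f p z)
        = complex_of_real (g (fst p) * q (snd p) * exp (- ((fst p - snd p) / \<sigma>)\<^sup>2 / 2))"
      by simp
  qed
  also have "\<dots> = complex_of_real (LINT p|?L. g (fst p) * q (snd p) * exp (- ((fst p - snd p) / \<sigma>)\<^sup>2 / 2))"
    by (rule integral_complex_of_real)
  finally show ?thesis .
qed

lemma std_normal_rescale:
  fixes h :: "real \<Rightarrow> complex"
  assumes [measurable]: "h \<in> borel_measurable borel" and \<sigma>: "0 < \<sigma>"
  shows "(LINT z|std_normal_distribution. h (z / \<sigma>))
    = (\<sigma> / sqrt (2 * pi)) *\<^sub>R (LINT \<omega>|lborel. exp (- (\<sigma> * \<omega>)\<^sup>2 / 2) *\<^sub>R h \<omega>)"
proof -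
  have "(LINT z|std_normal_distribution. h (z / \<sigma>)) = (LINT z|lborel. std_normal_density z *\<^sub>R h (z / \<sigma>))"
    by (rule integral_density) auto
  also have "\<dots> = \<bar>\<sigma>\<bar> *\<^sub>R (LINT \<omega>|lborel. std_normal_density (0 + \<sigma> * \<omega>) *\<^sub>R h ((0 + \<sigma> * \<omega>) / \<sigma>))"
    by (rule lborel_integral_real_affine) (use \<sigma> in simp)
  also have "\<dots> = \<sigma> *\<^sub>R (LINT \<omega>|lborel. (1 / sqrt (2 * pi)) *\<^sub>R (exp (- (\<sigma> * \<omega>)\<^sup>2 / 2) *\<^sub>R h \<omega>))"
  proof -
    have "std_normal_density (0 + \<sigma> * \<omega>) *\<^sub>R h ((0 + \<sigma> * \<omega>) / \<sigma>)
      = (1 / sqrt (2 * pi)) *\<^sub>R (exp (- (\<sigma> * \<omega>)\<^sup>2 / 2) *\<^sub>R h \<omega>)" for \<omega>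
      using \<sigma> by (simp add: std_normal_density_def)
    then show ?thesis using \<sigma> by (simp only: abs_of_pos)
  qed
  also have "\<dots> = (\<sigma> / sqrt (2 * pi)) *\<^sub>R (LINT \<omega>|lborel. exp (- (\<sigma> * \<omega>)\<^sup>2 / 2) *\<^sub>R h \<omega>)"
    unfolding integral_scaleR_right by simp
  finally show ?thesis .
qed

lemma shift_average_normal: "shift_average std_normal_distribution (\<lambda>z. \<sigma> * z)"
proof -
  interpret N: prob_space std_normal_distribution by (rule prob_space_normal_density) simp
  show ?thesis by unfold_locales measurable
qed

text \<open>Gaussian mollification, phrased as a shift average so that the norm bound and the inner
  product formula for averages apply to it.\<close>

abbreviation smooth :: "real \<Rightarrow> (real \<Rightarrow> real) \<Rightarrow> real \<Rightarrow> real" where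
  "smooth \<sigma> \<equiv> shift_average.avg std_normal_distribution (\<lambda>z. \<sigma> * z)"

lemma smooth_eq:
  assumes [measurable]: "g \<in> borel_measurable borel" and \<sigma>: "0 < \<sigma>"
  shows "(LINT s|lborel. g s * exp (- ((s - t) / \<sigma>)\<^sup>2 / 2)) = \<sigma> * sqrt (2 * pi) * smooth \<sigma> g t"
proof -
  interpret A: shift_average std_normal_distribution "\<lambda>z. \<sigma> * z" by (rule shift_average_normal)
  have "smooth \<sigma> g t = (LINT z|lborel. std_normal_density z * g (t - \<sigma> * z))"
    unfolding A.avg_def by (subst integral_density) auto
  also have "\<dots> = (LINT z|lborel. (1 / sqrt (2 * pi)) * (exp (- z\<^sup>2 / 2) * g (t - \<sigma> * z)))"
    by (rule Bochner_Integration.integral_cong) (auto simp: std_normal_density_def)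
  also have "\<dots> = (1 / sqrt (2 * pi)) * (LINT z|lborel. exp (- z\<^sup>2 / 2) * g (t - \<sigma> * z))"
    by (rule integral_mult_right_zero)
  finally have 1: "sqrt (2 * pi) * smooth \<sigma> g t = (LINT z|lborel. exp (- z\<^sup>2 / 2) * g (t - \<sigma> * z))"
    by simp
  have "(LINT s|lborel. g s * exp (- ((s - t) / \<sigma>)\<^sup>2 / 2))
      = \<bar>- \<sigma>\<bar> *\<^sub>R (LINT z|lborel. g (t + - \<sigma> * z) * exp (- ((t + - \<sigma> * z - t) / \<sigma>)\<^sup>2 / 2))"
    by (rule lborel_integral_real_affine) (use \<sigma> in simp)
  also have "\<dots> = \<sigma> * (LINT z|lborel. exp (- z\<^sup>2 / 2) * g (t - \<sigma> * z))"
    using \<sigma> by (simp add: mult.commute)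
  finally show ?thesis using 1 by simp
qed

text \<open>Damping in frequency is smoothing in time. One factor \<open>sqrt (2 * pi)\<close> comes
  from the density of the normal law in frequency, the other from the kernel in time.\<close>

lemma gaussian_parseval:
  assumes g: "integrable lborel g" "g \<in> L2" and q: "integrable lborel q" "q \<in> L2" and \<sigma>: "0 < \<sigma>"
  shows "(LINT \<omega>|lborel. exp (- (\<sigma> * \<omega>)\<^sup>2 / 2) *\<^sub>R (fourier g \<omega> * cnj (fourier q \<omega>)))
    = complex_of_real (2 * pi * L2_inner (smooth \<sigma> g) q)"
proof -
  note [measurable] = L2_measurable[OF g(2)] L2_measurable[OF q(2)]
  let ?I = "LINT \<omega>|lborel. exp (- (\<sigma> * \<omega>)\<^sup>2 / 2) *\<^sub>R (fourier g \<omega> * cnj (fourier q \<omega>))"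
  let ?E = "\<lambda>s t. exp (- ((s - t) / \<sigma>)\<^sup>2 / 2)"
  have [measurable]: "(\<lambda>\<omega>. cnj (fourier q \<omega>)) \<in> borel_measurable borel"
    unfolding cnj_fourier by measurable
  have "(\<sigma> / sqrt (2 * pi)) *\<^sub>R ?I
      = (LINT z|std_normal_distribution. fourier g (z / \<sigma>) * cnj (fourier q (z / \<sigma>)))"
    by (rule std_normal_rescale[symmetric]) (use \<sigma> in measurable)
  also have "\<dots> = complex_of_real (LINT p|(lborel \<Otimes>\<^sub>M lborel). g (fst p) * q (snd p) * ?E (fst p) (snd p))"
    by (rule fourier_mult_cnj_normal[OF g(1) q(1)])
  also have "(LINT p|(lborel \<Otimes>\<^sub>M lborel). g (fst p) * q (snd p) * ?E (fst p) (snd p))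
      = (LINT t|lborel. LINT s|lborel. g s * q t * ?E s t)"
  proof -
    have "integrable (lborel \<Otimes>\<^sub>M lborel) (\<lambda>(s, t). g s * q t * ?E s t)"
      by (rule Bochner_Integration.integrable_bound[OF integrable_tensor[OF g(1) q(1)]])
        (auto simp: abs_mult mult_left_le)
    from lborel_pair.integral_snd[OF this] show ?thesis by (simp add: case_prod_beta')
  qed
  also have "\<dots> = (LINT t|lborel. (\<sigma> * sqrt (2 * pi)) * (smooth \<sigma> g t * q t))"
  proof (rule Bochner_Integration.integral_cong[OF refl])
    fix t
    have "(LINT s|lborel. g s * q t * ?E s t) = (LINT s|lborel. q t * (g s * ?E s t))"
      by (rule Bochner_Integration.integral_cong) auto
    also have "\<dots> = q t * (LINT s|lborel. g s * ?E s t)" by (rule integral_mult_right_zero)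
    finally show "(LINT s|lborel. g s * q t * ?E s t) = (\<sigma> * sqrt (2 * pi)) * (smooth \<sigma> g t * q t)"
      using smooth_eq[OF L2_measurable[OF g(2)] \<sigma>, of t] by simp
  qed
  also have "\<dots> = \<sigma> * sqrt (2 * pi) * L2_inner (smooth \<sigma> g) q"
    unfolding L2_inner_def by (rule integral_mult_right_zero)
  finally have eq: "(\<sigma> / sqrt (2 * pi)) *\<^sub>R ?I
      = complex_of_real (\<sigma> * sqrt (2 * pi) * L2_inner (smooth \<sigma> g) q)" .
  have "?I = (sqrt (2 * pi) / \<sigma>) *\<^sub>R ((\<sigma> / sqrt (2 * pi)) *\<^sub>R ?I)"
    using \<sigma> by simp
  also have "\<dots> = (sqrt (2 * pi) / \<sigma>) *\<^sub>R complex_of_real (\<sigma> * sqrt (2 * pi) * L2_inner (smooth \<sigma> g) q)"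
    by (simp only: eq)
  also have "\<dots> = complex_of_real ((sqrt (2 * pi) * sqrt (2 * pi)) * L2_inner (smooth \<sigma> g) q)"
  proof -
    have "sqrt (2 * pi) / \<sigma> * (\<sigma> * sqrt (2 * pi) * c) = sqrt (2 * pi) * sqrt (2 * pi) * c" for c
      using \<sigma> by simp
    then show ?thesis by (simp only: scaleR_conv_of_real of_real_mult[symmetric])
  qed
  also have "sqrt (2 * pi) * sqrt (2 * pi) = 2 * pi" by simp
  finally show ?thesis .
qed

lemma gaussian_tendsto_1: "(\<lambda>n. exp (- (inverse (real (Suc n)) * \<omega>)\<^sup>2 / 2)) \<longlonglongrightarrow> 1"
proof -
  have "(\<lambda>n. exp (- (inverse (real (Suc n)) * \<omega>)\<^sup>2 / 2)) \<longlonglongrightarrow> exp (- (0 * \<omega>)\<^sup>2 / 2)"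
    by (intro tendsto_intros LIMSEQ_inverse_real_of_nat) simp
  then show ?thesis by simp
qed

text \<open>Fatou's lemma as the damping disappears. The damped integrals are at most
  \<open>2 * pi\<close> times the squared norm of \<open>g\<close>, because averaging over a
  probability law does not increase the norm.\<close>

lemma fourier_square_integrable:
  assumes g: "integrable lborel g" "g \<in> L2"
  shows "integrable lborel (\<lambda>\<omega>. (cmod (fourier g \<omega>))\<^sup>2)"
proof (rule integrableI_bounded)
  note [measurable] = L2_measurable[OF g(2)]
  show "(\<lambda>\<omega>. (cmod (fourier g \<omega>))\<^sup>2) \<in> borel_measurable lborel" by measurable
  let ?F = "\<lambda>n \<omega>. exp (- (inverse (real (Suc n)) * \<omega>)\<^sup>2 / 2) * (cmod (fourier g \<omega>))\<^sup>2"
  have "(\<integral>\<^sup>+ \<omega>. ennreal ((cmod (fourier g \<omega>))\<^sup>2) \<partial>lborel)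
      = (\<integral>\<^sup>+ \<omega>. liminf (\<lambda>n. ennreal (?F n \<omega>)) \<partial>lborel)"
  proof (rule nn_integral_cong)
    fix \<omega>
    have "(\<lambda>n. ennreal (?F n \<omega>)) \<longlonglongrightarrow> ennreal (1 * (cmod (fourier g \<omega>))\<^sup>2)"
      by (intro tendsto_ennrealI tendsto_mult gaussian_tendsto_1 tendsto_const)
    then show "ennreal ((cmod (fourier g \<omega>))\<^sup>2) = liminf (\<lambda>n. ennreal (?F n \<omega>))"
      using lim_imp_Liminf[OF sequentially_bot] by fastforce
  qed
  also have "\<dots> \<le> liminf (\<lambda>n. \<integral>\<^sup>+ \<omega>. ennreal (?F n \<omega>) \<partial>lborel)"
    by (rule nn_integral_liminf) measurable
  also have "\<dots> \<le> limsup (\<lambda>n. \<integral>\<^sup>+ \<omega>. ennreal (?F n \<omega>) \<partial>lborel)"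
    by (intro Liminf_le_Limsup sequentially_bot)
  also have "\<dots> \<le> ennreal (2 * pi * (L2_norm g * L2_norm g))"
  proof (intro Limsup_bounded always_eventually allI)
    fix n
    let ?\<sigma> = "inverse (real (Suc n))"
    interpret A: shift_average std_normal_distribution "\<lambda>z. ?\<sigma> * z" by (rule shift_average_normal)
    interpret N: prob_space std_normal_distribution by (rule prob_space_normal_density) simp
    have fb: "cmod (fourier g \<omega>) \<le> (LINT t|lborel. \<bar>g t\<bar>)" for \<omega>
      unfolding fourier_def
      using integral_norm_bound[of lborel "\<lambda>t. complex_of_real (g t) * cis (- \<omega> * t)"]
      by (simp add: norm_mult)
    have int: "integrable lborel (?F n)"
    proof (rule Bochner_Integration.integrable_bound)
      \<comment> \<open>Up to a constant the damping factor is the normal density of standard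
        deviation \<open>Suc n\<close>.\<close>
      have "integrable lborel (\<lambda>\<omega>. normal_density 0 (real (Suc n)) \<omega>)" by simp
      then have "integrable lborel (\<lambda>\<omega>. sqrt (2 * pi * (real (Suc n))\<^sup>2) * normal_density 0 (real (Suc n)) \<omega>)"
        by (rule integrable_mult_right)
      moreover have "sqrt (2 * pi * (real (Suc n))\<^sup>2) * normal_density 0 (real (Suc n)) \<omega>
          = exp (- (?\<sigma> * \<omega>)\<^sup>2 / 2)" for \<omega>
        unfolding normal_density_def by (simp add: power_mult_distrib field_simps)
      ultimately have "integrable lborel (\<lambda>\<omega>. exp (- (?\<sigma> * \<omega>)\<^sup>2 / 2))"
        by (simp only:)
      then show "integrable lborel (\<lambda>\<omega>. exp (- (?\<sigma> * \<omega>)\<^sup>2 / 2) * (LINT t|lborel. \<bar>g t\<bar>)\<^sup>2)"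
        by simp
      show "AE \<omega> in lborel. norm (?F n \<omega>) \<le> norm (exp (- (?\<sigma> * \<omega>)\<^sup>2 / 2) * (LINT t|lborel. \<bar>g t\<bar>)\<^sup>2)"
        using fb by (auto intro!: mult_left_mono power_mono simp: abs_mult)
    qed measurable
    have "complex_of_real (LINT \<omega>|lborel. ?F n \<omega>)
        = (LINT \<omega>|lborel. exp (- (?\<sigma> * \<omega>)\<^sup>2 / 2) *\<^sub>R (fourier g \<omega> * cnj (fourier g \<omega>)))"
      unfolding integral_complex_of_real[symmetric] complex_norm_square[symmetric]
      by (simp add: scaleR_conv_of_real)
    also have "\<dots> = complex_of_real (2 * pi * L2_inner (smooth ?\<sigma> g) g)"
      by (rule gaussian_parseval[OF g g]) simp
    finally have "(LINT \<omega>|lborel. ?F n \<omega>) = 2 * pi * L2_inner (smooth ?\<sigma> g) g"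
      by (simp only: of_real_eq_iff)
    also have "\<dots> \<le> 2 * pi * (L2_norm g * L2_norm g)"
    proof (rule mult_left_mono)
      have "L2_norm (smooth ?\<sigma> g) \<le> L2_norm g" using A.avg_L2(2)[OF g(2)] N.prob_space by simp
      then have "L2_norm (smooth ?\<sigma> g) * L2_norm g \<le> L2_norm g * L2_norm g"
        by (intro mult_right_mono) auto
      then show "L2_inner (smooth ?\<sigma> g) g \<le> L2_norm g * L2_norm g"
        using L2_Cauchy_Schwarz[OF A.avg_L2(1)[OF g(2)] g(2)] by linarith
    qed simp
    finally show "(\<integral>\<^sup>+ \<omega>. ennreal (?F n \<omega>) \<partial>lborel) \<le> ennreal (2 * pi * (L2_norm g * L2_norm g))"
      using int by (simp add: nn_integral_eq_integral ennreal_leI)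
  qed
  also have "\<dots> < \<infinity>" by simp
  finally show "(\<integral>\<^sup>+ \<omega>. ennreal (norm ((cmod (fourier g \<omega>))\<^sup>2)) \<partial>lborel) < \<infinity>" by simp
qed

section \<open>Removal of the damping\<close>

lemma integrable_mult_cnj:
  fixes X Y :: "'a \<Rightarrow> complex"
  assumes [measurable]: "X \<in> borel_measurable M" "Y \<in> borel_measurable M"
    and "integrable M (\<lambda>x. (cmod (X x))\<^sup>2)" "integrable M (\<lambda>x. (cmod (Y x))\<^sup>2)"
  shows "integrable M (\<lambda>x. X x * cnj (Y x))"
proof (rule Bochner_Integration.integrable_bound)
  show "integrable M (\<lambda>x. cmod (X x) * cmod (Y x))"
    by (intro integrable_mult_of_squares) (use assms in auto)
  show "(\<lambda>x. X x * cnj (Y x)) \<in> borel_measurable M"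
    by (intro borel_measurable_times borel_measurable_continuous_on[OF continuous_on_cnj[OF continuous_on_id]]) auto
qed (simp add: norm_mult)

text \<open>The shift is moved to \<open>q\<close>, where it converges pointwise by continuity and
  is dominated by boundedness. Continuity of translation in the norm is thus avoided.\<close>

lemma L2_inner_shift_tendsto:
  assumes g: "integrable lborel g" "g \<in> L2"
    and q: "q \<in> L2" "continuous_on UNIV q" "\<And>t. \<bar>q t\<bar> \<le> B"
    and s: "s \<longlonglongrightarrow> (0::real)"
  shows "(\<lambda>n. L2_inner (\<lambda>t. g (t - s n)) q) \<longlonglongrightarrow> L2_inner g q"
proof -
  note [measurable] = L2_measurable[OF g(2)] L2_measurable[OF q(1)]
  have eq: "L2_inner (\<lambda>t. g (t - s n)) q = (LINT t|lborel. g t * q (t + s n))" for n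
    unfolding L2_inner_shift_swap by (simp add: L2_inner_def mult.commute)
  show ?thesis
    unfolding eq unfolding L2_inner_def
  proof (rule integral_dominated_convergence)
    show "integrable lborel (\<lambda>t. \<bar>g t\<bar> * B)" using g(1) by simp
    have "(\<lambda>n. g t * q (t + s n)) \<longlonglongrightarrow> g t * q t" for t
    proof -
      have "(\<lambda>n. t + s n) \<longlonglongrightarrow> t + 0" by (intro tendsto_add tendsto_const s)
      then have "(\<lambda>n. q (t + s n)) \<longlonglongrightarrow> q t"
        by (intro continuous_on_tendsto_compose[OF q(2)]) auto
      then show ?thesis by (rule tendsto_mult_left)
    qed
    then show "AE t in lborel. (\<lambda>n. g t * q (t + s n)) \<longlonglongrightarrow> g t * q t" by simp
    show "AE t in lborel. norm (g t * q (t + s n)) \<le> \<bar>g t\<bar> * B" for n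
      using q(3) by (auto simp: abs_mult intro!: mult_left_mono)
  qed measurable
qed

text \<open>Both sides of the damped identity converge: in frequency by dominated convergence, the
  product of transforms being integrable, and in time by dominated convergence over the normal
  variable. Regularity is asked of \<open>q\<close> alone, so that \<open>g\<close> may be a clipped
  signal.\<close>

lemma parseval:
  assumes g: "integrable lborel g" "g \<in> L2"
    and q: "integrable lborel q" "q \<in> L2" "continuous_on UNIV q" "\<And>t. \<bar>q t\<bar> \<le> B"
  shows "(LINT \<omega>|lborel. fourier g \<omega> * cnj (fourier q \<omega>)) = complex_of_real (2 * pi * L2_inner g q)"
proof (rule LIMSEQ_unique)
  note [measurable] = L2_measurable[OF g(2)] L2_measurable[OF q(2)]
  let ?\<sigma> = "\<lambda>n. inverse (real (Suc n))"
  let ?X = "\<lambda>\<omega>. fourier g \<omega> * cnj (fourier q \<omega>)"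
  have X: "integrable lborel ?X"
    by (intro integrable_mult_cnj fourier_square_integrable g q) auto
  note [measurable] = borel_measurable_integrable[OF X]
  have "(\<lambda>n. LINT \<omega>|lborel. exp (- (?\<sigma> n * \<omega>)\<^sup>2 / 2) *\<^sub>R ?X \<omega>) \<longlonglongrightarrow> (LINT \<omega>|lborel. ?X \<omega>)"
  proof (rule integral_dominated_convergence)
    show "integrable lborel (\<lambda>\<omega>. cmod (?X \<omega>))" using X by (rule integrable_norm)
    have "(\<lambda>n. exp (- (?\<sigma> n * \<omega>)\<^sup>2 / 2) *\<^sub>R ?X \<omega>) \<longlonglongrightarrow> 1 *\<^sub>R ?X \<omega>" for \<omega>
      by (intro tendsto_scaleR gaussian_tendsto_1 tendsto_const)
    then show "AE \<omega> in lborel. (\<lambda>n. exp (- (?\<sigma> n * \<omega>)\<^sup>2 / 2) *\<^sub>R ?X \<omega>) \<longlonglongrightarrow> ?X \<omega>" by simp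
    show "AE \<omega> in lborel. norm (exp (- (?\<sigma> n * \<omega>)\<^sup>2 / 2) *\<^sub>R ?X \<omega>) \<le> cmod (?X \<omega>)" for n
      by (auto simp: norm_mult intro!: mult_left_le_one_le)
  qed measurable
  then show "(\<lambda>n. complex_of_real (2 * pi * L2_inner (smooth (?\<sigma> n) g) q)) \<longlonglongrightarrow> (LINT \<omega>|lborel. ?X \<omega>)"
    by (subst gaussian_parseval[OF g q(1,2), symmetric]) auto
  have "(\<lambda>n. L2_inner (smooth (?\<sigma> n) g) q) \<longlonglongrightarrow> L2_inner g q"
  proof -
    interpret N: prob_space std_normal_distribution by (rule prob_space_normal_density) simp
    have eq: "L2_inner (smooth (?\<sigma> n) g) q
        = (LINT z|std_normal_distribution. L2_inner (\<lambda>t. g (t - ?\<sigma> n * z)) q)" for n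
      by (rule shift_average.avg_inner[OF shift_average_normal g(2) q(2)])
    have "(\<lambda>n. LINT z|std_normal_distribution. L2_inner (\<lambda>t. g (t - ?\<sigma> n * z)) q)
        \<longlonglongrightarrow> (LINT z|std_normal_distribution. L2_inner g q)"
    proof (rule integral_dominated_convergence)
      show "integrable std_normal_distribution (\<lambda>z. L2_norm g * L2_norm q)" by simp
      show "AE z in std_normal_distribution. (\<lambda>n. L2_inner (\<lambda>t. g (t - ?\<sigma> n * z)) q) \<longlonglongrightarrow> L2_inner g q"
      proof (intro AE_I2 L2_inner_shift_tendsto[OF g q(2,3,4)])
        fix z :: real
        have "(\<lambda>n. ?\<sigma> n * z) \<longlonglongrightarrow> 0 * z" by (intro tendsto_mult LIMSEQ_inverse_real_of_nat tendsto_const)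
        then show "(\<lambda>n. ?\<sigma> n * z) \<longlonglongrightarrow> 0" by simp
      qed
      show "AE z in std_normal_distribution. norm (L2_inner (\<lambda>t. g (t - ?\<sigma> n * z)) q) \<le> L2_norm g * L2_norm q" for n
        using L2_inner_shift_bound[OF g(2) q(2)] by simp
      have m: "(\<lambda>s. L2_inner (\<lambda>t. g (t - s)) q) \<in> borel_measurable borel" by measurable
      show "(\<lambda>z. L2_inner (\<lambda>t. g (t - ?\<sigma> n * z)) q) \<in> borel_measurable std_normal_distribution" for n
        using measurable_compose[OF _ m, of "\<lambda>z. ?\<sigma> n * z" std_normal_distribution] by simp
    qed simp
    then show ?thesis unfolding eq using N.prob_space by simp
  qed
  then show "(\<lambda>n. complex_of_real (2 * pi * L2_inner (smooth (?\<sigma> n) g) q))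
      \<longlonglongrightarrow> complex_of_real (2 * pi * L2_inner g q)"
    by (intro tendsto_of_real tendsto_mult tendsto_const)
qed

section \<open>Coercivity on test functions\<close>

text \<open>Continuity serves Parseval's identity. Compact support makes the Fourier integrals over
  \<open>{-T..T}\<close> constant for large \<open>T\<close>, so that the limit in the mean is the
  ordinary transform.\<close>

definition test_fun :: "(real \<Rightarrow> real) \<Rightarrow> bool" where
  "test_fun q \<longleftrightarrow> continuous_on UNIV q \<and> (\<exists>R. \<forall>t. R < \<bar>t\<bar> \<longrightarrow> q t = 0)"

lemma test_funE:
  assumes "test_fun q"
  obtains R B where "continuous_on UNIV q" "0 \<le> R" "\<And>t. R < \<bar>t\<bar> \<Longrightarrow> q t = 0"
    "\<And>t. \<bar>q t\<bar> \<le> B" "integrable lborel q" "q \<in> L2"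
proof -
  obtain R where q: "continuous_on UNIV q" and R: "\<And>t. R < \<bar>t\<bar> \<Longrightarrow> q t = 0"
    using assms by (auto simp: test_fun_def)
  have [measurable]: "q \<in> borel_measurable borel" using q by (rule borel_measurable_continuous_onI)
  have "compact (q ` {- \<bar>R\<bar>..\<bar>R\<bar>})"
    by (intro compact_continuous_image continuous_on_subset[OF q]) auto
  then have "bounded (q ` {- \<bar>R\<bar>..\<bar>R\<bar>})" by (rule compact_imp_bounded)
  then obtain C where "\<forall>y\<in>q ` {- \<bar>R\<bar>..\<bar>R\<bar>}. norm y \<le> C" unfolding bounded_iff by blast
  then have C: "\<And>t. t \<in> {- \<bar>R\<bar>..\<bar>R\<bar>} \<Longrightarrow> \<bar>q t\<bar> \<le> C" by simp
  have R': "q t = 0" if "\<bar>R\<bar> < \<bar>t\<bar>" for t using R[of t] that by linarith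
  have B: "\<bar>q t\<bar> \<le> \<bar>C\<bar>" for t
  proof (cases "\<bar>t\<bar> \<le> \<bar>R\<bar>")
    case True
    then have "\<bar>q t\<bar> \<le> C" by (intro C) auto
    then show ?thesis by linarith
  qed (use R'[of t] in simp)
  have ind: "integrable lborel (\<lambda>t. c * indicator {- \<bar>R\<bar>..\<bar>R\<bar>} t)" for c :: real by simp
  have q1: "integrable lborel q"
  proof (rule Bochner_Integration.integrable_bound[OF ind[of C]])
    have "norm (q t) \<le> norm (C * indicator {- \<bar>R\<bar>..\<bar>R\<bar>} t)" for t
    proof (cases "\<bar>t\<bar> \<le> \<bar>R\<bar>")
      case True
      then have "t \<in> {- \<bar>R\<bar>..\<bar>R\<bar>}" by auto
      then show ?thesis using B[of t] by simp
    qed (use R'[of t] in simp)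
    then show "AE t in lborel. norm (q t) \<le> norm (C * indicator {- \<bar>R\<bar>..\<bar>R\<bar>} t)" by simp
  qed measurable
  have "integrable lborel (\<lambda>t. (q t)\<^sup>2)"
  proof (rule Bochner_Integration.integrable_bound)
    show "integrable lborel (\<lambda>t. \<bar>C\<bar> * q t)" using q1 by simp
    have "norm ((q t)\<^sup>2) \<le> norm (\<bar>C\<bar> * q t)" for t
      using mult_right_mono[OF B[of t], of "\<bar>q t\<bar>"] by (simp add: power2_eq_square abs_mult)
    then show "AE t in lborel. norm ((q t)\<^sup>2) \<le> norm (\<bar>C\<bar> * q t)" by simp
  qed measurable
  then have "q \<in> L2" by (simp add: L2_def)
  then show thesis using that[of "\<bar>R\<bar>" "\<bar>C\<bar>"] q R' B q1 by simp
qed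

section \<open>Frequency responses of averages\<close>

context shift_average
begin

text \<open>The Fourier-Stieltjes transform of the image of \<open>N\<close> under
  \<open>l\<close>.\<close>

definition transfer :: "real \<Rightarrow> complex" where
  "transfer \<omega> = (LINT n|N. cis (- \<omega> * l n))"

lemma transfer_measurable [measurable]: "transfer \<in> borel_measurable borel"
  unfolding transfer_def by measurable

lemma norm_transfer: "cmod (transfer \<omega>) \<le> measure N (space N)"
  unfolding transfer_def using integral_norm_bound[of N "\<lambda>n. cis (- \<omega> * l n)"] by simp

text \<open>A shift multiplies the transform by a phase. Parseval's identity for each shift,
  averaged over \<open>N\<close>, collects these phases into \<open>transfer\<close>.\<close>

lemma transfer_parseval:
  assumes g: "integrable lborel g" "g \<in> L2"
    and q: "integrable lborel q" "q \<in> L2" "continuous_on UNIV q" "\<And>t. \<bar>q t\<bar> \<le> B"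
  shows "complex_of_real (2 * pi * L2_inner (avg g) q)
    = (LINT \<omega>|lborel. transfer \<omega> * (fourier g \<omega> * cnj (fourier q \<omega>)))"
proof -
  note [measurable] = L2_measurable[OF g(2)] L2_measurable[OF q(2)]
  let ?X = "\<lambda>\<omega>. fourier g \<omega> * cnj (fourier q \<omega>)"
  have X: "integrable lborel ?X"
    by (intro integrable_mult_cnj fourier_square_integrable g q) auto
  note [measurable] = borel_measurable_integrable[OF X]
  have int: "integrable (lborel \<Otimes>\<^sub>M N) (\<lambda>(\<omega>, n). cis (- \<omega> * l n) * ?X \<omega>)"
  proof (rule P.Fubini_integrable)
    show "(\<lambda>(\<omega>, n). cis (- \<omega> * l n) * ?X \<omega>) \<in> borel_measurable (lborel \<Otimes>\<^sub>M N)" by measurable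
    show "integrable lborel (\<lambda>\<omega>. LINT n|N. norm (case (\<omega>, n) of (\<omega>, n) \<Rightarrow> cis (- \<omega> * l n) * ?X \<omega>))"
      using integrable_mult_right[OF integrable_norm[OF X], of "measure N (space N)"]
      by (simp add: norm_mult mult.assoc)
    show "AE \<omega> in lborel. integrable N (\<lambda>n. case (\<omega>, n) of (\<omega>, n) \<Rightarrow> cis (- \<omega> * l n) * ?X \<omega>)"
    proof (rule AE_I2)
      fix \<omega> :: real
      show "integrable N (\<lambda>n. case (\<omega>, n) of (\<omega>, n) \<Rightarrow> cis (- \<omega> * l n) * ?X \<omega>)"
        by (rule integrable_const_bound[where B = "cmod (?X \<omega>)"]) (auto simp: norm_mult)
    qed
  qed
  have "complex_of_real (2 * pi * L2_inner (avg g) q)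
      = complex_of_real (LINT n|N. 2 * pi * L2_inner (\<lambda>t. g (t - l n)) q)"
    by (simp add: avg_inner[OF g(2) q(2)])
  also have "\<dots> = (LINT n|N. complex_of_real (2 * pi * L2_inner (\<lambda>t. g (t - l n)) q))"
    by (rule integral_complex_of_real[symmetric])
  also have "\<dots> = (LINT n|N. LINT \<omega>|lborel. cis (- \<omega> * l n) * ?X \<omega>)"
  proof (rule Bochner_Integration.integral_cong[OF refl])
    fix n
    have "(LINT \<omega>|lborel. fourier (\<lambda>t. g (t - l n)) \<omega> * cnj (fourier q \<omega>))
        = complex_of_real (2 * pi * L2_inner (\<lambda>t. g (t - l n)) q)"
      by (rule parseval[OF _ _ q]) (intro lborel_integrable_shift L2_shift g)+
    then show "complex_of_real (2 * pi * L2_inner (\<lambda>t. g (t - l n)) q)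
        = (LINT \<omega>|lborel. cis (- \<omega> * l n) * ?X \<omega>)"
      by (simp add: fourier_shift mult.assoc)
  qed
  also have "\<dots> = (LINT \<omega>|lborel. LINT n|N. cis (- \<omega> * l n) * ?X \<omega>)"
    by (rule P.Fubini_integral[OF int])
  also have "\<dots> = (LINT \<omega>|lborel. transfer \<omega> * ?X \<omega>)"
    unfolding transfer_def integral_mult_left_zero ..
  finally show ?thesis .
qed

end

abbreviation transfer_atoms :: "gen_fun \<Rightarrow> real \<Rightarrow> complex" where
  "transfer_atoms h \<equiv> shift_average.transfer (atoms_measure h) (loc h)"

abbreviation transfer_dens :: "gen_fun \<Rightarrow> real \<Rightarrow> complex" where
  "transfer_dens h \<equiv> shift_average.transfer (dens_measure h) (\<lambda>s. s)"

lemma gen_fourier_transfer: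
  assumes h: "h \<in> Hp_set"
  shows "gen_fourier h \<omega> = transfer_atoms h \<omega> + transfer_dens h \<omega>"
proof -
  interpret A: shift_average "atoms_measure h" "loc h" by (rule shift_average_atoms[OF h])
  interpret D: shift_average "dens_measure h" "\<lambda>s. s" by (rule shift_average_dens[OF h])
  have "integrable (atoms_measure h) (\<lambda>i. cis (- \<omega> * loc h i))"
    by (rule A.integrable_const_bound[where B = 1]) auto
  then show ?thesis
    using integral_atoms_measure[OF h, of "\<lambda>i. cis (- \<omega> * loc h i)"]
      integral_dens_measure[OF h, of "\<lambda>s. cis (- \<omega> * s)"]
    by (simp add: gen_fourier_def A.transfer_def D.transfer_def scaleR_conv_of_real)
qed

lemma gen_fourier_measurable: "h \<in> Hp_set \<Longrightarrow> gen_fourier h \<in> borel_measurable borel"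
  using shift_average.transfer_measurable[OF shift_average_atoms, of h]
    shift_average.transfer_measurable[OF shift_average_dens, of h]
  by (simp add: gen_fourier_transfer cong: measurable_cong)

lemma norm_gen_fourier: "h \<in> Hp_set \<Longrightarrow> cmod (gen_fourier h \<omega>) \<le> H_norm h"
  unfolding gen_fourier_transfer H_norm_Hp
  by (intro norm_triangle_mono shift_average.norm_transfer shift_average_atoms shift_average_dens)

lemma mult_freq_measurable:
  "hp \<in> Hp_set \<Longrightarrow> hm \<in> Hp_set \<Longrightarrow> mult_freq hp hm \<in> borel_measurable borel"
  unfolding mult_freq_def[abs_def]
  by (intro borel_measurable_add borel_measurable_diff borel_measurable_const gen_fourier_measurable)

lemma norm_mult_freq:
  assumes "hp \<in> Hp_set" "hm \<in> Hp_set"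
  shows "cmod (mult_freq hp hm \<omega>) \<le> 1 + H_norm hp + H_norm hm"
  using norm_gen_fourier[OF assms(1), of \<omega>] norm_gen_fourier[OF assms(2), of \<omega>]
    norm_triangle_ineq[of "1 - gen_fourier hp \<omega>" "gen_fourier hm \<omega>"]
    norm_triangle_ineq4[of 1 "gen_fourier hp \<omega>"]
  by (simp add: mult_freq_def)

lemma integrable_bounded_mult:
  fixes X Y :: "'a \<Rightarrow> complex"
  assumes X: "integrable M X" and [measurable]: "Y \<in> borel_measurable M" and b: "\<And>x. cmod (Y x) \<le> b"
  shows "integrable M (\<lambda>x. Y x * X x)"
proof (rule Bochner_Integration.integrable_bound)
  show "integrable M (\<lambda>x. b * cmod (X x))" using X by simp
  note [measurable] = borel_measurable_integrable[OF X]
  show "(\<lambda>x. Y x * X x) \<in> borel_measurable M" by measurable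
  show "AE x in M. norm (Y x * X x) \<le> norm (b * cmod (X x))"
    using b by (auto simp: norm_mult abs_mult intro!: mult_right_mono order_trans[OF b abs_ge_self])
qed

lemma mult_op_parseval:
  assumes h: "hp \<in> Hp_set" "hm \<in> Hp_set" and g: "integrable lborel g" "g \<in> L2"
    and q: "integrable lborel q" "q \<in> L2" "continuous_on UNIV q" "\<And>t. \<bar>q t\<bar> \<le> B"
  shows "complex_of_real (2 * pi * L2_inner (mult_op hp hm g) q)
    = (LINT \<omega>|lborel. mult_freq hp hm \<omega> * (fourier g \<omega> * cnj (fourier q \<omega>)))"
proof -
  let ?X = "\<lambda>\<omega>. fourier g \<omega> * cnj (fourier q \<omega>)"
  have X: "integrable lborel ?X"
    by (intro integrable_mult_cnj fourier_square_integrable g q)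
      (auto intro!: fourier_measurable L2_measurable g q)
  have conv: "complex_of_real (2 * pi * L2_inner (conv_op h g) q) = (LINT \<omega>|lborel. gen_fourier h \<omega> * ?X \<omega>)"
    if h: "h \<in> Hp_set" for h
  proof -
    interpret A: shift_average "atoms_measure h" "loc h" by (rule shift_average_atoms[OF h])
    interpret D: shift_average "dens_measure h" "\<lambda>s. s" by (rule shift_average_dens[OF h])
    have "L2_inner (conv_op h g) q = L2_inner (A.avg g) q + L2_inner (D.avg g) q"
      by (simp add: conv_op_inner h g q A.avg_inner D.avg_inner)
    then have "complex_of_real (2 * pi * L2_inner (conv_op h g) q)
        = (LINT \<omega>|lborel. A.transfer \<omega> * ?X \<omega>) + (LINT \<omega>|lborel. D.transfer \<omega> * ?X \<omega>)"
      by (simp only: A.transfer_parseval[OF g q, symmetric] D.transfer_parseval[OF g q, symmetric]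
          distrib_left of_real_add)
    also have "\<dots> = (LINT \<omega>|lborel. A.transfer \<omega> * ?X \<omega> + D.transfer \<omega> * ?X \<omega>)"
      by (intro Bochner_Integration.integral_add[symmetric] integrable_bounded_mult[OF X _ A.norm_transfer]
          integrable_bounded_mult[OF X _ D.norm_transfer]) auto
    finally show ?thesis by (simp add: gen_fourier_transfer[OF h] distrib_right)
  qed
  have int: "integrable lborel (\<lambda>\<omega>. gen_fourier h \<omega> * ?X \<omega>)" if "h \<in> Hp_set" for h
    using that by (intro integrable_bounded_mult[OF X _ norm_gen_fourier]) (auto simp: gen_fourier_measurable)
  have "complex_of_real (2 * pi * L2_inner (mult_op hp hm g) q)
      = complex_of_real (2 * pi * L2_inner g q) - complex_of_real (2 * pi * L2_inner (conv_op hp g) q)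
        + complex_of_real (2 * pi * L2_inner (conv_op hm g) q)"
    by (simp add: mult_op_inner[OF h g(2) q(2)] algebra_simps)
  also have "\<dots> = (LINT \<omega>|lborel. ?X \<omega> - gen_fourier hp \<omega> * ?X \<omega> + gen_fourier hm \<omega> * ?X \<omega>)"
    unfolding conv[OF h(1)] conv[OF h(2)] parseval[OF g q, symmetric]
    using X int[OF h(1)] int[OF h(2)] by simp
  also have "\<dots> = (LINT \<omega>|lborel. mult_freq hp hm \<omega> * ?X \<omega>)"
    by (rule Bochner_Integration.integral_cong) (auto simp: mult_freq_def algebra_simps)
  finally show ?thesis .
qed

section \<open>The frequency condition on test functions\<close>

lemma fourier_norm_square:
  assumes "test_fun q"
  shows "(LINT \<omega>|lborel. (cmod (fourier q \<omega>))\<^sup>2) = 2 * pi * (L2_norm q)\<^sup>2"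
proof -
  obtain R B where q: "integrable lborel q" "q \<in> L2" "continuous_on UNIV q" "\<And>t. \<bar>q t\<bar> \<le> B"
    using test_funE[OF assms] by metis
  have "complex_of_real (LINT \<omega>|lborel. (cmod (fourier q \<omega>))\<^sup>2)
      = (LINT \<omega>|lborel. fourier q \<omega> * cnj (fourier q \<omega>))"
    unfolding integral_complex_of_real[symmetric] complex_norm_square ..
  also have "\<dots> = complex_of_real (2 * pi * L2_inner q q)" by (rule parseval[OF q(1,2) q])
  finally show ?thesis unfolding of_real_eq_iff by (simp add: L2_norm_square)
qed

lemma has_fourier_transform_test_fun:
  assumes "test_fun q"
  shows "has_fourier_transform q (fourier q)"
proof -
  obtain R where q: "q \<in> L2" and R: "0 \<le> R" "\<And>t. R < \<bar>t\<bar> \<Longrightarrow> q t = 0"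
    using test_funE[OF assms] by metis
  have "(LINT t:{-T..T}|lborel. complex_of_real (q t) * cis (- \<omega> * t)) = fourier q \<omega>" if "R \<le> T" for T \<omega>
    unfolding set_lebesgue_integral_def fourier_def
  proof (rule Bochner_Integration.integral_cong[OF refl])
    fix t
    show "indicator {-T..T} t *\<^sub>R (complex_of_real (q t) * cis (- \<omega> * t)) = complex_of_real (q t) * cis (- \<omega> * t)"
      using R(2)[of t] that by (auto simp: indicator_def abs_if split: if_splits)
  qed
  then have "\<forall>\<^sub>F T in at_top. (\<integral>\<^sup>+ \<omega>. ennreal ((cmod (fourier q \<omega> -
      (LINT t:{-T..T}|lborel. complex_of_real (q t) * cis (- \<omega> * t))))\<^sup>2) \<partial>lborel) = 0"
    by (intro eventually_mono[OF eventually_ge_at_top[of R]]) simp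
  then show ?thesis
    using fourier_measurable[OF L2_measurable[OF q]] by (simp add: has_fourier_transform_def tendsto_eventually)
qed

lemma L2_clip_tendsto:
  assumes g: "g \<in> L2"
  shows "(\<lambda>n. L2_norm (\<lambda>t. g t - indicator {- real n..real n} t * g t)) \<longlonglongrightarrow> 0"
proof -
  note [measurable] = L2_measurable[OF g]
  have "(\<lambda>n. LINT t|lborel. (g t - indicator {- real n..real n} t * g t)\<^sup>2) \<longlonglongrightarrow> (LINT t|(lborel :: real measure). 0)"
  proof (rule integral_dominated_convergence)
    show "integrable lborel (\<lambda>t. (g t)\<^sup>2)" using g by (simp add: L2_def)
    have "(\<lambda>n. (g t - indicator {- real n..real n} t * g t)\<^sup>2) \<longlonglongrightarrow> 0" for t
    proof (rule tendsto_eventually)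
      obtain m :: nat where "\<bar>t\<bar> \<le> real m" using real_arch_simple by blast
      then show "\<forall>\<^sub>F n in sequentially. (g t - indicator {- real n..real n} t * g t)\<^sup>2 = 0"
        by (intro eventually_sequentiallyI[of m]) (auto simp: indicator_def)
    qed
    then show "AE t in lborel. (\<lambda>n. (g t - indicator {- real n..real n} t * g t)\<^sup>2) \<longlonglongrightarrow> 0" by simp
    show "AE t in lborel. norm ((g t - indicator {- real n..real n} t * g t)\<^sup>2) \<le> (g t)\<^sup>2" for n
      by (auto simp: indicator_def)
  qed measurable
  from tendsto_real_sqrt[OF this] show ?thesis by (simp add: L2_norm_def)
qed

text \<open>Parseval's identity is out of reach for \<open>G q\<close>, which need not be
  integrable, but holds for its clips \<open>g n\<close>. Their transforms \<open>Z n\<close>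
  approximate \<open>Ghat * X\<close> in mean square, so the frequency condition holds for the clips
  up to an error \<open>K * \<eta> * x\<close>.\<close>

lemma coercive_test_fun:
  assumes h: "hp \<in> Hp_set" "hm \<in> Hp_set"
    and freq: "frequency_response G Ghat" and Gq: "G q \<in> L2"
    and \<epsilon>: "0 < \<epsilon>" "\<And>\<omega>. \<epsilon> \<le> Re (mult_freq hp hm \<omega> * Ghat \<omega>)"
    and tq: "test_fun q"
  shows "\<epsilon> * (L2_norm q)\<^sup>2 \<le> L2_inner (mult_op hp hm (G q)) q"
proof -
  obtain R B where q: "integrable lborel q" "q \<in> L2" "continuous_on UNIV q" "\<And>t. \<bar>q t\<bar> \<le> B"
    using test_funE[OF tq] by metis
  define X where "X = fourier q"
  define Y where "Y = (\<lambda>\<omega>. Ghat \<omega> * X \<omega>)"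
  define g where "g n = (\<lambda>t. indicator {- real n..real n} t * G q t)" for n :: nat
  define Z where "Z n = fourier (g n)" for n
  have gL2: "g n \<in> L2" for n unfolding g_def by (intro L2_indicator Gq) simp
  \<comment> \<open>The indicator of a bounded interval is square-integrable, so its product with
    \<open>G q\<close> is integrable.\<close>
  have gL1: "integrable lborel (g n)" for n
  proof -
    have "(\<lambda>t. indicator {- real n..real n} t) \<in> L2"
      by (simp add: L2_def power2_eq_square indicator_inter_arith[symmetric])
    from L2_integrable_mult[OF this Gq] show ?thesis by (simp add: g_def)
  qed
  have X2: "integrable lborel (\<lambda>\<omega>. (cmod (X \<omega>))\<^sup>2)"
    unfolding X_def by (intro fourier_square_integrable q)
  have Z2: "integrable lborel (\<lambda>\<omega>. (cmod (Z n \<omega>))\<^sup>2)" for n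
    unfolding Z_def by (intro fourier_square_integrable gL1 gL2)
  have hX: "has_fourier_transform (G q) Y"
    using freq q(2) has_fourier_transform_test_fun[OF tq] by (simp add: frequency_response_def X_def Y_def)
  have [measurable]: "X \<in> borel_measurable borel" "Y \<in> borel_measurable borel" "Z n \<in> borel_measurable borel"
    "Ghat \<in> borel_measurable borel" for n
    unfolding X_def Z_def using hX freq
    by (auto simp: has_fourier_transform_def frequency_response_def intro!: fourier_measurable L2_measurable q gL2)
  note [measurable] = mult_freq_measurable[OF h]
  have Zeq: "(LINT t:{- real n..real n}|lborel. complex_of_real (G q t) * cis (- \<omega> * t)) = Z n \<omega>" for n \<omega>
    unfolding set_lebesgue_integral_def Z_def fourier_def g_def
    by (rule Bochner_Integration.integral_cong) (auto simp: indicator_def)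
  \<comment> \<open>Along integer \<open>T\<close> the limit in the mean that defines the transform
    of \<open>G q\<close> is a statement about the clips.\<close>
  have lim: "(\<lambda>n. \<integral>\<^sup>+ \<omega>. ennreal ((cmod (Y \<omega> - Z n \<omega>))\<^sup>2) \<partial>lborel) \<longlonglongrightarrow> 0"
    using filterlim_compose[OF conjunct2[OF hX[unfolded has_fourier_transform_def]] filterlim_real_sequentially]
    by (simp only: Zeq)
  define K where "K = 1 + H_norm hp + H_norm hm"
  have K: "cmod (mult_freq hp hm \<omega>) \<le> K" for \<omega> unfolding K_def by (rule norm_mult_freq[OF h])
  have K0: "0 \<le> K" using K[of 0] norm_ge_zero order_trans by blast
  define x where "x = sqrt (LINT \<omega>|lborel. (cmod (X \<omega>))\<^sup>2)"
  have x0: "0 \<le> x" by (simp add: x_def)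
  have xx: "x\<^sup>2 = 2 * pi * (L2_norm q)\<^sup>2"
    using fourier_norm_square[OF tq] by (simp add: x_def X_def)

  have lower: "2 * pi * (\<epsilon> * (L2_norm q)\<^sup>2) \<le> 2 * pi * L2_inner (mult_op hp hm (g n)) q + K * \<eta> * x"
    if d: "(\<integral>\<^sup>+ \<omega>. ennreal ((cmod (Y \<omega> - Z n \<omega>))\<^sup>2) \<partial>lborel) < ennreal (\<eta>\<^sup>2)" and \<eta>: "0 < \<eta>" for \<eta> n
  proof -
    have D2: "integrable lborel (\<lambda>\<omega>. (cmod (Y \<omega> - Z n \<omega>))\<^sup>2)"
      using d by (intro integrableI_bounded) (auto intro: order.strict_trans)
    have Dn: "(LINT \<omega>|lborel. (cmod (Y \<omega> - Z n \<omega>))\<^sup>2) \<le> \<eta>\<^sup>2"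
    proof -
      have "ennreal (LINT \<omega>|lborel. (cmod (Y \<omega> - Z n \<omega>))\<^sup>2) \<le> ennreal (\<eta>\<^sup>2)"
        using d nn_integral_eq_integral[OF D2] by (simp add: ennreal_less_iff)
      then show ?thesis by simp
    qed
    have DX: "integrable lborel (\<lambda>\<omega>. (Y \<omega> - Z n \<omega>) * cnj (X \<omega>))"
      by (intro integrable_mult_cnj D2 X2) auto
    have ZX: "integrable lborel (\<lambda>\<omega>. Z n \<omega> * cnj (X \<omega>))"
      by (intro integrable_mult_cnj Z2 X2) auto
    have mDX: "integrable lborel (\<lambda>\<omega>. mult_freq hp hm \<omega> * ((Y \<omega> - Z n \<omega>) * cnj (X \<omega>)))"
      and mZX: "integrable lborel (\<lambda>\<omega>. mult_freq hp hm \<omega> * (Z n \<omega> * cnj (X \<omega>)))"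
      by (intro integrable_bounded_mult[OF DX _ K] integrable_bounded_mult[OF ZX _ K]; measurable)+
    \<comment> \<open>\<open>Ghat\<close> is known only to be measurable; the splitting into error
      and clip is also what makes the right side integrable.\<close>
    have eq: "mult_freq hp hm \<omega> * ((Y \<omega> - Z n \<omega>) * cnj (X \<omega>)) + mult_freq hp hm \<omega> * (Z n \<omega> * cnj (X \<omega>))
        = (mult_freq hp hm \<omega> * Ghat \<omega>) * complex_of_real ((cmod (X \<omega>))\<^sup>2)" for \<omega>
      unfolding complex_norm_square Y_def by (simp add: algebra_simps)
    have "\<epsilon> * x\<^sup>2 = (LINT \<omega>|lborel. \<epsilon> * (cmod (X \<omega>))\<^sup>2)"
      by (simp add: x_def)
    also have "\<dots> \<le> (LINT \<omega>|lborel. Re (mult_freq hp hm \<omega> * ((Y \<omega> - Z n \<omega>) * cnj (X \<omega>))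
        + mult_freq hp hm \<omega> * (Z n \<omega> * cnj (X \<omega>))))"
    proof (rule integral_mono)
      show "integrable lborel (\<lambda>\<omega>. \<epsilon> * (cmod (X \<omega>))\<^sup>2)" using X2 by simp
      show "integrable lborel (\<lambda>\<omega>. Re (mult_freq hp hm \<omega> * ((Y \<omega> - Z n \<omega>) * cnj (X \<omega>))
          + mult_freq hp hm \<omega> * (Z n \<omega> * cnj (X \<omega>))))"
        by (intro integrable_Re Bochner_Integration.integrable_add mDX mZX)
      show "\<epsilon> * (cmod (X \<omega>))\<^sup>2 \<le> Re (mult_freq hp hm \<omega> * ((Y \<omega> - Z n \<omega>) * cnj (X \<omega>))
          + mult_freq hp hm \<omega> * (Z n \<omega> * cnj (X \<omega>)))" for \<omega>
        unfolding eq using mult_right_mono[OF \<epsilon>(2)[of \<omega>], of "(cmod (X \<omega>))\<^sup>2"]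
        by (simp del: of_real_power)
    qed
    also have "\<dots> = Re ((LINT \<omega>|lborel. mult_freq hp hm \<omega> * ((Y \<omega> - Z n \<omega>) * cnj (X \<omega>)))
        + (LINT \<omega>|lborel. mult_freq hp hm \<omega> * (Z n \<omega> * cnj (X \<omega>))))"
      unfolding Bochner_Integration.integral_add[OF mDX mZX, symmetric]
      by (rule integral_Re) (intro Bochner_Integration.integrable_add mDX mZX)
    also have "(LINT \<omega>|lborel. mult_freq hp hm \<omega> * (Z n \<omega> * cnj (X \<omega>)))
        = complex_of_real (2 * pi * L2_inner (mult_op hp hm (g n)) q)"
      unfolding Z_def X_def by (rule mult_op_parseval[OF h gL1 gL2 q, symmetric])
    finally have 1: "\<epsilon> * x\<^sup>2 \<le> cmod (LINT \<omega>|lborel. mult_freq hp hm \<omega> * ((Y \<omega> - Z n \<omega>) * cnj (X \<omega>)))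
        + 2 * pi * L2_inner (mult_op hp hm (g n)) q"
      using complex_Re_le_cmod[of "LINT \<omega>|lborel. mult_freq hp hm \<omega> * ((Y \<omega> - Z n \<omega>) * cnj (X \<omega>))"]
      by simp
    have cs: "integrable lborel (\<lambda>\<omega>. cmod (Y \<omega> - Z n \<omega>) * cmod (X \<omega>))"
      using integrable_norm[OF DX] by (simp add: norm_mult)
    have "cmod (LINT \<omega>|lborel. mult_freq hp hm \<omega> * ((Y \<omega> - Z n \<omega>) * cnj (X \<omega>)))
        \<le> (LINT \<omega>|lborel. K * (cmod (Y \<omega> - Z n \<omega>) * cmod (X \<omega>)))"
    proof (rule order_trans[OF integral_norm_bound], rule integral_mono)
      show "norm (mult_freq hp hm \<omega> * ((Y \<omega> - Z n \<omega>) * cnj (X \<omega>))) \<le> K * (cmod (Y \<omega> - Z n \<omega>) * cmod (X \<omega>))" for \<omega>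
        unfolding norm_mult complex_mod_cnj by (intro mult_right_mono K) simp
    qed (use mDX cs in simp_all)
    also have "\<dots> = K * (LINT \<omega>|lborel. cmod (Y \<omega> - Z n \<omega>) * cmod (X \<omega>))" by simp
    also have "(LINT \<omega>|lborel. cmod (Y \<omega> - Z n \<omega>) * cmod (X \<omega>)) \<le> \<eta> * x"
    proof (rule power2_le_imp_le)
      have "(LINT \<omega>|lborel. cmod (Y \<omega> - Z n \<omega>) * cmod (X \<omega>))\<^sup>2
          \<le> (LINT \<omega>|lborel. (cmod (Y \<omega> - Z n \<omega>))\<^sup>2) * (LINT \<omega>|lborel. (cmod (X \<omega>))\<^sup>2)"
        by (intro integral_Cauchy_Schwarz D2 X2) auto
      also have "\<dots> \<le> \<eta>\<^sup>2 * x\<^sup>2"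
        using Dn by (intro mult_mono) (auto simp: x_def)
      finally show "(LINT \<omega>|lborel. cmod (Y \<omega> - Z n \<omega>) * cmod (X \<omega>))\<^sup>2 \<le> (\<eta> * x)\<^sup>2"
        by (simp add: power_mult_distrib)
      show "0 \<le> \<eta> * x" using \<eta> x0 by simp
    qed
    finally have "cmod (LINT \<omega>|lborel. mult_freq hp hm \<omega> * ((Y \<omega> - Z n \<omega>) * cnj (X \<omega>))) \<le> K * (\<eta> * x)"
      using K0 by (auto intro: mult_left_mono)
    with 1 show ?thesis by (simp add: xx algebra_simps)
  qed

  have conv: "(\<lambda>n. L2_inner (mult_op hp hm (g n)) q) \<longlonglongrightarrow> L2_inner (mult_op hp hm (G q)) q"
  proof -
    \<comment> \<open>With the multiplier moved to \<open>q\<close>, convergence of the clips in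
      norm is enough.\<close>
    let ?z = "mult_op (reflect hp) (reflect hm) q"
    have z: "?z \<in> L2" by (intro mult_op_L2 reflect_Hp h q)
    have "(\<lambda>n. L2_inner (\<lambda>t. G q t - g n t) ?z) \<longlonglongrightarrow> 0"
    proof (rule Lim_null_comparison)
      show "\<forall>\<^sub>F n in sequentially. norm (L2_inner (\<lambda>t. G q t - g n t) ?z) \<le> L2_norm (\<lambda>t. G q t - g n t) * L2_norm ?z"
        using L2_Cauchy_Schwarz[OF L2_diff[OF Gq gL2] z] by simp
      show "(\<lambda>n. L2_norm (\<lambda>t. G q t - g n t) * L2_norm ?z) \<longlonglongrightarrow> 0"
        using tendsto_mult_left_zero[OF L2_clip_tendsto[OF Gq]] by (simp add: g_def)
    qed
    then have "(\<lambda>n. L2_inner (G q) ?z - L2_inner (\<lambda>t. G q t - g n t) ?z) \<longlonglongrightarrow> L2_inner (G q) ?z - 0"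
      by (intro tendsto_diff tendsto_const)
    then show ?thesis
      by (simp add: L2_inner_diff_left Gq gL2 z mult_op_adjoint h q)
  qed

  have "2 * pi * (\<epsilon> * (L2_norm q)\<^sup>2) \<le> 2 * pi * L2_inner (mult_op hp hm (G q)) q + K * \<eta> * x" if \<eta>: "0 < \<eta>" for \<eta>
  proof (rule tendsto_lowerbound)
    show "(\<lambda>n. 2 * pi * L2_inner (mult_op hp hm (g n)) q + K * \<eta> * x)
        \<longlonglongrightarrow> 2 * pi * L2_inner (mult_op hp hm (G q)) q + K * \<eta> * x"
      by (intro tendsto_intros conv)
    have "\<forall>\<^sub>F n in sequentially. (\<integral>\<^sup>+ \<omega>. ennreal ((cmod (Y \<omega> - Z n \<omega>))\<^sup>2) \<partial>lborel) < ennreal (\<eta>\<^sup>2)"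
      using order_tendstoD(2)[OF lim, of "ennreal (\<eta>\<^sup>2)"] \<eta> by simp
    then show "\<forall>\<^sub>F n in sequentially. 2 * pi * (\<epsilon> * (L2_norm q)\<^sup>2)
        \<le> 2 * pi * L2_inner (mult_op hp hm (g n)) q + K * \<eta> * x"
      by eventually_elim (rule lower[OF _ \<eta>])
  qed simp
  then have "2 * pi * (\<epsilon> * (L2_norm q)\<^sup>2)
      \<le> 2 * pi * L2_inner (mult_op hp hm (G q)) q + K * inverse (real (Suc n)) * x" for n
    by simp
  moreover have "(\<lambda>n. 2 * pi * L2_inner (mult_op hp hm (G q)) q + K * inverse (real (Suc n)) * x)
      \<longlonglongrightarrow> 2 * pi * L2_inner (mult_op hp hm (G q)) q + K * 0 * x"
    by (intro tendsto_intros LIMSEQ_inverse_real_of_nat)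
  ultimately have "2 * pi * (\<epsilon> * (L2_norm q)\<^sup>2) \<le> 2 * pi * L2_inner (mult_op hp hm (G q)) q + K * 0 * x"
    by (intro LIMSEQ_le_const) auto
  then show ?thesis by simp
qed

section \<open>Coercivity and stability\<close>

definition approximable :: "(real \<Rightarrow> real) \<Rightarrow> bool" where
  "approximable x \<longleftrightarrow> x \<in> L2 \<and> (\<forall>e>0. \<exists>q. test_fun q \<and> L2_norm (\<lambda>t. x t - q t) \<le> e)"

lemma test_fun_L2: "test_fun q \<Longrightarrow> q \<in> L2"
  by (metis test_funE)

lemma test_fun_zero: "test_fun (\<lambda>t. 0)"
  by (simp add: test_fun_def)

lemma test_fun_lincomb:
  assumes "test_fun p" "test_fun q"
  shows "test_fun (\<lambda>t. a * p t + b * q t)"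
proof -
  obtain R S where R: "\<And>t. R < \<bar>t\<bar> \<Longrightarrow> p t = 0" and S: "\<And>t. S < \<bar>t\<bar> \<Longrightarrow> q t = 0"
    using assms by (auto simp: test_fun_def)
  have "\<forall>t. max R S < \<bar>t\<bar> \<longrightarrow> a * p t + b * q t = 0" using R S by simp
  moreover have "continuous_on UNIV (\<lambda>t. a * p t + b * q t)"
    using assms by (auto simp: test_fun_def intro!: continuous_intros)
  ultimately show ?thesis unfolding test_fun_def by blast
qed

lemma approximable_lincomb:
  assumes x: "approximable x" and y: "approximable y"
  shows "approximable (\<lambda>t. a * x t + b * y t)"
  unfolding approximable_def
proof (intro conjI allI impI)
  have L2: "x \<in> L2" "y \<in> L2" using x y by (auto simp: approximable_def)
  then show "(\<lambda>t. a * x t + b * y t) \<in> L2" by (rule L2_lincomb)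
  fix e :: real assume "0 < e"
  define d where "d = e / (\<bar>a\<bar> + \<bar>b\<bar> + 1)"
  have d: "0 < d" "(\<bar>a\<bar> + \<bar>b\<bar>) * d \<le> e"
    using \<open>0 < e\<close> by (auto simp: d_def field_simps add_pos_nonneg)
  obtain p q where p: "test_fun p" "L2_norm (\<lambda>t. x t - p t) \<le> d"
    and q: "test_fun q" "L2_norm (\<lambda>t. y t - q t) \<le> d"
    using x y d(1) unfolding approximable_def by meson
  have pq: "(\<lambda>t. x t - p t) \<in> L2" "(\<lambda>t. y t - q t) \<in> L2"
    by (intro L2_diff L2 test_fun_L2 p q)+
  have "(\<lambda>t. a * x t + b * y t - (a * p t + b * q t)) = (\<lambda>t. a * (x t - p t) + b * (y t - q t))"
    by (auto simp: algebra_simps)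
  then have "L2_norm (\<lambda>t. a * x t + b * y t - (a * p t + b * q t))
      \<le> \<bar>a\<bar> * L2_norm (\<lambda>t. x t - p t) + \<bar>b\<bar> * L2_norm (\<lambda>t. y t - q t)"
    using L2_norm_add[OF L2_cmult[OF pq(1)] L2_cmult[OF pq(2)], of a b] by (simp add: L2_norm_cmult)
  also have "\<dots> \<le> \<bar>a\<bar> * d + \<bar>b\<bar> * d" using p q by (intro add_mono mult_left_mono) auto
  also have "\<dots> \<le> e" using d(2) by (simp add: distrib_right)
  finally show "\<exists>r. test_fun r \<and> L2_norm (\<lambda>t. a * x t + b * y t - r t) \<le> e"
    using test_fun_lincomb[OF p(1) q(1), of a b] by blast
qed

lemma approximable_zero: "approximable (\<lambda>t. 0)"
  unfolding approximable_def
  by (auto simp: L2_zero L2_norm_def intro!: exI[of _ "\<lambda>t. 0"] test_fun_zero)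

lemma approximable_sum:
  assumes "finite I" "\<And>i. i \<in> I \<Longrightarrow> approximable (f i)"
  shows "approximable (\<lambda>t. \<Sum>i\<in>I. c i * f i t)"
  using assms
proof (induction I rule: finite_induct)
  case empty
  then show ?case by (simp add: approximable_zero)
next
  case (insert i I)
  then show ?case
    using approximable_lincomb[of "f i" "\<lambda>t. \<Sum>i\<in>I. c i * f i t" "c i" 1] by simp
qed

text \<open>Outer regularity of \<open>A\<close> and of its complement leaves an Urysohn function
  equal to 1 on a closed subset of \<open>A\<close> and to 0 outside an open neighbourhood. It
  differs from the indicator, by at most 1, only on two sets of measure below
  \<open>e\<^sup>2 / 2\<close> each.\<close>

lemma approximable_indicator:
  assumes A: "A \<in> sets borel" and b: "A \<subseteq> {-R..R}"
  shows "approximable (\<lambda>t. indicator A t)"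
  unfolding approximable_def
proof (intro conjI allI impI)
  have fin: "emeasure lborel A < \<infinity>"
    using emeasure_mono[OF b, of lborel] by (rule le_less_trans) (simp_all add: emeasure_lborel_Icc_eq)
  then have "integrable lborel (indicator A :: real \<Rightarrow> real)" using A by simp
  then show "(\<lambda>t. indicator A t) \<in> L2"
    using A by (simp add: L2_def power2_eq_square indicator_inter_arith[symmetric])
  note AL2 = this
  fix e :: real assume "0 < e"
  then have e2: "0 < e\<^sup>2 / 2" by simp
  obtain U where U: "open U" "A \<subseteq> U" "emeasure lborel (U - A) < ennreal (e\<^sup>2 / 2)"
    using outer_regular_lborel[OF A e2] by blast
  obtain V where V: "open V" "- A \<subseteq> V" "emeasure lborel (V - - A) < ennreal (e\<^sup>2 / 2)"
    using outer_regular_lborel[OF borel_comp[OF A] e2] by blast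
  \<comment> \<open>Cutting \<open>U\<close> to a bounded interval gives the Urysohn function
    compact support; the margin 1 keeps all of \<open>A\<close> inside the open interval.\<close>
  define W where "W = U \<inter> {- R - 1<..<R + 1}"
  have W: "open W" "A \<subseteq> W" "W - A \<subseteq> U - A" using U b by (auto simp: W_def)
  have "closed (- V)" "closed (- W)" "- V \<inter> - W = {}"
    using V W by (auto simp: closed_def)
  then obtain q :: "real \<Rightarrow> real" where q: "continuous_on UNIV q" "\<And>t. q t \<in> closed_segment 1 0"
    "\<And>t. t \<in> - V \<Longrightarrow> q t = 1" "\<And>t. t \<in> - W \<Longrightarrow> q t = 0"
    using Urysohn[of "- V" "- W" "1 :: real" 0] by metis
  have q01: "0 \<le> q t" "q t \<le> 1" for t using q(2)[of t] by (auto simp: closed_segment_eq_real_ivl)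
  have tq: "test_fun q"
    unfolding test_fun_def
  proof (intro conjI exI allI impI)
    fix t assume "\<bar>R\<bar> + 1 < \<bar>t\<bar>"
    then have "t \<notin> W" by (auto simp: W_def)
    then show "q t = 0" using q(4) by simp
  qed (rule q)
  have UA: "U - A \<in> sets borel" "V - - A \<in> sets borel" using U V A by auto
  let ?i = "\<lambda>t. indicator (U - A) t + indicator (V - - A) t :: real"
  have "integrable lborel (indicator (U - A) :: real \<Rightarrow> real)"
    "integrable lborel (indicator (V - - A) :: real \<Rightarrow> real)"
    using UA less_trans[OF U(3) ennreal_less_top] less_trans[OF V(3) ennreal_less_top]
    by (simp_all del: Diff_Compl)
  note int = this
  have le: "(indicator A t - q t)\<^sup>2 \<le> ?i t" for t
  proof (cases "t \<in> U - A \<or> t \<in> V - - A")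
    case True
    have "\<bar>indicator A t - q t\<bar> \<le> 1" using q01[of t] by (auto simp: indicator_def)
    then have "(indicator A t - q t)\<^sup>2 \<le> 1" by (simp add: abs_square_le_1)
    also have "1 \<le> ?i t" using True by (auto simp: indicator_def)
    finally show ?thesis .
  next
    case False
    then have "indicator A t = q t"
      using q(3)[of t] q(4)[of t] U(2) V(2) W by (cases "t \<in> A") (auto simp: W_def)
    then show ?thesis by (simp add: indicator_def)
  qed
  have m: "measure lborel (U - A) \<le> e\<^sup>2 / 2" "measure lborel (V - - A) \<le> e\<^sup>2 / 2"
    using enn2real_mono[OF less_imp_le[OF U(3)]] enn2real_mono[OF less_imp_le[OF V(3)]]
    unfolding measure_def by simp_all
  have "(LINT t|lborel. (indicator A t - q t)\<^sup>2) \<le> (LINT t|lborel. ?i t)"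
  proof (rule integral_mono)
    show "integrable lborel (\<lambda>t. (indicator A t - q t)\<^sup>2)"
      using L2_diff[OF AL2 test_fun_L2[OF tq]] by (simp add: L2_def)
  qed (use int le in auto)
  also have "\<dots> = measure lborel (U - A) + measure lborel (V - - A)"
    using int by simp
  also have "\<dots> \<le> e\<^sup>2" using m by simp
  finally have "L2_norm (\<lambda>t. indicator A t - q t) \<le> sqrt (e\<^sup>2)"
    unfolding L2_norm_def by (rule real_sqrt_le_mono)
  then show "\<exists>q. test_fun q \<and> L2_norm (\<lambda>t. indicator A t - q t) \<le> e"
    using tq \<open>0 < e\<close> by auto
qed

lemma test_fun_dense:
  assumes x: "x \<in> L2"
  shows "approximable x"
  unfolding approximable_def
proof (intro conjI allI impI)
  show "x \<in> L2" by fact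
  fix e :: real assume "0 < e"
  note [measurable] = L2_measurable[OF x]
  obtain s where s: "\<And>i. simple_function lborel (s i)" "\<And>t. (\<lambda>i. s i t) \<longlonglongrightarrow> x t"
    "\<And>i t. \<bar>s i t\<bar> \<le> 2 * \<bar>x t\<bar>"
    using borel_measurable_implies_sequence_metric[of x lborel 0] by (auto simp: dist_real_def)
  have sm [measurable]: "s i \<in> borel_measurable borel" for i
    using borel_measurable_simple_function[OF s(1)] by simp
  \<comment> \<open>Clipping makes the level sets bounded, as the approximation of indicators
    requires.\<close>
  define w where "w i t = indicator {- real i..real i} t * s i t" for i t
  have wm [measurable]: "w i \<in> borel_measurable borel" for i unfolding w_def by measurable
  have wb: "\<bar>w i t\<bar> \<le> 2 * \<bar>x t\<bar>" for i t
    using s(3)[of i t] by (auto simp: w_def indicator_def)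
  have wa: "approximable (w i)" for i
  proof -
    have fin: "finite (range (s i))" using simple_functionD(1)[OF s(1)] by simp
    have "approximable (\<lambda>t. \<Sum>c\<in>range (s i). c * indicator (s i -` {c} \<inter> {- real i..real i}) t)"
    proof (intro approximable_sum fin approximable_indicator)
      fix c assume "c \<in> range (s i)"
      have "s i -` {c} \<in> sets borel" using measurable_sets[OF sm[of i], of "{c}"] by simp
      then show "s i -` {c} \<inter> {- real i..real i} \<in> sets borel" by auto
    qed auto
    moreover have "(\<Sum>c\<in>range (s i). c * indicator (s i -` {c} \<inter> {- real i..real i}) t) = w i t" for t
    proof -
      have "(\<Sum>c\<in>range (s i). c * indicator (s i -` {c} \<inter> {- real i..real i}) t)
          = (\<Sum>c\<in>range (s i). if c = s i t then w i t else 0)"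
        by (rule sum.cong) (auto simp: indicator_def w_def)
      then show ?thesis using fin by (simp add: sum.delta)
    qed
    ultimately show ?thesis by (simp add: eta_contract_eq)
  qed
  have "(\<lambda>i. LINT t|lborel. (x t - w i t)\<^sup>2) \<longlonglongrightarrow> (LINT t|(lborel :: real measure). 0)"
  proof (rule integral_dominated_convergence)
    \<comment> \<open>\<open>\<bar>x - w\<bar> \<le> 3 * \<bar>x\<bar>\<close> from the bound
      \<open>2 * \<bar>x\<bar>\<close> on \<open>w\<close>, squared.\<close>
    show "integrable lborel (\<lambda>t. 9 * (x t)\<^sup>2)" using x by (simp add: L2_def)
    have "(\<lambda>i. (x t - w i t)\<^sup>2) \<longlonglongrightarrow> 0" for t
    proof -
      obtain m :: nat where "\<bar>t\<bar> \<le> real m" using real_arch_simple by blast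
      then have "\<forall>\<^sub>F i in sequentially. s i t = w i t"
        by (intro eventually_sequentiallyI[of m]) (auto simp: w_def indicator_def)
      from Lim_transform_eventually[OF s(2)[of t] this]
      have "(\<lambda>i. (x t - w i t)\<^sup>2) \<longlonglongrightarrow> (x t - x t)\<^sup>2" by (intro tendsto_intros)
      then show ?thesis by simp
    qed
    then show "AE t in lborel. (\<lambda>i. (x t - w i t)\<^sup>2) \<longlonglongrightarrow> 0" by simp
    have "(x t - w i t)\<^sup>2 \<le> 9 * (x t)\<^sup>2" for i t
    proof -
      have "\<bar>x t - w i t\<bar> \<le> \<bar>3 * x t\<bar>" using wb[of i t] by (simp add: abs_if split: if_splits)
      then have "(x t - w i t)\<^sup>2 \<le> (3 * x t)\<^sup>2" by (simp only: abs_le_square_iff)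
      then show ?thesis by (simp add: power_mult_distrib)
    qed
    then show "AE t in lborel. norm ((x t - w i t)\<^sup>2) \<le> 9 * (x t)\<^sup>2" for i by simp
  qed measurable
  from tendsto_real_sqrt[OF this] have "(\<lambda>i. L2_norm (\<lambda>t. x t - w i t)) \<longlonglongrightarrow> 0"
    by (simp add: L2_norm_def)
  then have "\<forall>\<^sub>F i in sequentially. L2_norm (\<lambda>t. x t - w i t) < e / 2"
    using \<open>0 < e\<close> by (intro order_tendstoD) auto
  then obtain i where i: "L2_norm (\<lambda>t. x t - w i t) < e / 2" by (auto simp: eventually_sequentially)
  have wL2: "w i \<in> L2" using wa[of i] by (simp add: approximable_def)
  obtain q where q: "test_fun q" "L2_norm (\<lambda>t. w i t - q t) \<le> e / 2"
    using wa[of i] \<open>0 < e\<close> unfolding approximable_def by (meson half_gt_zero)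
  have "L2_norm (\<lambda>t. (x t - w i t) + (w i t - q t)) \<le> L2_norm (\<lambda>t. x t - w i t) + L2_norm (\<lambda>t. w i t - q t)"
    by (intro L2_norm_add L2_diff x wL2 test_fun_L2 q)
  then show "\<exists>q. test_fun q \<and> L2_norm (\<lambda>t. x t - q t) \<le> e"
    using q i by (intro exI[of _ q]) simp
qed

text \<open>Both sides are continuous quadratic forms in \<open>q\<close>, so the inequality extends
  from the dense set of test functions.\<close>

lemma coercive_L2:
  assumes h: "hp \<in> Hp_set" "hm \<in> Hp_set"
    and G: "linear_operator G" "stable_operator G" and freq: "frequency_response G Ghat"
    and \<epsilon>: "0 < \<epsilon>" "\<And>\<omega>. \<epsilon> \<le> Re (mult_freq hp hm \<omega> * Ghat \<omega>)"
    and q: "q \<in> L2"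
  shows "\<epsilon> * (L2_norm q)\<^sup>2 \<le> L2_inner (mult_op hp hm (G q)) q"
proof -
  obtain K0 where GL2: "\<And>x. x \<in> L2 \<Longrightarrow> G x \<in> L2"
    and K0: "\<And>x. x \<in> L2 \<Longrightarrow> L2_norm (G x) \<le> K0 * L2_norm x"
    using G(2) unfolding stable_operator_def by blast
  define m where "m = 1 + H_norm hp + H_norm hm"
  define L where "L = m * \<bar>K0\<bar>"
  have m0: "0 \<le> m" using H_norm_Hp[OF h(1)] H_norm_Hp[OF h(2)] by (simp add: m_def)
  have L0: "0 \<le> L" using m0 by (simp add: L_def)
  let ?B = "\<lambda>p r. L2_inner (mult_op hp hm (G p)) r"
  have bound: "\<bar>?B p r\<bar> \<le> L * L2_norm p * L2_norm r" if "p \<in> L2" "r \<in> L2" for p r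
  proof -
    have "\<bar>?B p r\<bar> \<le> L2_norm (mult_op hp hm (G p)) * L2_norm r"
      by (intro L2_Cauchy_Schwarz mult_op_L2 h GL2 that)
    also have "\<dots> \<le> (m * (\<bar>K0\<bar> * L2_norm p)) * L2_norm r"
    proof (rule mult_right_mono)
      have "L2_norm (G p) \<le> \<bar>K0\<bar> * L2_norm p"
        using K0[OF that(1)] by (rule order_trans) (intro mult_right_mono, auto)
      then have "m * L2_norm (G p) \<le> m * (\<bar>K0\<bar> * L2_norm p)" using m0 by (rule mult_left_mono)
      then show "L2_norm (mult_op hp hm (G p)) \<le> m * (\<bar>K0\<bar> * L2_norm p)"
        using mult_op_L2(2)[OF h GL2[OF that(1)]] by (simp add: m_def)
    qed simp
    finally show ?thesis by (simp add: L_def mult.assoc)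
  qed
  \<comment> \<open>For a test function \<open>p\<close> at distance \<open>d\<close> from
    \<open>q\<close>, the first error replaces \<open>q\<close> by \<open>p\<close> in the two slots
    of the form one after the other; the second compares the squared norms.\<close>
  have approx: "\<epsilon> * (L2_norm q)\<^sup>2 \<le> ?B q q + L * d * (2 * L2_norm q + d) + \<epsilon> * (2 * L2_norm q * d + 3 * d\<^sup>2)"
    if d: "0 < d" for d
  proof -
    obtain p where p: "test_fun p" and pd: "L2_norm (\<lambda>t. q t - p t) \<le> d"
      using test_fun_dense[OF q] d unfolding approximable_def by blast
    have pL2: "p \<in> L2" by (rule test_fun_L2[OF p])
    let ?r = "\<lambda>t. q t - p t"
    \<comment> \<open>\<open>G\<close> is linear only up to null sets. Once the multiplier sits on
      the other side, additivity in the first slot reduces to that of the inner product.\<close>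
    let ?z = "mult_op (reflect hp) (reflect hm) q"
    have rL2: "?r \<in> L2" by (intro L2_diff q pL2)
    have zL2: "?z \<in> L2" by (intro mult_op_L2 reflect_Hp h q)
    have np: "L2_norm p \<le> L2_norm q + d"
      using L2_norm_diff[OF q rL2] pd by simp
    have nq: "L2_norm q \<le> L2_norm p + d"
      using L2_norm_add[OF pL2 rL2] pd by simp
    have "AE t in lborel. G (\<lambda>t. 1 * p t + 1 * ?r t) t = 1 * G p t + 1 * G ?r t"
      using G(1)[unfolded linear_operator_def sig_eq_def, rule_format,
          OF L2_subset_L2e[OF pL2] L2_subset_L2e[OF rL2], of 1 1] .
    then have "AE t in lborel. G q t = G p t + G ?r t" by simp
    then have "L2_inner (G q) ?z = L2_inner (\<lambda>t. G p t + G ?r t) ?z"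
      by (rule L2_inner_cong_AE) (intro L2_measurable L2_add GL2 q pL2 rL2 zL2 AE_I2 refl)+
    also have "\<dots> = L2_inner (G p) ?z + L2_inner (G ?r) ?z"
      by (intro L2_inner_add_left GL2 pL2 rL2 zL2)
    finally have "?B q q = ?B p q + ?B ?r q"
      by (simp add: mult_op_adjoint h q GL2 pL2 rL2)
    moreover have "?B p ?r = ?B p q - ?B p p"
      by (intro L2_inner_diff_right mult_op_L2 h GL2 pL2 q)
    ultimately have eq: "?B p p = ?B q q - ?B ?r q - ?B p ?r" by simp
    have "\<bar>?B ?r q\<bar> \<le> L * d * L2_norm q"
      using bound[OF rL2 q] by (rule order_trans) (intro mult_mono, use pd L0 d in auto)
    moreover have "\<bar>?B p ?r\<bar> \<le> L * (L2_norm q + d) * d"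
      using bound[OF pL2 rL2] by (rule order_trans) (intro mult_mono, use pd L0 d np in auto)
    ultimately have 1: "?B p p \<le> ?B q q + L * d * (2 * L2_norm q + d)"
      unfolding eq by (simp add: algebra_simps)
    have 2: "\<epsilon> * (L2_norm p)\<^sup>2 \<le> ?B p p"
      by (rule coercive_test_fun[OF h freq GL2[OF pL2] \<epsilon> p])
    have "(L2_norm q)\<^sup>2 \<le> (L2_norm p + d)\<^sup>2" using nq by (intro power_mono) auto
    also have "\<dots> = (L2_norm p)\<^sup>2 + (2 * L2_norm p * d + d\<^sup>2)" by (simp add: power2_sum)
    also have "\<dots> \<le> (L2_norm p)\<^sup>2 + (2 * (L2_norm q + d) * d + d\<^sup>2)"
      using np d by (intro add_mono mult_right_mono) auto
    finally have "\<epsilon> * (L2_norm q)\<^sup>2 \<le> \<epsilon> * ((L2_norm p)\<^sup>2 + (2 * (L2_norm q + d) * d + d\<^sup>2))"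
      using \<epsilon>(1) by simp
    also have "\<dots> = \<epsilon> * (L2_norm p)\<^sup>2 + \<epsilon> * (2 * L2_norm q * d + 3 * d\<^sup>2)"
      by (simp add: power2_eq_square algebra_simps)
    finally show ?thesis using 1 2 by linarith
  qed
  have "(\<lambda>n. ?B q q + L * inverse (real (Suc n)) * (2 * L2_norm q + inverse (real (Suc n)))
        + \<epsilon> * (2 * L2_norm q * inverse (real (Suc n)) + 3 * (inverse (real (Suc n)))\<^sup>2))
      \<longlonglongrightarrow> ?B q q + L * 0 * (2 * L2_norm q + 0) + \<epsilon> * (2 * L2_norm q * 0 + 3 * 0\<^sup>2)"
    by (intro tendsto_intros LIMSEQ_inverse_real_of_nat)
  then have "\<epsilon> * (L2_norm q)\<^sup>2 \<le> ?B q q + L * 0 * (2 * L2_norm q + 0) + \<epsilon> * (2 * L2_norm q * 0 + 3 * 0\<^sup>2)"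
    by (rule LIMSEQ_le_const) (auto intro!: approx simp del: of_nat_Suc)
  then show ?thesis by simp
qed

section \<open>Sector bounds of the operator and the stability theorem\<close>

lemma in_sector_abs_le:
  assumes f: "mono f" "f 0 = 0" and K: "1 \<le> K" and s: "in_sector f K u y"
  shows "\<bar>y\<bar> \<le> K * \<bar>f u\<bar>"
proof -
  consider "u = 0" | "0 < u" | "u < 0" by linarith
  then show ?thesis
  proof cases
    case 1
    then show ?thesis using s K by (simp add: in_sector_def)
  next
    case 2
    then have "0 \<le> f u" using monoD[OF f(1), of 0 u] f(2) by simp
    then show ?thesis using s 2 by (auto simp: in_sector_def divide_le_cancel)
  next
    case 3
    then have "f u \<le> 0" using monoD[OF f(1), of u 0] f(2) by simp
    then show ?thesis using s 3 by (auto simp: in_sector_def divide_le_cancel)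
  qed
qed

text \<open>The upper function is absorbed into a multiple of the lower one, so that a single
  monotone function, and hence a single potential, governs the sector.\<close>

lemma AE_in_sector:
  assumes "zero_at_zero \<phi>" "nonlinearity_bounded_below \<phi> f" "nonlinearity_bounded_above \<phi> g"
    and "fun_bounded_above g (\<lambda>x. K * f x)" and u: "u \<in> L2e"
  shows "AE t in lborel. in_sector f K (u t) (\<phi> u t)"
proof -
  have "AE t in lborel. u t = 0 \<longrightarrow> \<phi> u t = 0"
    "AE t in lborel. u t \<noteq> 0 \<longrightarrow> f (u t) / u t \<le> \<phi> u t / u t"
    "AE t in lborel. u t \<noteq> 0 \<longrightarrow> \<phi> u t / u t \<le> g (u t) / u t"
    using assms by (auto simp: zero_at_zero_def nonlinearity_bounded_below_def nonlinearity_bounded_above_def)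
  then show ?thesis
  proof eventually_elim
    case (elim t)
    then show ?case
      using assms(4) order_trans unfolding in_sector_def fun_bounded_above_def by blast
  qed
qed

theorem theorem1:
  fixes G \<phi> :: "(real \<Rightarrow> real) \<Rightarrow> (real \<Rightarrow> real)"
    and \<alpha>l \<alpha>u \<beta>l \<beta>u :: "real \<Rightarrow> real"
    and A :: real and B :: ereal
    and hp hm :: gen_fun
  assumes "L2e_operator G" "linear_operator G" "time_invariant G" "causal G" "stable_operator G"
    and "L2e_operator \<phi>"
    and "well_posed G \<phi>"
    and "zero_at_zero \<phi>"
    and "nonlinearity_bounded_below \<phi> \<alpha>l" "nonlinearity_bounded_above \<phi> \<alpha>u"
    and "mono \<alpha>l" "mono \<alpha>u" "bounded_fun \<alpha>l" "bounded_fun \<alpha>u"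
    and "\<And>x. x \<noteq> 0 \<Longrightarrow> \<alpha>l x / x \<ge> 0"
    and "nonlinearity_bounded_below \<phi> \<beta>l" "nonlinearity_bounded_above \<phi> \<beta>u"
    and "mono \<beta>l" "mono \<beta>u" "bounded_fun \<beta>l" "bounded_fun \<beta>u" "odd_fun \<beta>l" "odd_fun \<beta>u"
    and "\<And>x. x \<noteq> 0 \<Longrightarrow> \<beta>l x / x \<ge> 0"
    and "A \<ge> 1" "fun_bounded_above \<alpha>u (\<lambda>x. A * \<alpha>l x)"
    and "B \<ge> ereal A"
    and "B \<noteq> \<infinity> \<Longrightarrow> fun_bounded_above \<beta>u (\<lambda>x. real_of_ereal B * \<beta>l x)"
    and "hp \<in> Hp_set" "hm \<in> Hp_set"
    and "ereal A * ereal (H_norm hp) + B * ereal (H_norm hm) < 1"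
  shows "(\<forall>u\<in>L2. integrable lborel (\<lambda>t. mult_op hp hm u t * \<phi> u t) \<and>
                 (LINT t|lborel. mult_op hp hm u t * \<phi> u t) \<ge> 0) \<and>
         (\<forall>Ghat. frequency_response G Ghat \<longrightarrow>
            (\<exists>\<epsilon>>0. \<forall>\<omega>. Re (mult_freq hp hm \<omega> * Ghat \<omega>) \<ge> \<epsilon>) \<longrightarrow>
            lurye_stable G \<phi>)"
proof -
  note h = \<open>hp \<in> Hp_set\<close> \<open>hm \<in> Hp_set\<close>
  note \<alpha> = \<open>mono \<alpha>l\<close> \<open>bounded_fun \<alpha>l\<close> and \<beta> = \<open>mono \<beta>l\<close> \<open>bounded_fun \<beta>l\<close> \<open>odd_fun \<beta>l\<close>
  \<comment> \<open>For infinite \<open>B\<close> the value 1 is a placeholder: \<open>hm\<close>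
    then has norm zero and any factor at least 1 serves.\<close>
  define K where "K = (if B = \<infinity> then 1 else real_of_ereal B)"
  \<comment> \<open>All that is retained of \<open>\<phi>\<close>. Being a relation between values,
    it also applies to pairs of signals that no single input of \<open>\<phi>\<close> need
    produce.\<close>
  define S where "S u y \<longleftrightarrow> in_sector \<alpha>l A u y \<and> (B \<noteq> \<infinity> \<longrightarrow> in_sector \<beta>l K u y)" for u y
  have hn: "0 \<le> H_norm hp" "0 \<le> H_norm hm" using H_norm_Hp h by auto
  have K: "1 \<le> K" "B \<noteq> \<infinity> \<Longrightarrow> B = ereal K" "B \<noteq> \<infinity> \<Longrightarrow> A \<le> K"
    using \<open>A \<ge> 1\<close> \<open>B \<ge> ereal A\<close> by (cases B; auto simp: K_def)+
  \<comment> \<open>Infinity times a positive norm would be infinite and violate the condition;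
    times zero it is zero, in agreement with the stated convention.\<close>
  have hm0: "H_norm hm = 0" if "B = \<infinity>"
  proof (rule ccontr)
    assume "H_norm hm \<noteq> 0"
    then have "B * ereal (H_norm hm) = \<infinity>" using that hn by simp
    then show False
      using \<open>ereal A * ereal (H_norm hp) + B * ereal (H_norm hm) < 1\<close> by (simp only:) simp
  qed
  have small: "A * H_norm hp + K * H_norm hm < 1"
    using \<open>ereal A * ereal (H_norm hp) + B * ereal (H_norm hm) < 1\<close> K(2) hm0
    by (cases "B = \<infinity>") (auto simp: one_ereal_def zero_ereal_def[symmetric])
  \<comment> \<open>Both factors are at least 1, so the weighted condition implies the plain one,
    which makes \<open>1 - M\<close> a contraction.\<close>
  have \<rho>: "H_norm hp + H_norm hm < 1"
  proof -
    have "H_norm hp \<le> A * H_norm hp" "H_norm hm \<le> K * H_norm hm"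
      using hn \<open>A \<ge> 1\<close> K(1) by (simp_all add: mult_le_cancel_right1)
    then show ?thesis using small by linarith
  qed
  have pos: "0 \<le> L2_inner (mult_op hp hm u) y"
    if "u \<in> L2" "y \<in> L2" "AE t in lborel. S (u t) (y t)" for u y
  proof (rule mult_op_nonneg[OF h that(1,2) \<alpha> \<open>A \<ge> 1\<close> _ \<beta> K(1)])
    show "AE t in lborel. in_sector \<alpha>l A (u t) (y t)"
      using that(3) by eventually_elim (simp add: S_def)
    show "H_norm hm = 0 \<or> (AE t in lborel. in_sector \<beta>l K (u t) (y t))"
    proof (cases "B = \<infinity>")
      case True
      then show ?thesis using hm0 by blast
    next
      case False
      have "AE t in lborel. in_sector \<beta>l K (u t) (y t)"
        using that(3) by eventually_elim (simp add: S_def False)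
      then show ?thesis by blast
    qed
  qed (use small in simp)
  have S: "AE t in lborel. S (u t) (\<phi> u t)" if "u \<in> L2e" for u
  proof -
    have a: "AE t in lborel. in_sector \<alpha>l A (u t) (\<phi> u t)"
      by (rule AE_in_sector[OF \<open>zero_at_zero \<phi>\<close> \<open>nonlinearity_bounded_below \<phi> \<alpha>l\<close>
            \<open>nonlinearity_bounded_above \<phi> \<alpha>u\<close> \<open>fun_bounded_above \<alpha>u (\<lambda>x. A * \<alpha>l x)\<close> that])
    have b: "AE t in lborel. in_sector \<beta>l K (u t) (\<phi> u t)" if "B \<noteq> \<infinity>"
    proof (rule AE_in_sector[OF \<open>zero_at_zero \<phi>\<close> \<open>nonlinearity_bounded_below \<phi> \<beta>l\<close>
            \<open>nonlinearity_bounded_above \<phi> \<beta>u\<close> _ \<open>u \<in> L2e\<close>])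
      show "fun_bounded_above \<beta>u (\<lambda>x. K * \<beta>l x)"
        using \<open>B \<noteq> \<infinity> \<Longrightarrow> fun_bounded_above \<beta>u (\<lambda>x. real_of_ereal B * \<beta>l x)\<close> that by (simp add: K_def)
    qed
    show ?thesis
    proof (cases "B = \<infinity>")
      case True
      then show ?thesis using a by (simp add: S_def)
    next
      case False
      from a b[OF False] show ?thesis by eventually_elim (simp add: S_def)
    qed
  qed
  obtain C0 where C0: "0 \<le> C0" "\<And>x. \<bar>\<alpha>l x\<bar> \<le> C0 * \<bar>x\<bar>"
    using \<alpha>(2) by (auto simp: bounded_fun_def)
  \<comment> \<open>Linear growth of the output in the input. It places \<open>\<phi> u\<close> in
    \<open>L2\<close> and bounds the continued output in the truncation argument.\<close>
  define C where "C = A * C0"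
  have C: "0 \<le> C" using C0 \<open>A \<ge> 1\<close> by (simp add: C_def)
  have SC: "\<bar>b\<bar> \<le> C * \<bar>a\<bar>" if "S a b" for a b
  proof -
    have "\<bar>b\<bar> \<le> A * \<bar>\<alpha>l a\<bar>"
      using that by (intro in_sector_abs_le[OF \<alpha>(1) bounded_fun_zero[OF \<alpha>(2)] \<open>A \<ge> 1\<close>]) (simp add: S_def)
    also have "\<dots> \<le> A * (C0 * \<bar>a\<bar>)" using C0(2) \<open>A \<ge> 1\<close> by (intro mult_left_mono) auto
    finally show ?thesis by (simp add: C_def)
  qed
  have first: "integrable lborel (\<lambda>t. mult_op hp hm u t * \<phi> u t) \<and>
      (LINT t|lborel. mult_op hp hm u t * \<phi> u t) \<ge> 0" if u: "u \<in> L2" for u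
  proof -
    have ue: "u \<in> L2e" by (rule L2_subset_L2e[OF u])
    then have m: "\<phi> u \<in> borel_measurable borel"
      using \<open>L2e_operator \<phi>\<close> by (simp add: L2e_operator_def L2e_def)
    have "AE t in lborel. \<bar>\<phi> u t\<bar> \<le> \<bar>C * u t\<bar>"
      using S[OF ue] by eventually_elim (use SC C in \<open>simp add: abs_mult\<close>)
    then have "\<phi> u \<in> L2" by (rule L2_bound(1)[OF m L2_cmult[OF u]])
    then show ?thesis
      using L2_integrable_mult[OF mult_op_L2(1)[OF h u]] pos[OF u _ S[OF ue]] by (simp add: L2_inner_def)
  qed
  have "lurye_stable G \<phi>"
    if freq: "frequency_response G Ghat" and e: "\<exists>\<epsilon>>0. \<forall>\<omega>. Re (mult_freq hp hm \<omega> * Ghat \<omega>) \<ge> \<epsilon>" for Ghat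
  proof -
    obtain \<epsilon> where \<epsilon>: "0 < \<epsilon>" "\<And>\<omega>. \<epsilon> \<le> Re (mult_freq hp hm \<omega> * Ghat \<omega>)" using e by blast
    have co: "\<epsilon> * (L2_norm q)\<^sup>2 \<le> L2_inner (mult_op hp hm (G q)) q" if "q \<in> L2" for q
      by (rule coercive_L2[OF h \<open>linear_operator G\<close> \<open>stable_operator G\<close> freq \<epsilon> that])
    show ?thesis
    proof (rule lurye_stableI[OF \<open>stable_operator G\<close>])
      fix r1 r2 u1 u2 y1 y2
      assume a: "r1 \<in> L2" "r2 \<in> L2" "u1 \<in> L2e" "u2 \<in> L2e" "y1 \<in> L2e" "y2 \<in> L2e"
        "lurye_eqs G \<phi> r1 r2 u1 u2 y1 y2"
      show "y2 \<in> L2"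
      proof (rule L2_of_trunc_bounded[OF a(6)])
        fix T
        have "\<epsilon> * L2_norm (trunc T y2) \<le> 2 * L2_norm (\<lambda>t. G r1 t + r2 t)"
          by (rule lurye_trunc_bound[OF h \<rho> \<open>L2e_operator G\<close> \<open>linear_operator G\<close> \<open>causal G\<close>
                \<open>stable_operator G\<close> \<open>L2e_operator \<phi>\<close> S C SC pos \<epsilon>(1) co a])
        then show "L2_norm (trunc T y2) \<le> 2 * L2_norm (\<lambda>t. G r1 t + r2 t) / \<epsilon>"
          using \<epsilon>(1) by (simp add: field_simps)
      qed
    qed
  qed
  with first show ?thesis by blast
qed

end
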